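(* Let $\Lambda_1$ and $\Lambda_2$ be normal subshifts. The following assertions are equivalent. (i) The one-sided subshifts $(X_{\Lambda_1},\sigma_{\Lambda_1})$ and $(X_{\Lambda_2},\sigma_{\Lambda_2})$ are topologically conjugate. (ii) There exists an isomorphism $\Phi:\mathcal{O}_{\Lambda_1^{\min}}\to\mathcal{O}_{\Lambda_2^{\min}}$ of $C^*$-algebras such that $\Phi(\mathcal{D}_{\Lambda_1})=\mathcal{D}_{\Lambda_2}$ and $$\Phi\circ\rho^{\Lambda_1,f}_t=\rho^{\Lambda_2,\Phi(f)}_t\circ\Phi\qquad\text{for all } f\in C(X_{\Lambda_1},\mathbb{Z}),\ t\in\mathbb{T}.$$ Here $\mathcal{D}_{\Lambda_i}$ is identified with $C(X_{\Lambda_i})$, and $\Phi(f)$ denotes the element of $C(X_{\Lambda_2},\mathbb{Z})$ which is the image of $f\in C(X_{\Lambda_1},\mathbb{Z})\subset C(X_{\Lambda_1})$ under $\Phi|_{\mathcal{D}_{\Lambda_1}}$.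
   Context: Notation: $\mathbb{Z}_+=\{0,1,2,\dots\}$, $\mathbb{N}=\{1,2,\dots\}$, $\mathbb{T}=\mathbb{R}/\mathbb{Z}$. **Subshifts.** Let $\Sigma=\{1,\dots,N\}$, $N\ge 2$, and let $\bar\sigma$ be the shift on $\Sigma^{\mathbb{Z}}$. A subshift is a closed set $\Lambda\subset\Sigma^{\mathbb{Z}}$ with $\bar\sigma(\Lambda)=\Lambda$. Its one-sided subshift is $X_\Lambda=\{(a_n)_{n\in\mathbb{N}} : (a_n)_{n\in\mathbb{Z}}\in\Lambda\}$ with $\sigma_\Lambda((a_n)_n)=(a_{n+1})_n$. Two one-sided subshifts are topologically conjugate if there is a homeomorphism $h:X_{\Lambda_1}\to X_{\Lambda_2}$ with $h\circ\sigma_{\Lambda_1}=\sigma_{\Lambda_2}\circ h$. $B_k(\Lambda)$ is the set of admissible words of length $k$ ($B_0(\Lambda)$ consists of the empty word) and $B_*(\Lambda)=\bigcup_{k\ge0}B_k(\Lambda)$. For a word $\mu\in B_m(\Lambda)$ put $\Gamma_l^-(\mu)=\{\nu\in B_l(\Lambda):\nu\mu\in B_{l+m}(\Lambda)\}$ and $\Gamma_*^+(\mu)=\{\nu\in B_*(\Lambda):\mu\nu\in B_*(\Lambda)\}$. A word $\mu$ is $l$-synchronizing if $\Gamma_l^-(\mu)=\Gamma_l^-(\mu\xi)$ for all $\xi\in\Gamma_*^+(\mu)$; $S_l(\Lambda)$ is the set of $l$-synchronizing words ($S_0(\Lambda)=B_*(\Lambda)$). $\Lambda$ is irreducible if for all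 $\mu,\nu\in B_*(\Lambda)$ there is $\eta\in B_*(\Lambda)$ with $\mu\eta\nu\in B_*(\Lambda)$. An irreducible $\Lambda$ is $\lambda$-synchronizing if for every $\nu\in B_l(\Lambda)$ and every $k\in\mathbb{N}$ with $k\ge l$ there is $\mu\in S_k(\Lambda)$ with $\nu\mu\in S_{k-l}(\Lambda)$. $\Lambda$ is nontrivial if it is an infinite set. A subshift is **normal** if it is nontrivial, irreducible and $\lambda$-synchronizing. **Minimal $\lambda$-graph system.** For a normal subshift $\Lambda$, let $\mathfrak{L}=\mathfrak{L}_\Lambda^{\min}$ be the following labeled Bratteli diagram with shift $\iota$. Words $\mu,\nu\in S_l(\Lambda)$ are $l$-past equivalent if $\Gamma_l^-(\mu)=\Gamma_l^-(\nu)$; the vertex set $V_l$ ($l\in\mathbb{Z}_+$) is the (finite) set of classes $[\mu]_l$, $\mu\in S_l(\Lambda)$. For $\nu\in S_{l+1}(\Lambda)$ and $\alpha\in\Sigma$ with $\alpha\nu\in B_*(\Lambda)$ there is one edge in $E_{l,l+1}$ with source $[\alpha\nu]_l\in V_l$, terminal $[\nu]_{l+1}\in V_{l+1}$ and label $\alpha$ (edges being determined by source, label, terminal). The surjection $\iota:V_{l+1}\to V_l$ is $[\nu]_{l+1}\mapsto[\nu]_l$. For an edge $e$ write $s(e),t(e),\lambda(e)$ for source, terminal, label. This system is left-resolving: an edge in $E_{l,l+1}$ is determined by its label and terminal. **Groupoid.** $\Omega_{\mathfrak L}=\{(v^l)_{l\in\mathbb{Z}_+}\in\prod_l V_l:\iota(v^{l+1})=v^l\}$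 (projective limit topology). $E_{\mathfrak L}$ is the set of $(u,\alpha,v)\in\Omega_{\mathfrak L}\times\Sigma\times\Omega_{\mathfrak L}$ such that for each $l\in\mathbb{Z}_+$ there is $e\in E_{l,l+1}$ with $s(e)=u^l$, $t(e)=v^{l+1}$, $\lambda(e)=\alpha$. $X_{\mathfrak L}$ is the set of $(\alpha_i,v_i)_{i\in\mathbb{N}}\in\prod_{i\in\mathbb{N}}(\Sigma\times\Omega_{\mathfrak L})$ with $(v_i,\alpha_{i+1},v_{i+1})\in E_{\mathfrak L}$ for all $i\in\mathbb{N}$ and $(v_0,\alpha_1,v_1)\in E_{\mathfrak L}$ for some $v_0\in\Omega_{\mathfrak L}$ (relative product topology); $\sigma_{\mathfrak L}$ is the shift on $X_{\mathfrak L}$, and $\pi_{\mathfrak L}:X_{\mathfrak L}\to X_\Lambda$, $\pi_{\mathfrak L}((\alpha_i,v_i)_i)=(\alpha_i)_i$, is a continuous surjection intertwining the shifts. $G_{\mathfrak L}=\{(x,p-q,z)\in X_{\mathfrak L}\times\mathbb{Z}\times X_{\mathfrak L}: p,q\in\mathbb{Z}_+,\ \sigma_{\mathfrak L}^p(x)=\sigma_{\mathfrak L}^q(z)\}$ is the Deaconu–Renault groupoid, with $(x,n,z)(z,m,w)=(x,n+m,w)$, $(x,n,z)^{-1}=(z,-n,x)$, and the étale topology with basis $\{(x,p-q,z): x\in U, z\in V,\sigma_{\mathfrak L}^p(x)=\sigma_{\mathfrak L}^q(z)\}$ for open $U,V$ on which $\sigma_{\mathfrak L}^p,\sigma_{\mathfrak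 L}^q$ respectively are homeomorphisms onto the same open set. The unit space is identified with $X_{\mathfrak L}$. **$C^*$-algebra.** $\mathcal{O}_{\Lambda^{\min}}:=C^*_r(G_{\mathfrak L})$, the reduced groupoid $C^*$-algebra, acting by convolution on the Hilbert $C(X_{\mathfrak L})$-module $\ell^2(G_{\mathfrak L})$ (completion of $C_c(G_{\mathfrak L})$ for $\langle\xi,\eta\rangle(z)=\sum_{(x,n,z)}\overline{\xi(x,n,z)}\eta(x,n,z)$). For $\alpha\in\Sigma$ let $S_\alpha$ be the image of the characteristic function of $\{(x,1,\sigma_{\mathfrak L}(x)): x=(\alpha_i,v_i)_i\in X_{\mathfrak L},\ \alpha_1=\alpha\}$, and $S_\mu=S_{\mu_1}\cdots S_{\mu_m}$ for $\mu=(\mu_1,\dots,\mu_m)$. $\mathcal{D}_\Lambda$ is the $C^*$-subalgebra generated by all $S_\mu S_\mu^*$, $\mu\in B_*(\Lambda)$; it is identified with $C(X_\Lambda)$, where $g\in C(X_\Lambda)$ corresponds to $g\circ\pi_{\mathfrak L}\in C(X_{\mathfrak L})=C(G_{\mathfrak L}^{(0)})\subset\mathcal{O}_{\Lambda^{\min}}$. **Gauge action with potential.** For $f\in C(X_\Lambda,\mathbb{Z})$ put $\tilde f=f\circ\pi_{\mathfrak L}$, $\tilde f^n(x)=\sum_{i=0}^{n-1}\tilde f(\sigma_{\mathfrak L}^i(x))$ (with $\tilde f^0=0$), and let $\tilde f_G(x,p-q,z)=\tilde f^p(x)-\tilde f^q(z)$ whenever $\sigma_{\mathfrak L}^p(x)=\sigma_{\mathfrak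 L}^q(z)$, a well-defined continuous homomorphism $G_{\mathfrak L}\to\mathbb{Z}$. With unitaries $[U_t\xi](\gamma)=\exp(2\pi\sqrt{-1}\,\tilde f_G(\gamma)t)\xi(\gamma)$ on $\ell^2(G_{\mathfrak L})$, $\rho^{\Lambda,f}_t:=\mathrm{Ad}(U_t)\in\mathrm{Aut}(\mathcal{O}_{\Lambda^{\min}})$, $t\in\mathbb{T}$. In particular $\rho^{\Lambda,f}_t(S_\alpha)=\exp(2\pi\sqrt{-1}ft)S_\alpha$. *)

theory Defs
  imports "HOL-Analysis.Analysis"
begin

section \<open>Subshifts\<close>

text \<open>The alphabet is the set \<open>{1..N}\<close> of natural numbers. The topologies of \<open>nat\<close> and \<open>int\<close> are
  discrete, and the class topology on a function type is the product topology.\<close>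

definition subshift :: "nat \<Rightarrow> (int \<Rightarrow> nat) set \<Rightarrow> bool" where
  "subshift N L \<longleftrightarrow> N \<ge> 2 \<and> L \<subseteq> (UNIV \<rightarrow> {1..N}) \<and> closed L \<and> (\<lambda>a n. a (n + 1)) ` L = L"

text \<open>One-sided sequences \<open>(a\<^sub>n)\<close>, \<open>n = 1, 2, \<dots>\<close>, are functions on \<open>nat\<close> whose value at \<open>i\<close> is
  the entry with index \<open>i + 1\<close>.\<close>

definition one_sided :: "(int \<Rightarrow> nat) set \<Rightarrow> (nat \<Rightarrow> nat) set" where
  "one_sided L = (\<lambda>a i. a (int i + 1)) ` L"

definition shift :: "(nat \<Rightarrow> 'a) \<Rightarrow> nat \<Rightarrow> 'a" where
  "shift x = (\<lambda>i. x (Suc i))"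

definition one_sided_conjugate :: "(int \<Rightarrow> nat) set \<Rightarrow> (int \<Rightarrow> nat) set \<Rightarrow> bool" where
  "one_sided_conjugate L1 L2 \<longleftrightarrow>
     (\<exists>h. homeomorphic_map (top_of_set (one_sided L1)) (top_of_set (one_sided L2)) h \<and>
          (\<forall>x\<in>one_sided L1. h (shift x) = shift (h x)))"

definition words :: "(int \<Rightarrow> nat) set \<Rightarrow> nat \<Rightarrow> nat list set" where
  "words L k = {map (\<lambda>j. a (i + int j)) [0..<k] | a i. a \<in> L}"

definition all_words :: "(int \<Rightarrow> nat) set \<Rightarrow> nat list set" where
  "all_words L = (\<Union>k. words L k)"

definition past :: "(int \<Rightarrow> nat) set \<Rightarrow> nat \<Rightarrow> nat list \<Rightarrow> nat list set" where
  "past L l \<mu> = {\<nu> \<in> words L l. \<nu> @ \<mu> \<in> words L (l + length \<mu>)}"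

definition follower :: "(int \<Rightarrow> nat) set \<Rightarrow> nat list \<Rightarrow> nat list set" where
  "follower L \<mu> = {\<nu> \<in> all_words L. \<mu> @ \<nu> \<in> all_words L}"

definition sync :: "(int \<Rightarrow> nat) set \<Rightarrow> nat \<Rightarrow> nat list set" where
  "sync L l = {\<mu> \<in> all_words L. \<forall>\<xi>\<in>follower L \<mu>. past L l \<mu> = past L l (\<mu> @ \<xi>)}"

definition irreducible_subshift :: "(int \<Rightarrow> nat) set \<Rightarrow> bool" where
  "irreducible_subshift L \<longleftrightarrow>
     (\<forall>\<mu>\<in>all_words L. \<forall>\<nu>\<in>all_words L. \<exists>\<eta>\<in>all_words L. \<mu> @ \<eta> @ \<nu> \<in> all_words L)"

definition lambda_synchronizing :: "(int \<Rightarrow> nat) set \<Rightarrow> bool" where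
  "lambda_synchronizing L \<longleftrightarrow> irreducible_subshift L \<and>
     (\<forall>l. \<forall>\<nu>\<in>words L l. \<forall>k\<ge>1. k \<ge> l \<longrightarrow> (\<exists>\<mu>\<in>sync L k. \<nu> @ \<mu> \<in> sync L (k - l)))"

definition normal_subshift :: "nat \<Rightarrow> (int \<Rightarrow> nat) set \<Rightarrow> bool" where
  "normal_subshift N L \<longleftrightarrow>
     subshift N L \<and> infinite L \<and> irreducible_subshift L \<and> lambda_synchronizing L"


section \<open>The minimal \<open>\<lambda>\<close>-graph system\<close>

definition past_class :: "(int \<Rightarrow> nat) set \<Rightarrow> nat \<Rightarrow> nat list \<Rightarrow> nat list set" where
  "past_class L l \<mu> = {\<mu>' \<in> sync L l. past L l \<mu>' = past L l \<mu>}"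

definition vertices :: "(int \<Rightarrow> nat) set \<Rightarrow> nat \<Rightarrow> nat list set set" where
  "vertices L l = past_class L l ` sync L l"

text \<open>Edges between levels \<open>l\<close> and \<open>l + 1\<close> are triples (source, label, terminal).\<close>

definition edges :: "(int \<Rightarrow> nat) set \<Rightarrow> nat \<Rightarrow> (nat list set \<times> nat \<times> nat list set) set" where
  "edges L l = {(past_class L l (\<alpha> # \<nu>), \<alpha>, past_class L (Suc l) \<nu>) | \<alpha> \<nu>.
                  \<nu> \<in> sync L (Suc l) \<and> \<alpha> # \<nu> \<in> all_words L}"

text \<open>On \<open>vertices L (l + 1)\<close> the image below is a singleton, as words with the same
  \<open>(l + 1)\<close>-past have the same \<open>l\<close>-past.\<close>

definition iota :: "(int \<Rightarrow> nat) set \<Rightarrow> nat \<Rightarrow> nat list set \<Rightarrow> nat list set" where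
  "iota L l C = the_elem (past_class L l ` C)"

type_synonym vertex_seq = "nat \<Rightarrow> nat list set"

definition Omega :: "(int \<Rightarrow> nat) set \<Rightarrow> vertex_seq set" where
  "Omega L = {v. \<forall>l. v l \<in> vertices L l \<and> iota L l (v (Suc l)) = v l}"

definition Omega_top :: "(int \<Rightarrow> nat) set \<Rightarrow> vertex_seq topology" where
  "Omega_top L =
     subtopology (product_topology (\<lambda>l. discrete_topology (vertices L l)) UNIV) (Omega L)"

definition E_graph :: "(int \<Rightarrow> nat) set \<Rightarrow> (vertex_seq \<times> nat \<times> vertex_seq) set" where
  "E_graph L = {(u, \<alpha>, v). u \<in> Omega L \<and> v \<in> Omega L \<and> (\<forall>l. (u l, \<alpha>, v (Suc l)) \<in> edges L l)}"

text \<open>As for \<^const>\<open>one_sided\<close>, the value of \<open>x\<close> at \<open>i\<close> is the pair with index \<open>i + 1\<close>.\<close>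

type_synonym lpath = "nat \<Rightarrow> nat \<times> vertex_seq"

definition X_set :: "(int \<Rightarrow> nat) set \<Rightarrow> lpath set" where
  "X_set L = {x. (\<forall>i. (snd (x i), fst (x (Suc i)), snd (x (Suc i))) \<in> E_graph L) \<and>
                 (\<exists>v0. (v0, fst (x 0), snd (x 0)) \<in> E_graph L)}"

definition X_top :: "(int \<Rightarrow> nat) set \<Rightarrow> lpath topology" where
  "X_top L =
     subtopology (product_topology (\<lambda>_. prod_topology (discrete_topology UNIV) (Omega_top L)) UNIV)
       (X_set L)"

definition labels :: "lpath \<Rightarrow> nat \<Rightarrow> nat" where
  "labels x = (\<lambda>i. fst (x i))"


section \<open>Deaconu--Renault groupoids and their reduced \<open>C\<^sup>*\<close>-algebras\<close>

text \<open>Below, \<open>X\<close> is the unit space and \<open>s\<close> is a local homeomorphism on it.\<close>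

type_synonym 'x arrow = "'x \<times> int \<times> 'x"
type_synonym 'x vec = "'x arrow \<Rightarrow> complex"
type_synonym 'x oper = "'x vec \<Rightarrow> 'x vec"

definition arrows :: "'x topology \<Rightarrow> ('x \<Rightarrow> 'x) \<Rightarrow> 'x arrow set" where
  "arrows X s = {(x, int p - int q, z) | x z p q.
                   x \<in> topspace X \<and> z \<in> topspace X \<and> (s ^^ p) x = (s ^^ q) z}"

definition basic_set ::
  "'x topology \<Rightarrow> ('x \<Rightarrow> 'x) \<Rightarrow> 'x set \<Rightarrow> nat \<Rightarrow> nat \<Rightarrow> 'x set \<Rightarrow> 'x arrow set" where
  "basic_set X s U p q V = {(x, int p - int q, z) | x z. x \<in> U \<and> z \<in> V \<and> (s ^^ p) x = (s ^^ q) z}"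

definition arrow_top :: "'x topology \<Rightarrow> ('x \<Rightarrow> 'x) \<Rightarrow> 'x arrow topology" where
  "arrow_top X s = topology_generated_by
     {basic_set X s U p q V | U p q V. openin X U \<and> openin X V \<and>
        (\<exists>W. openin X W \<and>
             homeomorphic_map (subtopology X U) (subtopology X W) (s ^^ p) \<and>
             homeomorphic_map (subtopology X V) (subtopology X W) (s ^^ q))}"

text \<open>The pairs of composable arrows with product \<open>\<gamma>\<close>.\<close>

definition factorizations ::
  "'x topology \<Rightarrow> ('x \<Rightarrow> 'x) \<Rightarrow> 'x arrow \<Rightarrow> ('x arrow \<times> 'x arrow) set" where
  "factorizations X s \<gamma> = {((x, n, z), (z, m, w)) | x n z m w.
     (x, n, z) \<in> arrows X s \<and> (z, m, w) \<in> arrows X s \<and> (x, n + m, w) = \<gamma>}"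

text \<open>Functions on the groupoid are extended by \<open>0\<close> to the whole type.\<close>

definition Cc :: "'x topology \<Rightarrow> ('x \<Rightarrow> 'x) \<Rightarrow> 'x vec set" where
  "Cc X s = {f. (\<forall>\<gamma>. \<gamma> \<notin> arrows X s \<longrightarrow> f \<gamma> = 0) \<and>
                continuous_map (arrow_top X s) euclidean f \<and>
                compactin (arrow_top X s) (arrow_top X s closure_of {\<gamma>. f \<gamma> \<noteq> 0})}"

definition source_fibre :: "'x topology \<Rightarrow> ('x \<Rightarrow> 'x) \<Rightarrow> 'x \<Rightarrow> 'x arrow set" where
  "source_fibre X s z = {\<gamma> \<in> arrows X s. snd (snd \<gamma>) = z}"

definition module_inner ::
  "'x topology \<Rightarrow> ('x \<Rightarrow> 'x) \<Rightarrow> 'x vec \<Rightarrow> 'x vec \<Rightarrow> 'x \<Rightarrow> complex" where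
  "module_inner X s \<xi> \<eta> z = (\<Sum>\<^sub>\<infinity>\<gamma>\<in>source_fibre X s z. cnj (\<xi> \<gamma>) * \<eta> \<gamma>)"

text \<open>The norm of the Hilbert module is the square root of the supremum norm of
  \<open>module_inner X s \<xi> \<xi>\<close>. The following predicate expresses that it is at most \<open>c\<close>; it is false
  for functions of infinite norm.\<close>

definition module_norm_le :: "'x topology \<Rightarrow> ('x \<Rightarrow> 'x) \<Rightarrow> 'x vec \<Rightarrow> real \<Rightarrow> bool" where
  "module_norm_le X s \<xi> c \<longleftrightarrow> 0 \<le> c \<and>
     (\<forall>z\<in>topspace X. (\<lambda>\<gamma>. (cmod (\<xi> \<gamma>))\<^sup>2) summable_on source_fibre X s z \<and>
                     (\<Sum>\<^sub>\<infinity>\<gamma>\<in>source_fibre X s z. (cmod (\<xi> \<gamma>))\<^sup>2) \<le> c\<^sup>2)"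

text \<open>The functions on the groupoid with finite norm form a Banach space, so the completion of
  \<open>Cc X s\<close> is its closure there.\<close>

definition l2 :: "'x topology \<Rightarrow> ('x \<Rightarrow> 'x) \<Rightarrow> 'x vec set" where
  "l2 X s = {\<xi>. (\<forall>\<gamma>. \<gamma> \<notin> arrows X s \<longrightarrow> \<xi> \<gamma> = 0) \<and>
                (\<forall>\<epsilon>>0. \<exists>f\<in>Cc X s. module_norm_le X s (\<lambda>\<gamma>. \<xi> \<gamma> - f \<gamma>) \<epsilon>)}"

text \<open>Maps of the Hilbert module to itself; they are extended by \<open>0\<close>, so that two of them are
  equal if and only if they agree on \<open>l2 X s\<close>.\<close>

definition operators :: "'x topology \<Rightarrow> ('x \<Rightarrow> 'x) \<Rightarrow> 'x oper set" where
  "operators X s = {T. (\<forall>\<xi>\<in>l2 X s. T \<xi> \<in> l2 X s) \<and> (\<forall>\<xi>. \<xi> \<notin> l2 X s \<longrightarrow> T \<xi> = (\<lambda>_. 0))}"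

definition restrict_op :: "'x topology \<Rightarrow> ('x \<Rightarrow> 'x) \<Rightarrow> 'x oper \<Rightarrow> 'x oper" where
  "restrict_op X s T = (\<lambda>\<xi>. if \<xi> \<in> l2 X s then T \<xi> else (\<lambda>_. 0))"

definition op_add :: "'x oper \<Rightarrow> 'x oper \<Rightarrow> 'x oper" where
  "op_add S T = (\<lambda>\<xi> \<gamma>. S \<xi> \<gamma> + T \<xi> \<gamma>)"

definition op_diff :: "'x oper \<Rightarrow> 'x oper \<Rightarrow> 'x oper" where
  "op_diff S T = (\<lambda>\<xi> \<gamma>. S \<xi> \<gamma> - T \<xi> \<gamma>)"

definition op_scale :: "complex \<Rightarrow> 'x oper \<Rightarrow> 'x oper" where
  "op_scale c T = (\<lambda>\<xi> \<gamma>. c * T \<xi> \<gamma>)"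

definition is_adjoint :: "'x topology \<Rightarrow> ('x \<Rightarrow> 'x) \<Rightarrow> 'x oper \<Rightarrow> 'x oper \<Rightarrow> bool" where
  "is_adjoint X s T S \<longleftrightarrow>
     (\<forall>\<xi>\<in>l2 X s. \<forall>\<eta>\<in>l2 X s. \<forall>z\<in>topspace X.
        module_inner X s (T \<xi>) \<eta> z = module_inner X s \<xi> (S \<eta>) z)"

definition adjointables :: "'x topology \<Rightarrow> ('x \<Rightarrow> 'x) \<Rightarrow> 'x oper set" where
  "adjointables X s = {T \<in> operators X s. \<exists>S\<in>operators X s. is_adjoint X s T S}"

definition op_star :: "'x topology \<Rightarrow> ('x \<Rightarrow> 'x) \<Rightarrow> 'x oper \<Rightarrow> 'x oper" where
  "op_star X s T = (THE S. S \<in> operators X s \<and> is_adjoint X s T S)"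

definition op_norm_le :: "'x topology \<Rightarrow> ('x \<Rightarrow> 'x) \<Rightarrow> 'x oper \<Rightarrow> real \<Rightarrow> bool" where
  "op_norm_le X s T c \<longleftrightarrow>
     (\<forall>\<xi>\<in>l2 X s. \<forall>r. module_norm_le X s \<xi> r \<longrightarrow> module_norm_le X s (T \<xi>) (c * r))"

definition conv_op :: "'x topology \<Rightarrow> ('x \<Rightarrow> 'x) \<Rightarrow> 'x vec \<Rightarrow> 'x oper" where
  "conv_op X s f =
     restrict_op X s (\<lambda>\<xi> \<gamma>. \<Sum>\<^sub>\<infinity>(\<beta>, \<delta>)\<in>factorizations X s \<gamma>. f \<beta> * \<xi> \<delta>)"

definition reduced_cstar :: "'x topology \<Rightarrow> ('x \<Rightarrow> 'x) \<Rightarrow> 'x oper set" where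
  "reduced_cstar X s = {T \<in> adjointables X s.
     \<forall>\<epsilon>>0. \<exists>f\<in>Cc X s. op_norm_le X s (op_diff T (conv_op X s f)) \<epsilon>}"

definition cstar_subalgebra :: "'x topology \<Rightarrow> ('x \<Rightarrow> 'x) \<Rightarrow> 'x oper set \<Rightarrow> bool" where
  "cstar_subalgebra X s B \<longleftrightarrow> B \<subseteq> reduced_cstar X s \<and> B \<noteq> {} \<and>
     (\<forall>S\<in>B. \<forall>T\<in>B. op_add S T \<in> B \<and> S \<circ> T \<in> B) \<and>
     (\<forall>c. \<forall>T\<in>B. op_scale c T \<in> B) \<and>
     (\<forall>T\<in>B. op_star X s T \<in> B) \<and>
     (\<forall>T\<in>reduced_cstar X s.
        (\<forall>\<epsilon>>0. \<exists>S\<in>B. op_norm_le X s (op_diff T S) \<epsilon>) \<longrightarrow> T \<in> B)"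

definition cstar_generated :: "'x topology \<Rightarrow> ('x \<Rightarrow> 'x) \<Rightarrow> 'x oper set \<Rightarrow> 'x oper set" where
  "cstar_generated X s A = \<Inter>{B. cstar_subalgebra X s B \<and> A \<subseteq> B}"

definition cstar_isomorphism ::
  "'x topology \<Rightarrow> ('x \<Rightarrow> 'x) \<Rightarrow> 'y topology \<Rightarrow> ('y \<Rightarrow> 'y) \<Rightarrow> ('x oper \<Rightarrow> 'y oper) \<Rightarrow> bool" where
  "cstar_isomorphism X s Y r \<Phi> \<longleftrightarrow>
     bij_betw \<Phi> (reduced_cstar X s) (reduced_cstar Y r) \<and>
     (\<forall>S\<in>reduced_cstar X s. \<forall>T\<in>reduced_cstar X s.
        \<Phi> (op_add S T) = op_add (\<Phi> S) (\<Phi> T) \<and> \<Phi> (S \<circ> T) = \<Phi> S \<circ> \<Phi> T) \<and>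
     (\<forall>c. \<forall>T\<in>reduced_cstar X s. \<Phi> (op_scale c T) = op_scale c (\<Phi> T)) \<and>
     (\<forall>T\<in>reduced_cstar X s. \<Phi> (op_star X s T) = op_star Y r (\<Phi> T))"

text \<open>On arrows the value does not depend on the choice of \<open>p\<close> and \<open>q\<close>.\<close>

definition cocycle :: "('x \<Rightarrow> 'x) \<Rightarrow> ('x \<Rightarrow> int) \<Rightarrow> 'x arrow \<Rightarrow> int" where
  "cocycle s F = (\<lambda>(x, n, z). THE k. \<exists>p q. n = int p - int q \<and> (s ^^ p) x = (s ^^ q) z \<and>
      k = (\<Sum>i<p. F ((s ^^ i) x)) - (\<Sum>i<q. F ((s ^^ i) z)))"

definition gauge_unitary ::
  "'x topology \<Rightarrow> ('x \<Rightarrow> 'x) \<Rightarrow> ('x \<Rightarrow> int) \<Rightarrow> real \<Rightarrow> 'x oper" where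
  "gauge_unitary X s F t = restrict_op X s
     (\<lambda>\<xi> \<gamma>. exp (2 * of_real pi * \<i> * of_int (cocycle s F \<gamma>) * of_real t) * \<xi> \<gamma>)"


section \<open>The algebra of a normal subshift\<close>

definition O_min :: "(int \<Rightarrow> nat) set \<Rightarrow> lpath oper set" where
  "O_min L = reduced_cstar (X_top L) shift"

definition S_letter :: "(int \<Rightarrow> nat) set \<Rightarrow> nat \<Rightarrow> lpath oper" where
  "S_letter L \<alpha> = conv_op (X_top L) shift
     (indicator {(x, 1, shift x) | x. x \<in> X_set L \<and> fst (x 0) = \<alpha>})"

definition S_word :: "(int \<Rightarrow> nat) set \<Rightarrow> nat list \<Rightarrow> lpath oper" where
  "S_word L \<mu> = foldr (\<lambda>\<alpha> T. S_letter L \<alpha> \<circ> T) \<mu> (restrict_op (X_top L) shift id)"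

definition D_alg :: "(int \<Rightarrow> nat) set \<Rightarrow> lpath oper set" where
  "D_alg L = cstar_generated (X_top L) shift
     {S_word L \<mu> \<circ> op_star (X_top L) shift (S_word L \<mu>) | \<mu>. \<mu> \<in> all_words L}"

text \<open>The element of \<open>D_alg L\<close> identified with \<open>g \<in> C(X\<^sub>\<Lambda>)\<close>: convolution by \<open>g \<circ> \<pi>\<close>, supported on
  the unit space.\<close>

definition diag_elem :: "(int \<Rightarrow> nat) set \<Rightarrow> ((nat \<Rightarrow> nat) \<Rightarrow> complex) \<Rightarrow> lpath oper" where
  "diag_elem L g = conv_op (X_top L) shift
     (\<lambda>(x, n, z). if x \<in> X_set L \<and> n = 0 \<and> z = x then g (labels x) else 0)"

text \<open>\<open>C(X\<^sub>\<Lambda>, \<int>)\<close>, with functions undefined outside \<open>X\<^sub>\<Lambda>\<close>.\<close>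

definition CZ :: "(int \<Rightarrow> nat) set \<Rightarrow> ((nat \<Rightarrow> nat) \<Rightarrow> int) set" where
  "CZ L = {f \<in> extensional (one_sided L). continuous_on (one_sided L) f}"

definition gauge_action :: "(int \<Rightarrow> nat) set \<Rightarrow> ((nat \<Rightarrow> nat) \<Rightarrow> int) \<Rightarrow> real \<Rightarrow> lpath oper \<Rightarrow> lpath oper"
  where
  "gauge_action L f t T =
     (let U = gauge_unitary (X_top L) shift (f \<circ> labels) t
      in U \<circ> T \<circ> op_star (X_top L) shift U)"

definition image_potential ::
  "(int \<Rightarrow> nat) set \<Rightarrow> (int \<Rightarrow> nat) set \<Rightarrow> (lpath oper \<Rightarrow> lpath oper) \<Rightarrow>
   ((nat \<Rightarrow> nat) \<Rightarrow> int) \<Rightarrow> (nat \<Rightarrow> nat) \<Rightarrow> int" where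
  "image_potential L1 L2 \<Phi> f = (THE g. g \<in> CZ L2 \<and>
     diag_elem L2 (\<lambda>y. of_int (g y)) = \<Phi> (diag_elem L1 (\<lambda>x. of_int (f x))))"

end

theory Submission
  imports Defs
begin

text \<open>From the subshift to the algebra: the vertices, edges and \<open>\<iota>\<close> of the minimal \<open>\<lambda>\<close>-graph system
  can be read off from those points of \<open>X\<^sub>\<Lambda>\<close> whose set of \<open>l\<close>-pasts is locally constant, and the points
  of \<open>X\<^sub>L\<close> are the limits of such points. A one-sided conjugacy \<open>h\<close> is a sliding block code and
  the \<open>l\<close>-pasts of \<open>h x\<close> depend only on those of \<open>x\<close> and on finitely many letters of \<open>x\<close>, so \<open>h\<close> lifts
  to a conjugacy of the path spaces, along which the whole construction is transported.

  From the algebra to the subshift: \<open>\<Phi>\<close> maps the projections \<open>1\<^sub>V\<close>, \<open>V\<close> clopen, bijectively onto those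
  of the other diagonal, which by Stone duality comes from a homeomorphism \<open>h\<close>. Let
  \<open>T = \<Phi>(S\<^sub>\<alpha>)\<close>, viewed as a function on the groupoid. For the potentials \<open>b - b \<circ> \<sigma>\<close> the gauge action
  is given by a coboundary, and equivariance shows that \<open>T(x, n, z) \<noteq> 0\<close> forces \<open>b(z) = b(\<sigma> x)\<close>.
  Hence \<open>(b \<circ> \<sigma>) T = T b\<close>. Comparing this with the image of \<open>(a \<circ> \<sigma>) S\<^sub>\<alpha> = S\<^sub>\<alpha> a\<close>,
  the projection onto the set where \<open>\<Phi>(a \<circ> \<sigma>)\<close> and \<open>\<Phi>(a) \<circ> \<sigma>\<close> differ annihilates all \<open>\<Phi>(S\<^sub>\<alpha>)\<close>,
  so it is \<open>0\<close>, and \<open>h\<close> commutes with the shifts.\<close>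

section \<open>Points of one-sided subshifts\<close>

text \<open>Equivariance is tested only at t = 1/2 and for potentials b - b \<circ> \<sigma> with b
  the indicator of a clopen set. There the phase exp(\<pi> i k) is 1 or -1, so the multiplier
  exp(\<pi> i f) is a combination of finitely many projections and its image under \<Phi> follows by
  linearity; and parity is enough to recover a function b with values 0 and 1. To view an operator
  as a function on the groupoid means to apply it to \<open>e0\<close>, the indicator of the units:
  elements of the reduced algebra are determined by the result. In the other direction the obstacle
  is that a vertex sequence is given only level by level, with representing points that may vary
  with the level. Every construction is therefore made at a finite level on a synchronizing
  representative and shown to be independent of it. Prepending a letter costs one level, which is
  why approximations carry one parameter for the number of steps and another for the level.\<close>

definition pre :: "nat \<Rightarrow> (nat \<Rightarrow> 'a) \<Rightarrow> 'a list" where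
  "pre k x = map x [0..<k]"

definition app :: "'a list \<Rightarrow> (nat \<Rightarrow> 'a) \<Rightarrow> nat \<Rightarrow> 'a" where
  "app \<nu> x = (\<lambda>i. if i < length \<nu> then \<nu> ! i else x (i - length \<nu>))"

lemma length_pre [simp]: "length (pre k x) = k"
  by (simp add: pre_def)

lemma nth_pre [simp]: "i < k \<Longrightarrow> pre k x ! i = x i"
  by (simp add: pre_def)

lemma pre_0 [simp]: "pre 0 x = []"
  by (simp add: pre_def)

lemma pre_eq_iff: "pre k x = pre k y \<longleftrightarrow> (\<forall>i<k. x i = y i)"
  by (auto simp: pre_def)

lemma pre_mono: "pre k x = pre k y \<Longrightarrow> j \<le> k \<Longrightarrow> pre j x = pre j y"
  by (auto simp: pre_eq_iff)

lemma shift_funpow: "(shift ^^ n) x = (\<lambda>i. x (i + n))"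
  by (induction n arbitrary: x) (auto simp: shift_def)

lemma app_Nil [simp]: "app [] x = x"
  by (simp add: app_def)

lemma app_append: "app (\<mu> @ \<nu>) x = app \<mu> (app \<nu> x)"
  by (rule ext) (auto simp: app_def nth_append)

lemma pre_app: "pre (length \<nu>) (app \<nu> x) = \<nu>"
  by (rule nth_equalityI) (auto simp: app_def)

lemma pre_app_add: "pre (length \<nu> + k) (app \<nu> x) = \<nu> @ pre k x"
  by (rule nth_equalityI) (auto simp: app_def nth_append)

lemma pre_app': "length \<nu> = n \<Longrightarrow> pre n (app \<nu> x) = \<nu>"
  using pre_app by blast

lemma shift_app: "(shift ^^ length \<nu>) (app \<nu> x) = x"
  by (rule ext) (simp add: shift_funpow app_def)

lemma shift_app_Cons [simp]: "shift (app [a] x) = x"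
  by (rule ext) (simp add: shift_def app_def)

lemma app_Cons_0 [simp]: "app [a] x 0 = a"
  by (simp add: app_def)

lemma app_Cons: "app (a # \<nu>) x = app [a] (app \<nu> x)"
  using app_append[of "[a]" \<nu> x] by simp

lemma app_pre_shift: "app (pre k x) ((shift ^^ k) x) = x"
  by (rule ext) (auto simp: app_def shift_funpow)

lemma app_head_shift: "app [x 0] (shift x) = x"
  using app_pre_shift[of 1 x] by (simp add: pre_def)

lemma pre_Suc: "pre (Suc k) x = x 0 # pre k (shift x)"
  by (rule nth_equalityI) (auto simp: shift_def nth_Cons split: nat.splits)

lemma pre_add: "pre (j + k) x = pre j x @ pre k ((shift ^^ j) x)"
  by (rule nth_equalityI) (auto simp: nth_append shift_funpow add.commute)

lemma pre_prefixI: "pre k y = \<mu> @ \<nu> \<Longrightarrow> pre (length \<mu>) y = \<mu>"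
  by (metis (no_types, lifting) append_eq_append_conv le_add1 length_append length_pre
      nat_le_iff_add pre_add)

lemma open_cylinder: "open {y :: nat \<Rightarrow> nat. pre k y = w}"
proof (cases "length w = k")
  case True
  have "open {y :: nat \<Rightarrow> nat. \<forall>i\<in>{..<k}. y i \<in> {w ! i}}"
    by (rule product_topology_basis') (auto simp: open_discrete)
  moreover have "{y. pre k y = w} = {y. \<forall>i\<in>{..<k}. y i \<in> {w ! i}}"
    using True by (auto simp: list_eq_iff_nth_eq)
  ultimately show ?thesis by simp
next
  case False
  then have "{y. pre k y = w} = {}" by auto
  then show ?thesis by simp
qed

text \<open>A basic open set of the product restricts finitely many coordinates, all of them below
  some \<open>k\<close>. Topological arguments on sequences thereby become statements about
  prefixes.\<close>

lemma cylinder_nbhd: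
  fixes x :: "nat \<Rightarrow> 'a :: topological_space"
  assumes "open T" "x \<in> T" shows "\<exists>k. \<forall>y. pre k y = pre k x \<longrightarrow> y \<in> T"
proof -
  have "openin (product_topology (\<lambda>_::nat. euclidean) UNIV) T"
    using assms(1) by (simp add: euclidean_product_topology)
  from product_topology_open_contains_basis[OF this assms(2)]
  obtain U where U: "x \<in> Pi\<^sub>E UNIV U" "finite {i. U i \<noteq> UNIV}" "Pi\<^sub>E UNIV U \<subseteq> T"
    by auto
  define k where "k = Suc (Max (insert 0 {i. U i \<noteq> UNIV}))"
  have "y \<in> T" if "pre k y = pre k x" for y
  proof -
    have "y i \<in> U i" for i
    proof (cases "U i = UNIV")
      case False
      then have "i < k" unfolding k_def using U(2) by (simp add: less_Suc_eq_le)
      then show ?thesis using that U(1) unfolding pre_eq_iff by auto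
    qed auto
    then show ?thesis using U(3) by blast
  qed
  then show ?thesis by blast
qed

lemma Hausdorff_sequences: "Hausdorff_space (euclidean :: (nat \<Rightarrow> nat) topology)"
  unfolding Hausdorff_space_def
proof (intro allI impI)
  fix x y :: "nat \<Rightarrow> nat" assume "x \<in> topspace euclidean \<and> y \<in> topspace euclidean \<and> x \<noteq> y"
  then obtain i where "x i \<noteq> y i" by blast
  then have "pre (Suc i) x \<noteq> pre (Suc i) y" unfolding pre_eq_iff by blast
  then show "\<exists>U V. openin euclidean U \<and> openin euclidean V \<and> x \<in> U \<and> y \<in> V \<and> disjnt U V"
    by (intro exI[of _ "{z. pre (Suc i) z = pre (Suc i) x}"] exI[of _ "{z. pre (Suc i) z = pre (Suc i) y}"])
       (auto simp: open_cylinder disjnt_def)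
qed

section \<open>Compactness and the language of a subshift\<close>

locale sshift =
  fixes N :: nat and L :: "(int \<Rightarrow> nat) set"
  assumes subshift: "subshift N L"
begin

abbreviation X where "X \<equiv> one_sided L"

lemma compact_L: "compact L"
proof -
  have "compactin (product_topology (\<lambda>i::int. euclidean :: nat topology) UNIV) (PiE UNIV (\<lambda>_. {1..N}))"
    by (subst compactin_PiE) (auto intro: finite_imp_compact)
  then have "compact (PiE UNIV (\<lambda>_::int. {1..N}))"
    by (simp add: euclidean_product_topology)
  moreover have "L \<subseteq> PiE UNIV (\<lambda>_. {1..N})" "closed L"
    using subshift by (auto simp: subshift_def PiE_UNIV_domain)
  ultimately show ?thesis
    by (metis compact_Int_closed inf.absorb_iff2)
qed

lemma translate_nat: "a \<in> L \<Longrightarrow> (\<lambda>i. a (i + int n)) \<in> L"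
proof (induction n)
  case (Suc n)
  have "(\<lambda>i. a (i + int n)) \<in> L" using Suc by simp
  then have "(\<lambda>a i. a (i + 1)) (\<lambda>i. a (i + int n)) \<in> (\<lambda>a i. a (i + 1)) ` L" by (rule imageI)
  also have "... = L" using subshift unfolding subshift_def by simp
  finally show ?case by (simp add: algebra_simps)
qed simp

lemma translate_nat_minus: "a \<in> L \<Longrightarrow> (\<lambda>i. a (i - int n)) \<in> L"
proof (induction n)
  case (Suc n)
  then have "(\<lambda>i. a (i - int n)) \<in> (\<lambda>a n. a (n + 1)) ` L"
    using subshift unfolding subshift_def by simp
  then obtain b where b: "b \<in> L" "(\<lambda>i. a (i - int n)) = (\<lambda>n. b (n + 1))"
    by blast
  have "a (i - int (Suc n)) = b i" for i
    using fun_cong[OF b(2), of "i - 1"] by (simp add: algebra_simps)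
  then have "(\<lambda>i. a (i - int (Suc n))) = b" by blast
  then show ?case using b by simp
qed simp

lemma translate: "a \<in> L \<Longrightarrow> (\<lambda>i. a (i + c)) \<in> L"
  using translate_nat[of a "nat c"] translate_nat_minus[of a "nat (- c)"]
  by (cases "c \<ge> 0") auto

lemma one_sidedI: "a \<in> L \<Longrightarrow> (\<lambda>i. a (int i + 1)) \<in> X"
  unfolding one_sided_def by (rule image_eqI) simp_all

lemma one_sidedE:
  assumes "x \<in> X" obtains a where "a \<in> L" "x = (\<lambda>i. a (int i + 1))"
  using assms unfolding one_sided_def by blast

text \<open>Translation invariance moves a window at any two-sided position to the one starting at
  index 1.\<close>

lemma words_eq: "words L k = pre k ` X"
proof -
  have "map (\<lambda>j. a (i + int j)) [0..<k] \<in> pre k ` X" if "a \<in> L" for a i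
  proof -
    have "(\<lambda>j. (\<lambda>n. a (n + (i - 1))) (int j + 1)) \<in> X"
      using translate[OF that, of "i - 1"] by (rule one_sidedI)
    then have "pre k (\<lambda>j. (\<lambda>n. a (n + (i - 1))) (int j + 1)) \<in> pre k ` X" by (rule imageI)
    then show ?thesis by (simp add: pre_def algebra_simps)
  qed
  moreover have "pre k x \<in> words L k" if "x \<in> X" for x
  proof -
    obtain a where a: "a \<in> L" "x = (\<lambda>i. a (int i + 1))" using \<open>x \<in> X\<close> by (rule one_sidedE)
    have "pre k x = map (\<lambda>j. a (1 + int j)) [0..<k]" unfolding a pre_def by (simp add: add.commute)
    then show ?thesis unfolding words_def using a(1) by blast
  qed
  ultimately show ?thesis unfolding words_def by blast
qed

lemma length_words: "w \<in> words L k \<Longrightarrow> length w = k"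
  by (auto simp: words_eq)

lemma words_iff: "w \<in> words L k \<longleftrightarrow> length w = k \<and> w \<in> all_words L"
  unfolding all_words_def by (auto dest: length_words)

lemma all_words_iff: "w \<in> all_words L \<longleftrightarrow> (\<exists>x\<in>X. pre (length w) x = w)"
  unfolding all_words_def words_eq by (auto simp: image_iff) (metis length_pre)+

lemma pre_all_words: "x \<in> X \<Longrightarrow> pre k x \<in> all_words L"
  unfolding all_words_def words_eq by blast

lemma X_range: "x \<in> X \<Longrightarrow> x i \<in> {1..N}"
proof -
  assume "x \<in> X"
  then obtain a where a: "a \<in> L" "x = (\<lambda>i. a (int i + 1))" by (rule one_sidedE)
  have "a \<in> UNIV \<rightarrow> {1..N}" using subshift a(1) unfolding subshift_def by blast
  then show ?thesis unfolding a by blast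
qed

lemma finite_words: "finite (words L k)"
proof (rule finite_subset)
  show "words L k \<subseteq> {w. set w \<subseteq> {1..N} \<and> length w = k}"
    unfolding words_eq using X_range by (auto simp: pre_def)
qed (simp add: finite_lists_length_eq)

lemma shift_X: "x \<in> X \<Longrightarrow> shift x \<in> X"
proof -
  assume "x \<in> X"
  then obtain a where a: "a \<in> L" "x = (\<lambda>i. a (int i + 1))" by (auto simp: one_sided_def)
  have "shift x = (\<lambda>i. (\<lambda>n. a (n + 1)) (int i + 1))"
    unfolding a shift_def by (simp add: algebra_simps)
  then show ?thesis using one_sidedI[OF translate[OF a(1), of 1]] by simp
qed

lemma shift_pow_X: "x \<in> X \<Longrightarrow> (shift ^^ n) x \<in> X"
  by (induction n) (auto simp: shift_X)

text \<open>A one-sided point is the right half of a two-sided one; translating the latter uncovers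
  \<open>n\<close> letters of its past.\<close>

lemma preimage_X: "x \<in> X \<Longrightarrow> \<exists>\<nu>. length \<nu> = n \<and> app \<nu> x \<in> X"
proof -
  assume "x \<in> X"
  then obtain a where a: "a \<in> L" "x = (\<lambda>i. a (int i + 1))" by (auto simp: one_sided_def)
  define y where "y = (\<lambda>i. (\<lambda>m. a (m + (- int n))) (int i + 1))"
  have "y \<in> X" unfolding y_def by (rule one_sidedI) (rule translate[OF a(1), of "- int n"])
  moreover have "app (pre n y) x = y"
    by (rule ext) (auto simp: app_def y_def a of_nat_diff algebra_simps)
  ultimately show ?thesis by (metis length_pre)
qed

text \<open>Compactness of \<open>L\<close>: the two-sided sequences that agree with
  \<open>x\<close> on a given prefix form a closed set \<open>C k\<close>, finitely many of these
  meet \<open>L\<close> jointly because a long prefix of \<open>x\<close> is admissible, and a point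
  common to all of them and \<open>L\<close> extends \<open>x\<close> to the left.\<close>

lemma X_closedI: assumes "\<And>k. pre k x \<in> all_words L" shows "x \<in> X"
proof -
  define C where "C k = {a \<in> UNIV. \<forall>j\<in>{..<k}. a (int j + 1) \<in> {x j}}" for k
  have "closed (C k)" for k
  proof -
    have "closed ((\<lambda>a. a (int j + 1)) -` {x j})" for j
      by (rule closed_vimage) (auto intro: continuous_on_product_coordinates)
    moreover have "C k = (\<Inter>j\<in>{..<k}. (\<lambda>a. a (int j + 1)) -` {x j})"
      unfolding C_def by auto
    ultimately show ?thesis by (simp add: closed_INT)
  qed
  have "L \<inter> \<Inter>(range C) \<noteq> {}"
  proof (rule compact_imp_fip[OF compact_L])
    fix F' assume "finite F'" "F' \<subseteq> range C"
    then obtain K where K: "finite K" "F' = C ` K" by (meson finite_subset_image)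
    define m where "m = Max (insert 0 K)"
    obtain y where y: "y \<in> X" "pre m y = pre m x"
      using assms[of m] unfolding all_words_iff by auto
    then obtain a where a: "a \<in> L" "y = (\<lambda>i. a (int i + 1))" by (auto simp: one_sided_def)
    have "a \<in> C k" if "k \<in> K" for k
    proof -
      have "k \<le> m" using K that unfolding m_def by auto
      then show ?thesis using y(2) unfolding a C_def pre_eq_iff by auto
    qed
    then show "L \<inter> \<Inter>F' \<noteq> {}" using a K by blast
  qed (use \<open>\<And>k. closed (C k)\<close> in auto)
  then obtain a where a: "a \<in> L" "\<And>k. a \<in> C k" by auto
  have "x = (\<lambda>i. a (int i + 1))"
  proof
    fix i show "x i = a (int i + 1)" using a(2)[of "Suc i"] unfolding C_def by auto
  qed
  then show ?thesis using one_sidedI a(1) by simp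
qed

lemma all_words_appendD:
  assumes "\<mu> @ \<nu> \<in> all_words L" shows "\<mu> \<in> all_words L" "\<nu> \<in> all_words L"
proof -
  obtain x where x: "x \<in> X" "pre (length \<mu> + length \<nu>) x = \<mu> @ \<nu>"
    using assms unfolding all_words_iff by auto
  then have "pre (length \<mu>) x = \<mu>" "pre (length \<nu>) ((shift ^^ length \<mu>) x) = \<nu>"
    unfolding pre_add by auto
  then show "\<mu> \<in> all_words L" "\<nu> \<in> all_words L"
    using x(1) shift_pow_X pre_all_words by metis+
qed

lemma app_X_D: "app \<nu> x \<in> X \<Longrightarrow> x \<in> X"
  by (metis shift_pow_X shift_app)

lemma extend_word:
  assumes "\<mu> \<in> all_words L" obtains x where "x \<in> X" "app \<mu> x \<in> X"
  by (metis all_words_iff app_pre_shift assms shift_pow_X)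

lemma past_iff:
  "past L l \<mu> = {\<nu>. length \<nu> = l \<and> \<nu> @ \<mu> \<in> all_words L}"
  unfolding past_def words_iff by (auto dest: all_words_appendD)

lemma follower_iff: "\<xi> \<in> follower L \<mu> \<longleftrightarrow> \<mu> @ \<xi> \<in> all_words L"
  unfolding follower_def by (auto dest: all_words_appendD)

section \<open>Pasts and synchronization of points\<close>

text \<open>The analogue of \<open>past\<close> for an infinite sequence in place of a word. It
  refers only to \<open>X\<close> and to prepending letters, so it can be followed along a
  conjugacy.\<close>

definition Past where "Past l x = {\<nu>. length \<nu> = l \<and> app \<nu> x \<in> X}"

lemma Past_words: "Past l x \<subseteq> words L l"
proof
  fix \<nu> assume "\<nu> \<in> Past l x"
  then have "length \<nu> = l" "app \<nu> x \<in> X" unfolding Past_def by auto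
  then show "\<nu> \<in> words L l" unfolding words_iff all_words_iff using pre_app[of \<nu> x] by blast
qed

text \<open>A word that precedes a prefix of \<open>x\<close> is realized in front of some point
  with this prefix, though perhaps not in front of \<open>x\<close>.\<close>

lemma past_pre:
  assumes "x \<in> X"
  shows "past L l (pre k x) = (\<Union>x'\<in>{x'\<in>X. pre k x' = pre k x}. Past l x')"
proof -
  have "\<exists>x'\<in>X. pre k x' = pre k x \<and> app \<nu> x' \<in> X" if "\<nu> @ pre k x \<in> all_words L" for \<nu>
  proof -
    have "\<exists>y\<in>X. pre (length \<nu> + k) y = \<nu> @ pre k x"
      using that unfolding all_words_iff by simp
    then obtain y where y: "y \<in> X" "pre (length \<nu> + k) y = \<nu> @ pre k x" by blast
    then have "pre (length \<nu>) y = \<nu>" "pre k ((shift ^^ length \<nu>) y) = pre k x"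
      unfolding pre_add by auto
    moreover have "app \<nu> ((shift ^^ length \<nu>) y) = y"
      using calculation(1) app_pre_shift by metis
    ultimately show ?thesis using y(1) shift_pow_X by auto
  qed
  moreover have "\<nu> @ pre k x \<in> all_words L" if "app \<nu> x' \<in> X" "pre k x' = pre k x" for \<nu> x'
    using pre_all_words[OF that(1), of "length \<nu> + k"] that(2) by (simp add: pre_app_add)
  ultimately show ?thesis
    unfolding past_iff Past_def by blast
qed

lemma past_append_subset: "past L l (\<mu> @ \<xi>) \<subseteq> past L l \<mu>"
  unfolding past_iff using all_words_appendD(1) by (metis (mono_tags, lifting) Collect_mono append.assoc)

text \<open>If a word can precede every prefix of \<open>x\<close>, all prefixes of the concatenated
  sequence are admissible, and \<open>X_closedI\<close> applies.\<close>

lemma Past_eq_INT: assumes "x \<in> X" shows "Past l x = (\<Inter>k. past L l (pre k x))"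
proof -
  have "app \<nu> x \<in> X" if "length \<nu> = l" "\<And>k. \<nu> @ pre k x \<in> all_words L" for \<nu>
  proof (rule X_closedI)
    fix k
    have "pre (length \<nu> + k) (app \<nu> x) \<in> all_words L"
      using that(2) by (simp add: pre_app_add)
    moreover have "pre (length \<nu> + k) (app \<nu> x) = pre k (app \<nu> x) @ pre (length \<nu>) ((shift ^^ k) (app \<nu> x))"
      by (metis add.commute pre_add)
    ultimately show "pre k (app \<nu> x) \<in> all_words L" using all_words_appendD(1) by metis
  qed
  moreover have "\<nu> @ pre k x \<in> all_words L" if "app \<nu> x \<in> X" for \<nu> k
    using pre_all_words[OF that, of "length \<nu> + k"] by (simp add: pre_app_add)
  ultimately show ?thesis unfolding past_iff Past_def by blast
qed

definition psync where "psync l x \<longleftrightarrow> x \<in> X \<and> (\<exists>k. pre k x \<in> sync L l)"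

text \<open>For an \<open>l\<close>-synchronizing point this is the vertex of any of its
  \<open>l\<close>-synchronizing prefixes; written through \<open>Past\<close>, it involves no
  choice of a prefix.\<close>

definition cls where "cls l x = {\<mu> \<in> sync L l. past L l \<mu> = Past l x}"

lemma sync_append:
  assumes "\<mu> \<in> sync L l" "\<mu> @ \<xi> \<in> all_words L"
  shows "\<mu> @ \<xi> \<in> sync L l" "past L l (\<mu> @ \<xi>) = past L l \<mu>"
proof -
  show "past L l (\<mu> @ \<xi>) = past L l \<mu>"
    using assms unfolding sync_def by (auto simp: follower_iff)
  have "past L l (\<mu> @ \<xi> @ \<xi>') = past L l (\<mu> @ \<xi>)" if "\<mu> @ \<xi> @ \<xi>' \<in> all_words L" for \<xi>'
  proof -
    have "\<xi> \<in> follower L \<mu>" "\<xi> @ \<xi>' \<in> follower L \<mu>" using assms(2) that by (simp_all add: follower_iff)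
    then show ?thesis using assms(1) unfolding sync_def by blast
  qed
  then show "\<mu> @ \<xi> \<in> sync L l"
    using assms(2) unfolding sync_def by (simp add: follower_iff)
qed

lemma sync_pre:
  assumes "x \<in> X" "pre k x \<in> sync L l" "k \<le> j"
  shows "pre j x \<in> sync L l" "past L l (pre j x) = past L l (pre k x)"
proof -
  have "pre j x = pre k x @ pre (j - k) ((shift ^^ k) x)"
    using assms(3) pre_add[of k "j - k" x] by simp
  then show "pre j x \<in> sync L l" "past L l (pre j x) = past L l (pre k x)"
    using sync_append[OF assms(2)] pre_all_words[OF assms(1)] by metis+
qed

text \<open>The pasts of the prefixes decrease and become stationary as soon as a prefix is
  synchronizing, so the intersection in \<open>Past_eq_INT\<close> is reached there.\<close>

lemma Past_sync:
  assumes "x \<in> X" "pre k x \<in> sync L l" shows "Past l x = past L l (pre k x)"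
proof -
  have "past L l (pre j x) \<supseteq> past L l (pre k x)" for j
  proof (cases "k \<le> j")
    case True then show ?thesis using sync_pre[OF assms] by blast
  next
    case False
    then have "pre k x = pre j x @ pre (k - j) ((shift ^^ j) x)"
      using pre_add[of j "k - j" x] by simp
    then show ?thesis using past_append_subset by metis
  qed
  then show ?thesis unfolding Past_eq_INT[OF assms(1)] by blast
qed

text \<open>Synchronization of a point is thus expressed by the one-sided shift space and its shift alone,
  which makes it invariant under conjugacy.\<close>

lemma psync_iff:
  "psync l x \<longleftrightarrow> x \<in> X \<and> (\<exists>k. \<forall>x'\<in>X. pre k x' = pre k x \<longrightarrow> Past l x' = Past l x)"
proof safe
  assume "psync l x"
  then obtain k where k: "x \<in> X" "pre k x \<in> sync L l" unfolding psync_def by blast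
  show "x \<in> X" by fact
  have "Past l x' = Past l x" if "x' \<in> X" "pre k x' = pre k x" for x'
    using Past_sync[of x k l] Past_sync[of x' k l] that k by simp
  then show "\<exists>k. \<forall>x'\<in>X. pre k x' = pre k x \<longrightarrow> Past l x' = Past l x" by blast
next
  fix k assume k: "x \<in> X" "\<forall>x'\<in>X. pre k x' = pre k x \<longrightarrow> Past l x' = Past l x"
  have *: "past L l (pre j x') = Past l x" if "x' \<in> X" "pre k x' = pre k x" "k \<le> j" for j x'
  proof -
    have "past L l (pre j x') = (\<Union>y\<in>{y\<in>X. pre j y = pre j x'}. Past l y)"
      using past_pre that by blast
    also have "... = Past l x"
    proof -
      have "Past l y = Past l x" if y: "y \<in> X" "pre j y = pre j x'" for y
        using k(2) y pre_mono[OF y(2) \<open>k \<le> j\<close>] \<open>pre k x' = pre k x\<close> by simp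
      then show ?thesis using that(1) by blast
    qed
    finally show ?thesis .
  qed
  have "past L l (pre k x) = past L l (pre k x @ \<xi>)" if "pre k x @ \<xi> \<in> all_words L" for \<xi>
  proof -
    have "\<exists>y\<in>X. pre (k + length \<xi>) y = pre k x @ \<xi>"
      using that unfolding all_words_iff by simp
    then obtain y where y: "y \<in> X" "pre (k + length \<xi>) y = pre k x @ \<xi>" by blast
    then have "pre k y = pre k x" using pre_prefixI[OF y(2)] by simp
    then show ?thesis using *[of y "k + length \<xi>"] *[of x k] y k(1) by simp
  qed
  then have "pre k x \<in> sync L l"
    unfolding sync_def using pre_all_words[OF k(1)] by (auto simp: follower_iff)
  then show "psync l x" unfolding psync_def using k by blast
qed

lemma psync_X: "psync l x \<Longrightarrow> x \<in> X"
  by (simp add: psync_def)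

lemma psync_word:
  assumes "\<mu> \<in> sync L l" "app \<mu> x \<in> X"
  shows "psync l (app \<mu> x)" "Past l (app \<mu> x) = past L l \<mu>" "cls l (app \<mu> x) = past_class L l \<mu>"
proof -
  have p: "pre (length \<mu>) (app \<mu> x) = \<mu>" by (rule pre_app)
  then show "psync l (app \<mu> x)" unfolding psync_def using assms by metis
  show "Past l (app \<mu> x) = past L l \<mu>" using Past_sync p assms by metis
  then show "cls l (app \<mu> x) = past_class L l \<mu>" unfolding cls_def past_class_def by simp
qed

lemma psyncE:
  assumes "psync l x"
  obtains k where "pre k x \<in> sync L l" "Past l x = past L l (pre k x)" "cls l x = past_class L l (pre k x)"
  using assms Past_sync unfolding psync_def cls_def past_class_def by blast

lemma cls_eq_iff:
  assumes "psync l x" "psync l y" shows "cls l x = cls l y \<longleftrightarrow> Past l x = Past l y"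
proof -
  obtain k where "pre k x \<in> sync L l" "Past l x = past L l (pre k x)" using assms(1) by (rule psyncE)
  then have "pre k x \<in> cls l x" by (simp add: cls_def)
  then show ?thesis unfolding cls_def by auto
qed

section \<open>Vertices, edges and \<iota> in terms of points\<close>

lemma vertices_eq: "vertices L l = {cls l x | x. psync l x}"
proof -
  have "\<exists>x. past_class L l \<mu> = cls l x \<and> psync l x" if "\<mu> \<in> sync L l" for \<mu>
  proof -
    have "\<mu> \<in> all_words L" using that by (simp add: sync_def)
    then obtain x where "app \<mu> x \<in> X" by (rule extend_word)
    then show ?thesis using psync_word[OF that] by metis
  qed
  moreover have "cls l x \<in> vertices L l" if "psync l x" for x
    using psyncE[OF that] unfolding vertices_def by (metis image_eqI)
  ultimately show ?thesis unfolding vertices_def by blast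
qed

lemma finite_vertices: "finite (vertices L l)"
proof -
  have "vertices L l \<subseteq> (\<lambda>P. {\<mu> \<in> sync L l. past L l \<mu> = P}) ` Pow (words L l)"
    unfolding vertices_eq cls_def using Past_words by blast
  then show ?thesis using finite_words finite_subset by blast
qed

lemma Past_Suc_shift: "x \<in> X \<Longrightarrow> Past l x = {\<nu>. length \<nu> = l \<and> \<nu> @ [x 0] \<in> Past (Suc l) (shift x)}"
  unfolding Past_def by (auto simp: app_append app_head_shift)

lemma Past_app: "app [a] y \<in> X \<Longrightarrow> Past l (app [a] y) = {\<nu>. length \<nu> = l \<and> \<nu> @ [a] \<in> Past (Suc l) y}"
  by (subst Past_Suc_shift) auto

text \<open>Every past can be lengthened by one letter, the shift being onto. Hence the pasts of
  length \<open>Suc l\<close> determine those of length \<open>l\<close>, which is what makes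
  \<iota> well defined.\<close>

lemma Past_mono_Suc: "x \<in> X \<Longrightarrow> Past l x = {\<nu>. length \<nu> = l \<and> (\<exists>a. a # \<nu> \<in> Past (Suc l) x)}"
proof -
  have "\<exists>a. app (a # \<nu>) x \<in> X" if \<nu>: "app \<nu> x \<in> X" for \<nu>
  proof -
    obtain \<mu> where "length \<mu> = 1" "app \<mu> (app \<nu> x) \<in> X" using preimage_X[OF \<nu>] by blast
    then show ?thesis unfolding app_append[symmetric] by (cases \<mu>) auto
  qed
  moreover have "app \<nu> x \<in> X" if "app (a # \<nu>) x \<in> X" for a \<nu>
    by (metis app_Cons app_X_D that)
  ultimately show "Past l x = {\<nu>. length \<nu> = l \<and> (\<exists>a. a # \<nu> \<in> Past (Suc l) x)}"
    unfolding Past_def by auto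
qed

lemma Past_le:
  assumes "x \<in> X" "y \<in> X" "Past l x = Past l y" "j \<le> l" shows "Past j x = Past j y"
  using assms(4,3)
proof (induction rule: dec_induct)
  case (step n)
  then have "Past (Suc n) x = Past (Suc n) y \<Longrightarrow> Past n x = Past n y"
    using Past_mono_Suc[OF assms(1), of n] Past_mono_Suc[OF assms(2), of n] by simp
  then show ?case using step by blast
qed simp

lemma psync_le: "psync l x \<Longrightarrow> j \<le> l \<Longrightarrow> psync j x"
  unfolding psync_iff using Past_le by metis

text \<open>By \<open>Past_Suc_shift\<close> the \<open>l\<close>-past depends on the first letter
  and the \<open>Suc l\<close>-past of the shifted point. A cylinder on which the latter is
  constant, lengthened by the first letter, serves for \<open>x\<close>; one level is lost.\<close>

lemma psync_shiftD:
  assumes "x \<in> X" "psync (Suc l) (shift x)" shows "psync l x"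
proof -
  obtain k where k: "\<forall>x'\<in>X. pre k x' = pre k (shift x) \<longrightarrow> Past (Suc l) x' = Past (Suc l) (shift x)"
    using assms(2) unfolding psync_iff by blast
  have "Past l x' = Past l x" if "x' \<in> X" "pre (Suc k) x' = pre (Suc k) x" for x'
  proof -
    have "pre k (shift x') = pre k (shift x)" "x' 0 = x 0" using that(2) by (simp_all add: pre_Suc)
    then have "Past (Suc l) (shift x') = Past (Suc l) (shift x)" using k shift_X[OF that(1)] by blast
    then show ?thesis
      unfolding Past_Suc_shift[OF that(1)] Past_Suc_shift[OF assms(1)] \<open>x' 0 = x 0\<close> by simp
  qed
  then show ?thesis unfolding psync_iff using assms(1) by blast
qed

lemma psync_app:
  assumes "app [a] y \<in> X" "psync (Suc l) y" shows "psync l (app [a] y)"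
  using psync_shiftD assms by simp

text \<open>An edge is a point seen at its first letter: the word in the definition of an edge
  extends to a point \<open>shift x\<close>, and conversely it is a synchronizing prefix of
  \<open>shift x\<close>.\<close>

lemma edges_eq: "edges L l = {(cls l x, x 0, cls (Suc l) (shift x)) | x. x \<in> X \<and> psync (Suc l) (shift x)}"
  (is "_ = ?R")
proof
  show "edges L l \<subseteq> ?R"
  proof
    fix e assume "e \<in> edges L l"
    then obtain \<alpha> \<nu> where e: "e = (past_class L l (\<alpha> # \<nu>), \<alpha>, past_class L (Suc l) \<nu>)"
      "\<nu> \<in> sync L (Suc l)" "\<alpha> # \<nu> \<in> all_words L" unfolding edges_def by blast
    obtain y where y: "app (\<alpha> # \<nu>) y \<in> X" using e(3) extend_word by blast
    let ?x = "app (\<alpha> # \<nu>) y"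
    have s: "?x = app [\<alpha>] (app \<nu> y)" by (rule app_Cons)
    have nX: "app \<nu> y \<in> X" using y s app_X_D by metis
    note p = psync_word[OF e(2) nX]
    have pl: "psync l ?x" using psync_app p(1) y s by metis
    have "Past l ?x = past L l (\<alpha> # \<nu>)"
    proof -
      have "Past l ?x = {\<mu>. length \<mu> = l \<and> \<mu> @ [\<alpha>] \<in> past L (Suc l) \<nu>}"
        unfolding s using Past_app[of \<alpha> "app \<nu> y" l] y p(2) s by simp
      also have "... = past L l (\<alpha> # \<nu>)" unfolding past_iff by auto
      finally show ?thesis .
    qed
    then have "cls l ?x = past_class L l (\<alpha> # \<nu>)" unfolding cls_def past_class_def by simp
    then show "e \<in> ?R" unfolding e(1) using p(1,3) y s
      by (metis (mono_tags, lifting) app_Cons_0 mem_Collect_eq shift_app_Cons)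
  qed
  show "?R \<subseteq> edges L l"
  proof
    fix e assume "e \<in> ?R"
    then obtain x where x: "e = (cls l x, x 0, cls (Suc l) (shift x))" "x \<in> X" "psync (Suc l) (shift x)"
      by blast
    obtain k where k: "pre k (shift x) \<in> sync L (Suc l)" "Past (Suc l) (shift x) = past L (Suc l) (pre k (shift x))"
      "cls (Suc l) (shift x) = past_class L (Suc l) (pre k (shift x))" using x(3) by (rule psyncE)
    have "Past l x = past L l (x 0 # pre k (shift x))"
      using k(2) Past_Suc_shift[OF x(2), of l] unfolding past_iff by auto
    then have "cls l x = past_class L l (x 0 # pre k (shift x))"
      unfolding cls_def past_class_def by simp
    moreover have "x 0 # pre k (shift x) \<in> all_words L"
      using pre_all_words[OF x(2)] pre_Suc by metis
    ultimately show "e \<in> edges L l" unfolding edges_def x(1) using k by blast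
  qed
qed

lemma past_mono_Suc: "past L l \<mu> = {\<nu>. length \<nu> = l \<and> (\<exists>a. a # \<nu> \<in> past L (Suc l) \<mu>)}"
proof -
  have "\<exists>a. a # \<nu> @ \<mu> \<in> all_words L" if \<nu>: "\<nu> @ \<mu> \<in> all_words L" for \<nu>
  proof -
    obtain z where z: "app (\<nu> @ \<mu>) z \<in> X" using \<nu> by (rule extend_word)
    obtain \<xi> where "length \<xi> = 1" "app \<xi> (app (\<nu> @ \<mu>) z) \<in> X" using preimage_X[OF z] by blast
    then obtain a where "app [a] (app (\<nu> @ \<mu>) z) \<in> X" by (cases \<xi>) auto
    then have "app (a # \<nu> @ \<mu>) z \<in> X" by (metis app_Cons)
    then show ?thesis using pre_all_words pre_app by metis
  qed
  moreover have "\<nu> @ \<mu> \<in> all_words L" if "a # \<nu> @ \<mu> \<in> all_words L" for a \<nu>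
    using all_words_appendD(2)[of "[a]"] that by simp
  ultimately show ?thesis unfolding past_iff by auto
qed

text \<open>The set under \<open>the_elem\<close> is a singleton: all words of the class share the
  \<open>Suc l\<close>-past of \<open>x\<close>, which fixes their \<open>l\<close>-past, and a
  synchronizing prefix of \<open>x\<close> belongs to the class.\<close>

lemma iota_cls:
  assumes "psync (Suc l) x" shows "iota L l (cls (Suc l) x) = cls l x"
proof -
  have xX: "x \<in> X" using assms psync_X by blast
  have "past_class L l \<mu> = cls l x" if \<mu>: "\<mu> \<in> cls (Suc l) x" for \<mu>
  proof -
    have s: "\<mu> \<in> sync L (Suc l)" "past L (Suc l) \<mu> = Past (Suc l) x" using \<mu> unfolding cls_def by auto
    have "\<mu> \<in> all_words L" using s(1) unfolding sync_def by simp
    then obtain y where "app \<mu> y \<in> X" by (rule extend_word)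
    then have "Past (Suc l) (app \<mu> y) = Past (Suc l) x" "app \<mu> y \<in> X" using psync_word[OF s(1)] s(2) by auto
    then have "Past l (app \<mu> y) = Past l x" using Past_le[of "app \<mu> y" x "Suc l" l] xX by simp
    moreover have "past L l \<mu> = Past l (app \<mu> y)"
      unfolding Past_mono_Suc[OF \<open>app \<mu> y \<in> X\<close>, of l] past_mono_Suc[of l \<mu>]
        psync_word(2)[OF s(1) \<open>app \<mu> y \<in> X\<close>] ..
    ultimately show ?thesis unfolding past_class_def cls_def by simp
  qed
  moreover have "cls (Suc l) x \<noteq> {}"
  proof -
    obtain k where "pre k x \<in> sync L (Suc l)" "Past (Suc l) x = past L (Suc l) (pre k x)"
      using assms by (rule psyncE)
    then have "pre k x \<in> cls (Suc l) x" unfolding cls_def by simp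
    then show ?thesis by blast
  qed
  ultimately have "past_class L l ` cls (Suc l) x = {cls l x}" by auto
  then show ?thesis unfolding iota_def by simp
qed

text \<open>The edge comes from a point whose shift has the same \<open>Suc l\<close>-past as
  \<open>y\<close>, so its label can be put before \<open>y\<close> as well, with the same
  \<open>l\<close>-past as result. That the source is determined by label and terminal is
  left-resolution at one level.\<close>

lemma edge_prepend:
  assumes "psync (Suc l) y" "(u, a, cls (Suc l) y) \<in> edges L l"
  shows "app [a] y \<in> X" "psync l (app [a] y)" "cls l (app [a] y) = u"
proof -
  obtain x where x: "u = cls l x" "a = x 0" "cls (Suc l) y = cls (Suc l) (shift x)" "x \<in> X"
     "psync (Suc l) (shift x)"
    using assms(2) unfolding edges_eq by blast
  have P: "Past (Suc l) y = Past (Suc l) (shift x)"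
    using x(3) cls_eq_iff[OF assms(1) x(5)] by blast
  \<comment> \<open>The two pasts can be compared only on words of length exactly
    \<open>Suc l\<close>, so \<open>l\<close> more letters are put in front of \<open>x\<close> and
    dropped again afterwards.\<close>
  obtain \<nu> where \<nu>: "length \<nu> = l" "app \<nu> x \<in> X" using preimage_X[OF x(4)] by blast
  then have "\<nu> @ [a] \<in> Past (Suc l) (shift x)"
    unfolding Past_def by (simp add: app_append x(2) app_head_shift)
  then have "\<nu> @ [a] \<in> Past (Suc l) y" using P by simp
  then have "app (\<nu> @ [a]) y \<in> X" unfolding Past_def by simp
  then show yX: "app [a] y \<in> X" unfolding app_append by (rule app_X_D)
  then show ps: "psync l (app [a] y)" using psync_app assms(1) by blast
  have "Past l (app [a] y) = Past l x"
    using Past_app[OF yX, of l] Past_Suc_shift[OF x(4), of l] P x(2) by simp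
  then show "cls l (app [a] y) = u"
    using cls_eq_iff[OF ps psync_shiftD[OF x(4,5)]] x(1) by simp
qed

lemma Omega_level:
  assumes "v \<in> Omega L" "psync l x" "cls l x = v l" "j \<le> l"
  shows "psync j x" "cls j x = v j"
proof -
  show "cls j x = v j" using assms(4,3,2)
  proof (induction rule: inc_induct)
    case (step n)
    then have "psync (Suc n) x" using psync_le by (meson Suc_leI)
    then have "cls n x = iota L n (cls (Suc n) x)" using iota_cls by simp
    also have "... = v n" using step assms(1) unfolding Omega_def by simp
    finally show ?case .
  qed
  show "psync j x" using psync_le assms by blast
qed

section \<open>Paths in the \<lambda>-graph system and their approximation by points\<close>

definition path where "path v a \<longleftrightarrow> (\<forall>i. (v i, a i, v (Suc i)) \<in> E_graph L)"

text \<open>\<open>x\<close> follows the path \<open>(v, a)\<close> for \<open>n\<close> steps, with synchronization up to level \<open>m\<close>.\<close>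

definition apx where "apx n m v a x \<longleftrightarrow> x \<in> X \<and> (\<forall>i<n. x i = a i) \<and>
  (\<forall>i\<le>n. \<forall>j\<le>m. psync j ((shift ^^ i) x) \<and> cls j ((shift ^^ i) x) = v i j)"

lemma apxD:
  assumes "apx n m v a x"
  shows "x \<in> X" "i < n \<Longrightarrow> x i = a i" "i \<le> n \<Longrightarrow> j \<le> m \<Longrightarrow> psync j ((shift ^^ i) x)"
    "i \<le> n \<Longrightarrow> j \<le> m \<Longrightarrow> cls j ((shift ^^ i) x) = v i j"
  using assms by (simp_all add: apx_def)

text \<open>Induction on the number of steps, with path and level arbitrary: the tail is followed up
  to level \<open>Suc m\<close>, and prepending the first label by \<open>edge_prepend\<close>
  leaves level \<open>m\<close>.\<close>

lemma path_approx: "path v a \<Longrightarrow> \<exists>x. apx n m v a x"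
proof (induction n arbitrary: v a m)
  case 0
  then have "v 0 \<in> Omega L" unfolding path_def E_graph_def by blast
  then have "v 0 m \<in> vertices L m" unfolding Omega_def by blast
  then obtain x where "psync m x" "cls m x = v 0 m" unfolding vertices_eq by blast
  then show ?case unfolding apx_def using Omega_level[OF \<open>v 0 \<in> Omega L\<close>, of m x] psync_X
    by (intro exI[of _ x]) (use psync_X in \<open>simp; blast\<close>)
next
  case (Suc n)
  let ?v = "\<lambda>i. v (Suc i)" and ?a = "\<lambda>i. a (Suc i)"
  have E: "(v 0, a 0, v (Suc 0)) \<in> E_graph L" using Suc.prems unfolding path_def by blast
  have "path ?v ?a" using Suc.prems unfolding path_def by blast
  then obtain y where y: "apx n (Suc m) ?v ?a y" using Suc.IH by blast
  have s: "psync (Suc m) y" "cls (Suc m) y = v (Suc 0) (Suc m)"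
    using y unfolding apx_def by (auto dest: spec[of _ 0])
  have "(v 0 m, a 0, cls (Suc m) y) \<in> edges L m" using E s(2) unfolding E_graph_def by simp
  note p = edge_prepend[OF s(1) this]
  have 0: "v 0 \<in> Omega L" using E unfolding E_graph_def by blast
  have "app [a 0] y i = a i" if "i < Suc n" for i
    using that y unfolding apx_def by (cases i) (auto simp: app_def)
  moreover have "psync j ((shift ^^ i) (app [a 0] y)) \<and> cls j ((shift ^^ i) (app [a 0] y)) = v i j"
    if "i \<le> Suc n" "j \<le> m" for i j
  proof (cases i)
    case 0 then show ?thesis using Omega_level[OF \<open>v 0 \<in> Omega L\<close> p(2,3) \<open>j \<le> m\<close>] by simp
  next
    case (Suc k)
    then have "(shift ^^ i) (app [a 0] y) = (shift ^^ k) y" by (simp add: funpow_swap1)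
    then show ?thesis using y that Suc unfolding apx_def by auto
  qed
  ultimately show ?case unfolding apx_def using p(1) by blast
qed

text \<open>Each condition on a path concerns finitely many positions and levels, so it can be read
  off from one sufficiently good approximation. Paths are produced from points in this way.\<close>

lemma pathI:
  assumes "\<And>n. \<exists>x. apx n n v a x" shows "path v a"
proof -
  have Om: "v i \<in> Omega L" for i
  proof -
    have "v i l \<in> vertices L l \<and> iota L l (v i (Suc l)) = v i l" for l
    proof -
      obtain x where x: "apx (i + Suc l) (i + Suc l) v a x" using assms by blast
      then have "psync (Suc l) ((shift ^^ i) x)" "cls (Suc l) ((shift ^^ i) x) = v i (Suc l)"
        "psync l ((shift ^^ i) x)" "cls l ((shift ^^ i) x) = v i l" unfolding apx_def by auto
      then show ?thesis using iota_cls vertices_eq by fastforce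
    qed
    then show ?thesis unfolding Omega_def by blast
  qed
  have "(v i l, a i, v (Suc i) (Suc l)) \<in> edges L l" for i l
  proof -
    obtain x where x: "apx (Suc i + Suc l) (Suc i + Suc l) v a x" using assms by blast
    let ?y = "(shift ^^ i) x"
    have "psync (Suc l) (shift ?y)" "cls (Suc l) (shift ?y) = v (Suc i) (Suc l)"
      "cls l ?y = v i l" "?y 0 = a i" "?y \<in> X"
      using apxD(3,4)[OF x, of "Suc i" "Suc l"] apxD(4)[OF x, of i l] apxD(2)[OF x, of i]
        shift_pow_X[OF apxD(1)[OF x]] by (simp_all add: shift_funpow)
    then show ?thesis unfolding edges_eq by force
  qed
  then show ?thesis unfolding path_def E_graph_def using Om by blast
qed

text \<open>A path lists the vertex before the first letter, of which \<open>X_set\<close> asserts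
  only the existence. Hence the letter \<open>a i\<close> is paired with \<open>v (Suc i)\<close>,
  the vertex behind it.\<close>

lemma X_set_iff: "xh \<in> X_set L \<longleftrightarrow> (\<exists>v a. path v a \<and> xh = (\<lambda>i. (a i, v (Suc i))))"
proof
  assume "xh \<in> X_set L"
  then obtain v0 where v0: "(v0, fst (xh 0), snd (xh 0)) \<in> E_graph L"
    "\<And>i. (snd (xh i), fst (xh (Suc i)), snd (xh (Suc i))) \<in> E_graph L" unfolding X_set_def by blast
  define v where "v i = (case i of 0 \<Rightarrow> v0 | Suc k \<Rightarrow> snd (xh k))" for i
  have "(v i, fst (xh i), v (Suc i)) \<in> E_graph L" for i
    unfolding v_def using v0 by (cases i) auto
  then have "path v (\<lambda>i. fst (xh i))" unfolding path_def by blast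
  moreover have "xh = (\<lambda>i. (fst (xh i), v (Suc i)))" unfolding v_def by simp
  ultimately show "\<exists>v a. path v a \<and> xh = (\<lambda>i. (a i, v (Suc i)))" by blast
qed (auto simp: X_set_def path_def)

lemma path_X: assumes "path v a" shows "a \<in> X"
proof (rule X_closedI)
  fix k obtain x where "apx k 0 v a x" using path_approx[OF assms] by blast
  then have "x \<in> X" "pre k x = pre k a" unfolding apx_def pre_eq_iff by auto
  then show "pre k a \<in> all_words L" using pre_all_words by metis
qed

lemma labels_X: "xh \<in> X_set L \<Longrightarrow> labels xh \<in> X"
  unfolding X_set_iff using path_X by (auto simp: labels_def)

lemma left_resolving:
  assumes "(u, a, v) \<in> E_graph L" "(u', a, v) \<in> E_graph L" shows "u = u'"
proof
  fix l
  have "v (Suc l) \<in> vertices L (Suc l)" using assms unfolding E_graph_def Omega_def by blast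
  then obtain y where y: "psync (Suc l) y" "cls (Suc l) y = v (Suc l)" unfolding vertices_eq by blast
  have "(u l, a, cls (Suc l) y) \<in> edges L l" "(u' l, a, cls (Suc l) y) \<in> edges L l"
    using assms y(2) unfolding E_graph_def by auto
  then show "u l = u' l" using edge_prepend(3)[OF y(1)] by metis
qed

lemma edge_append:
  assumes "app [a] y \<in> X" "psync (Suc l) y"
  shows "(cls l (app [a] y), a, cls (Suc l) y) \<in> edges L l"
  unfolding edges_eq using assms by (auto intro!: exI[of _ "app [a] y"])

text \<open>If a representative of the level-1 vertex admits the letter \<open>a\<close>, so do
  representatives at all higher levels, and the classes of the resulting points form a vertex
  sequence. A condition on all levels is thus replaced by one on a single coordinate; compactness of
  the path space and openness of its shift depend on this.\<close>

lemma predecessor_iff: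
  assumes "v \<in> Omega L"
  shows "(\<exists>u. (u, a, v) \<in> E_graph L) \<longleftrightarrow> (\<exists>c. (c, a, v 1) \<in> edges L 0)"
proof
  assume "\<exists>c. (c, a, v 1) \<in> edges L 0"
  then obtain c where c: "(c, a, v 1) \<in> edges L 0" by blast
  have "\<exists>y. psync (Suc l) y \<and> cls (Suc l) y = v (Suc l)" for l
  proof -
    have "v (Suc l) \<in> vertices L (Suc l)" using assms unfolding Omega_def by blast
    then show ?thesis unfolding vertices_eq by blast
  qed
  then obtain y where y: "\<And>l. psync (Suc l) (y l)" "\<And>l. cls (Suc l) (y l) = v (Suc l)" by metis
  have aX: "app [a] (y l) \<in> X" for l
  proof -
    have "psync (Suc 0) (y l)" "cls (Suc 0) (y l) = v 1" using Omega_level[OF assms y] by simp_all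
    then show ?thesis using edge_prepend(1)[of 0 "y l" c a] c by simp
  qed
  define u where "u l = cls l (app [a] (y l))" for l
  have ps: "psync l (app [a] (y l))" for l using psync_app aX y(1) by blast
  have "iota L l (u (Suc l)) = u l" for l
  proof -
    have "psync (Suc l) (y (Suc l))" "cls (Suc l) (y (Suc l)) = v (Suc l)"
      using Omega_level[OF assms y(1,2)[of "Suc l"], of "Suc l"] by simp_all
    then have P: "Past (Suc l) (y (Suc l)) = Past (Suc l) (y l)" using cls_eq_iff y by metis
    have "iota L l (u (Suc l)) = cls l (app [a] (y (Suc l)))" unfolding u_def using iota_cls ps by blast
    also have "... = u l" unfolding u_def
      using cls_eq_iff[OF psync_le[OF ps[of "Suc l"], of l] ps[of l]] P unfolding Past_app[OF aX] by simp
    finally show ?thesis .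
  qed
  moreover have "u l \<in> vertices L l" for l unfolding u_def vertices_eq using ps by blast
  ultimately have "u \<in> Omega L" unfolding Omega_def by blast
  moreover have "(u l, a, v (Suc l)) \<in> edges L l" for l
    unfolding u_def y(2)[symmetric] using edge_append[OF aX y(1)] .
  ultimately have "(u, a, v) \<in> E_graph L" unfolding E_graph_def using assms by blast
  then show "\<exists>u. (u, a, v) \<in> E_graph L" by blast
qed (auto simp: E_graph_def)

lemma compact_X: "compact X"
  unfolding one_sided_def
  by (intro compact_continuous_image compact_L continuous_on_coordinatewise_then_product
      continuous_on_subset[OF continuous_on_product_coordinates subset_UNIV])

text \<open>Uniform continuity on a compact space, with the largest cylinder length of a finite
  subcover in the role of a Lebesgue number.\<close>

lemma uniform_prefix:
  fixes g :: "(nat \<Rightarrow> nat) \<Rightarrow> 'b :: metric_space"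
  assumes g: "continuous_on X g" and e: "e > 0"
  shows "\<exists>m. \<forall>x\<in>X. \<forall>y\<in>X. pre m x = pre m y \<longrightarrow> dist (g x) (g y) < e"
proof -
  have "\<exists>k. \<forall>y\<in>X. pre k y = pre k x \<longrightarrow> dist (g y) (g x) < e / 2" if xX: "x \<in> X" for x
  proof -
    obtain T where T: "open T" "x \<in> T" "\<And>y. y \<in> X \<Longrightarrow> y \<in> T \<Longrightarrow> g y \<in> ball (g x) (e / 2)"
    proof -
      have "open (ball (g x) (e / 2))" "g x \<in> ball (g x) (e / 2)" using e by auto
      then have "\<exists>A. open A \<and> x \<in> A \<and> (\<forall>y\<in>X. y \<in> A \<longrightarrow> g y \<in> ball (g x) (e / 2))"
        using g[unfolded continuous_on_topological] xX by blast
      then show thesis using that by blast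
    qed
    obtain k where "\<And>y. pre k y = pre k x \<Longrightarrow> y \<in> T" using cylinder_nbhd[OF T(1,2)] by blast
    then show ?thesis using T(3) by (auto simp: dist_commute)
  qed
  then obtain k where k: "\<And>x y. x \<in> X \<Longrightarrow> y \<in> X \<Longrightarrow> pre (k x) y = pre (k x) x \<Longrightarrow> dist (g y) (g x) < e / 2"
    by metis
  define C where "C x = {y. pre (k x) y = pre (k x) x}" for x
  have cover: "X \<subseteq> (\<Union>x\<in>X. C x)" unfolding C_def by blast
  have opn: "open (C x)" if "x \<in> X" for x unfolding C_def by (rule open_cylinder)
  obtain F where F: "F \<subseteq> X" "finite F" "X \<subseteq> (\<Union>x\<in>F. C x)"
    by (rule compactE_image[where C = X and f = C, OF compact_X opn cover])
  define m where "m = Max (insert 0 (k ` F))"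
  have "dist (g x) (g y) < e" if xy: "x \<in> X" "y \<in> X" "pre m x = pre m y" for x y
  proof -
    obtain z where z: "z \<in> F" "pre (k z) x = pre (k z) z" using F(3) xy(1) unfolding C_def by blast
    have "k z \<le> m" unfolding m_def using z(1) F(2) by auto
    then have "pre (k z) y = pre (k z) z" using pre_mono[OF xy(3)] z(2) by metis
    moreover have "z \<in> X" using z(1) F(1) by blast
    ultimately have "dist (g x) (g z) < e / 2" "dist (g y) (g z) < e / 2"
      using k[OF _ xy(1) z(2)] k[OF _ xy(2)] by blast+
    then show ?thesis by (rule dist_triangle_half_l)
  qed
  then show ?thesis by blast
qed

end

section \<open>Density of synchronizing points in normal subshifts\<close>

locale normal_sshift =
  fixes N :: nat and L :: "(int \<Rightarrow> nat) set"
  assumes normal: "normal_subshift N L"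

sublocale normal_sshift \<subseteq> sshift
  using normal by unfold_locales (simp add: normal_subshift_def)

context normal_sshift
begin

text \<open>\<lambda>-synchronization with k = \<open>length w + Suc n\<close> supplies the
  continuation. It is lengthened by one letter to be nonempty; synchronization persists under
  admissible continuation.\<close>

lemma sync_extension:
  assumes "w \<in> all_words L"
  shows "\<exists>\<nu>. \<nu> \<noteq> [] \<and> \<nu> \<in> sync L (length w + Suc n) \<and> w @ \<nu> \<in> all_words L"
proof -
  have "w \<in> words L (length w)" using assms words_iff by blast
  then obtain \<mu> where \<mu>: "\<mu> \<in> sync L (length w + Suc n)" "w @ \<mu> \<in> sync L (length w + Suc n - length w)"
    using normal unfolding normal_subshift_def lambda_synchronizing_def
    by (metis Suc_eq_plus1 add_Suc_right le_add1 le_add2)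
  then have "w @ \<mu> \<in> all_words L" unfolding sync_def by blast
  then obtain x where x: "app (w @ \<mu>) x \<in> X" by (rule extend_word)
  have "app (w @ \<mu>) x = app (w @ \<mu> @ [x 0]) (shift x)"
    by (simp add: app_append app_head_shift)
  then have *: "w @ \<mu> @ [x 0] \<in> all_words L" using x pre_all_words pre_app by metis
  then show ?thesis using sync_append(1)[OF \<mu>(1)] all_words_appendD(2)[OF *] by blast
qed

text \<open>The word is extended infinitely often, in stage \<open>n\<close> by a block that
  synchronizes to level \<open>length (w n) + Suc n\<close>. Going back from the end of
  \<open>w n\<close> to an earlier position costs at most \<open>length (w n)\<close> levels, so
  every level is attained at every position.\<close>

lemma dense_sync:
  assumes "\<mu> \<in> all_words L"
  obtains x where "x \<in> X" "pre (length \<mu>) x = \<mu>" "\<And>i l. psync l ((shift ^^ i) x)"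
proof -
  obtain e where e: "\<And>w n. w \<in> all_words L \<Longrightarrow>
      e w n \<noteq> [] \<and> e w n \<in> sync L (length w + Suc n) \<and> w @ e w n \<in> all_words L"
    using sync_extension by metis
  define w where "w = rec_nat \<mu> (\<lambda>n w. w @ e w n)"
  have w0: "w 0 = \<mu>" and wS: "w (Suc n) = w n @ e (w n) n" for n by (simp_all add: w_def)
  have wX: "w n \<in> all_words L" for n by (induction n) (use e wS w0 assms in auto)
  have len: "n \<le> length (w n)" for n
  proof (induction n)
    case (Suc n) then show ?case using e[OF wX[of n], of n] unfolding wS by (cases "e (w n) n") auto
  qed simp
  have pref: "\<exists>\<xi>. w m = w n @ \<xi>" if "n \<le> m" for n m
    using that by (induction rule: dec_induct) (auto simp: wS)
  define x where "x i = w (Suc i) ! i" for i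
  have xw: "x i = w n ! i" if "i < length (w n)" for i n
  proof (cases "n \<le> Suc i")
    case True
    then obtain \<xi> where "w (Suc i) = w n @ \<xi>" using pref by blast
    then show ?thesis unfolding x_def using that by (simp add: nth_append)
  next
    case False
    then obtain \<xi> where "w n = w (Suc i) @ \<xi>" using pref[of "Suc i" n] by auto
    then show ?thesis unfolding x_def using len[of "Suc i"] by (simp add: nth_append)
  qed
  have pw: "pre (length (w n)) x = w n" for n
    by (rule nth_equalityI) (auto simp: xw)
  have xX: "x \<in> X"
  proof (rule X_closedI)
    fix k
    have "w k = pre k x @ pre (length (w k) - k) ((shift ^^ k) x)"
      using pre_add[of k "length (w k) - k" x] len[of k] pw[of k] by simp
    then show "pre k x \<in> all_words L" using all_words_appendD(1) wX by metis
  qed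
  have "psync l ((shift ^^ i) x)" for i l
  proof -
    \<comment> \<open>Then \<open>w n\<close> reaches position \<open>i\<close>, as its length is at
      least \<open>n\<close>, and the level \<open>i + Suc n\<close> that remains there is at least
      \<open>l\<close>.\<close>
    define n where "n = max i l"
    have "pre (length (w n) + length (e (w n) n)) x = w n @ e (w n) n"
      using pw[of "Suc n"] unfolding wS by simp
    then have "pre (length (e (w n) n)) ((shift ^^ length (w n)) x) = e (w n) n"
      unfolding pre_add by simp
    then have "psync (length (w n) + Suc n) ((shift ^^ length (w n)) x)"
      unfolding psync_def using e[OF wX, of n n] shift_pow_X[OF xX] by metis
    moreover have "psync m y" if "y \<in> X" "psync (m + j) ((shift ^^ j) y)" for m j y
      using that
    proof (induction j arbitrary: m)
      case (Suc j)
      then have "psync (m + j) ((shift ^^ j) y)" using psync_shiftD shift_pow_X by simp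
      then show ?case using Suc by blast
    qed simp
    moreover have "(shift ^^ (length (w n) - i)) ((shift ^^ i) x) = (shift ^^ length (w n)) x"
      using len[of n] unfolding n_def by (simp add: shift_funpow add.assoc)
    moreover have "length (w n) + Suc n = (i + Suc n) + (length (w n) - i)"
      using len[of n] unfolding n_def by simp
    ultimately have "psync (i + Suc n) ((shift ^^ i) x)" using shift_pow_X[OF xX] by metis
    then show ?thesis using psync_le unfolding n_def by (metis le_SucI max.cobounded2 trans_le_add2)
  qed
  moreover have "pre (length \<mu>) x = \<mu>" using pw[of 0] w0 by simp
  ultimately show ?thesis using that xX by blast
qed

text \<open>Where every shift of a point synchronizes at all levels, the classes of its shifts form
  a path that carries the point.\<close>

lemma X_set_dense:
  assumes "\<mu> \<in> all_words L" shows "\<exists>xh\<in>X_set L. pre (length \<mu>) (labels xh) = \<mu>"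
proof -
  obtain x where x: "x \<in> X" "pre (length \<mu>) x = \<mu>" "\<And>i l. psync l ((shift ^^ i) x)"
    using dense_sync[OF assms] by blast
  define v where "v i l = cls l ((shift ^^ i) x)" for i l
  have "path v x"
    by (rule pathI) (use x in \<open>auto simp: apx_def v_def\<close>)
  then have "(\<lambda>i. (x i, v (Suc i))) \<in> X_set L" unfolding X_set_iff by blast
  moreover have "labels (\<lambda>i. (x i, v (Suc i))) = x" unfolding labels_def by simp
  ultimately show ?thesis using x(2) by metis
qed

end

section \<open>The groupoid of a local homeomorphism\<close>

lemma continuous_map_locally_constant:
  assumes "\<And>k. openin Z {z \<in> topspace Z. h z = k}"
  shows "continuous_map Z euclidean (\<lambda>z. \<phi> (h z))"
proof -
  have "openin Z {z \<in> topspace Z. \<phi> (h z) \<in> U}" for U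
  proof -
    have "{z \<in> topspace Z. \<phi> (h z) \<in> U} = (\<Union>k\<in>{k. \<phi> k \<in> U}. {z \<in> topspace Z. h z = k})" by blast
    also have "openin Z ..." using assms by blast
    finally show ?thesis .
  qed
  then show ?thesis by (simp add: continuous_map_def)
qed

lemma continuous_map_extend_by_zero:
  fixes g :: "'a \<Rightarrow> 'b :: {topological_space, zero}"
  assumes "openin Z D" "closedin Z D" "continuous_map (subtopology Z D) euclidean g"
  shows "continuous_map Z euclidean (\<lambda>z. if z \<in> D then g z else 0)"
proof -
  have "openin Z {z \<in> topspace Z. (if z \<in> D then g z else 0) \<in> U}" if "open U" for U
  proof -
    have "openin (subtopology Z D) {z \<in> topspace (subtopology Z D). g z \<in> U}"
      using assms(3) that by (simp add: continuous_map_def)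
    then have 1: "openin Z {z \<in> topspace (subtopology Z D). g z \<in> U}"
      using assms(1) openin_open_subtopology by blast
    have 2: "openin Z (topspace Z - D)" using assms(2) by blast
    have D: "D \<subseteq> topspace Z" using assms(1) openin_subset by blast
    have "{z \<in> topspace Z. (if z \<in> D then g z else 0) \<in> U} =
       {z \<in> topspace (subtopology Z D). g z \<in> U} \<union> (if 0 \<in> U then topspace Z - D else {})"
      using D by (auto split: if_splits)
    then show ?thesis using 1 2 by auto
  qed
  then show ?thesis by (simp add: continuous_map_def)
qed

lemma continuous_map_mult:
  fixes f g :: "'a \<Rightarrow> 'b :: real_normed_algebra"
  shows "continuous_map Z euclidean f \<Longrightarrow> continuous_map Z euclidean g \<Longrightarrow> continuous_map Z euclidean (\<lambda>z. f z * g z)"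
  by (simp add: continuous_map_atin tendsto_mult)

lemma image_restrict: "W \<subseteq> f ` S \<Longrightarrow> f ` {y \<in> S. f y \<in> W} = W"
  by blast

section \<open>The topology of the groupoid\<close>

locale dr_system =
  fixes X :: "'x topology" and s :: "'x \<Rightarrow> 'x"
  assumes compact_X: "compact_space X" and Hausdorff_X: "Hausdorff_space X"
    and cont_s: "continuous_map X X s" and open_s: "open_map X X s"
    and locally_inj: "\<And>x. x \<in> topspace X \<Longrightarrow> \<exists>U. openin X U \<and> x \<in> U \<and> inj_on s U"
begin

abbreviation "A \<equiv> arrows X s"
abbreviation "G \<equiv> arrow_top X s"

lemma pow_cont: "continuous_map X X (s ^^ n)"
proof (induction n)
  case (Suc n)
  have "s ^^ Suc n = s \<circ> (s ^^ n)" by simp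
  then show ?case using continuous_map_compose[OF Suc cont_s] by metis
qed simp

lemma pow_open: "open_map X X (s ^^ n)"
proof (induction n)
  case (Suc n)
  have "s ^^ Suc n = s \<circ> (s ^^ n)" by simp
  then show ?case using open_map_compose[OF Suc open_s] by metis
qed (simp add: open_map_def)

lemma pow_topspace: "x \<in> topspace X \<Longrightarrow> (s ^^ n) x \<in> topspace X"
  using pow_cont continuous_map_image_subset_topspace by blast

lemma openin_image: "openin X U \<Longrightarrow> openin X ((s ^^ n) ` U)"
  using pow_open unfolding open_map_def by blast

lemma openin_preimage: "openin X U \<Longrightarrow> openin X V \<Longrightarrow> openin X {x \<in> U. (s ^^ n) x \<in> V}"
  using openin_continuous_map_preimage_gen[OF pow_cont] .

lemma pow_locally_inj: "x \<in> topspace X \<Longrightarrow> \<exists>U. openin X U \<and> x \<in> U \<and> inj_on (s ^^ n) U"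
proof (induction n)
  case 0 then show ?case by (intro exI[of _ "topspace X"]) auto
next
  case (Suc n)
  then obtain U where U: "openin X U" "x \<in> U" "inj_on (s ^^ n) U" by blast
  obtain V where V: "openin X V" "(s ^^ n) x \<in> V" "inj_on s V"
    using locally_inj[OF pow_topspace[OF Suc.prems]] by blast
  have "inj_on (s ^^ Suc n) {y \<in> U. (s ^^ n) y \<in> V}"
    using U(3) V(3) by (auto simp: inj_on_def)
  then show ?case using openin_preimage[OF U(1) V(1), of n] U(2) V(2) by blast
qed

lemma homeo_on:
  assumes "openin X U" "inj_on (s ^^ p) U"
  shows "homeomorphic_map (subtopology X U) (subtopology X ((s ^^ p) ` U)) (s ^^ p)"
proof (rule bijective_open_imp_homeomorphic_map)
  have U: "U \<subseteq> topspace X" "(s ^^ p) ` U \<subseteq> topspace X" using assms openin_subset pow_topspace by blast+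
  show "continuous_map (subtopology X U) (subtopology X ((s ^^ p) ` U)) (s ^^ p)"
    by (rule continuous_map_into_subtopology[OF continuous_map_from_subtopology[OF pow_cont]]) (use U in auto)
  show "open_map (subtopology X U) (subtopology X ((s ^^ p) ` U)) (s ^^ p)"
    by (rule open_map_into_subtopology[OF open_map_from_subtopology[OF pow_open assms(1)]]) (use U in auto)
  show "(s ^^ p) ` topspace (subtopology X U) = topspace (subtopology X ((s ^^ p) ` U))"
    "inj_on (s ^^ p) (topspace (subtopology X U))"
    using U assms(2) by (auto simp: Int_absorb1)
qed

lemma arrowsI: "x \<in> topspace X \<Longrightarrow> z \<in> topspace X \<Longrightarrow> (s ^^ p) x = (s ^^ q) z \<Longrightarrow> n = int p - int q \<Longrightarrow> (x, n, z) \<in> A"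
  unfolding arrows_def by blast

lemma arrowsE:
  assumes "(x, n, z) \<in> A"
  obtains p q where "x \<in> topspace X" "z \<in> topspace X" "n = int p - int q" "(s ^^ p) x = (s ^^ q) z"
  using assms unfolding arrows_def by auto

lemma in_basic_set: "(x, n, z) \<in> basic_set X s U p q V \<longleftrightarrow> n = int p - int q \<and> x \<in> U \<and> z \<in> V \<and> (s ^^ p) x = (s ^^ q) z"
  unfolding basic_set_def by auto

lemma basic_subset: "openin X U \<Longrightarrow> openin X V \<Longrightarrow> basic_set X s U p q V \<subseteq> A"
  unfolding basic_set_def arrows_def using openin_subset by blast

definition gens where "gens = {basic_set X s U p q V | U p q V. openin X U \<and> openin X V \<and>
        (\<exists>W. openin X W \<and>
             homeomorphic_map (subtopology X U) (subtopology X W) (s ^^ p) \<and>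
             homeomorphic_map (subtopology X V) (subtopology X W) (s ^^ q))}"

lemma G_eq: "G = topology_generated_by gens"
  unfolding arrow_top_def gens_def ..

text \<open>Around the given arrow \<open>U\<close> and \<open>V\<close> shrink to sets on which the
  powers are injective, and then to the preimages of the common open image \<open>W\<close>. Hence
  every basic set is open, for arbitrary open \<open>U\<close> and \<open>V\<close>; see
  \<open>basic_open\<close>.\<close>

lemma small_gen:
  assumes "openin X U" "openin X V" "x \<in> U" "z \<in> V" "(s ^^ p) x = (s ^^ q) z"
  shows "\<exists>B\<in>gens. (x, int p - int q, z) \<in> B \<and> B \<subseteq> basic_set X s U p q V"
proof -
  have T: "x \<in> topspace X" "z \<in> topspace X" using assms openin_subset by blast+
  obtain U1 where U1: "openin X U1" "x \<in> U1" "inj_on (s ^^ p) U1" using pow_locally_inj[OF T(1)] by blast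
  obtain V1 where V1: "openin X V1" "z \<in> V1" "inj_on (s ^^ q) V1" using pow_locally_inj[OF T(2)] by blast
  define W where "W = (s ^^ p) ` (U \<inter> U1) \<inter> (s ^^ q) ` (V \<inter> V1)"
  have W: "openin X W" unfolding W_def using assms U1 V1 by (intro openin_Int openin_image) auto
  define U2 where "U2 = {y \<in> U \<inter> U1. (s ^^ p) y \<in> W}"
  define V2 where "V2 = {y \<in> V \<inter> V1. (s ^^ q) y \<in> W}"
  have o: "openin X U2" "openin X V2" unfolding U2_def V2_def
    by (rule openin_preimage[OF openin_Int[OF assms(1) U1(1)] W] openin_preimage[OF openin_Int[OF assms(2) V1(1)] W])+
  have i: "(s ^^ p) ` U2 = W" "(s ^^ q) ` V2 = W"
    unfolding U2_def V2_def by (rule image_restrict, simp add: W_def)+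
  have "inj_on (s ^^ p) U2" "inj_on (s ^^ q) V2" using U1(3) V1(3) unfolding U2_def V2_def
    by (auto simp: inj_on_def)
  then have "homeomorphic_map (subtopology X U2) (subtopology X W) (s ^^ p)"
    "homeomorphic_map (subtopology X V2) (subtopology X W) (s ^^ q)"
    using homeo_on[OF o(1), of p] homeo_on[OF o(2), of q] unfolding i by blast+
  then have "basic_set X s U2 p q V2 \<in> gens" unfolding gens_def using o W by blast
  moreover have "(s ^^ p) x \<in> W" unfolding W_def using assms(3-5) U1(2) V1(2)
    by (intro IntI) (blast, metis IntI imageI)
  then have "x \<in> U2" "z \<in> V2" unfolding U2_def V2_def using assms(3-5) U1(2) V1(2) by auto
  then have "(x, int p - int q, z) \<in> basic_set X s U2 p q V2" using assms(5) by (simp add: in_basic_set)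
  moreover have "basic_set X s U2 p q V2 \<subseteq> basic_set X s U p q V"
    unfolding basic_set_def U2_def V2_def by blast
  ultimately show ?thesis by blast
qed

lemma gens_subset: "B \<in> gens \<Longrightarrow> B \<subseteq> A"
  unfolding gens_def using basic_subset by blast

text \<open>The generators are bisections: the source determines the common image point, and
  \<open>s ^^ p\<close> is injective on \<open>U\<close>.\<close>

lemma gens_inj:
  assumes "B \<in> gens" "\<gamma> \<in> B" "\<gamma>' \<in> B" "snd (snd \<gamma>) = snd (snd \<gamma>')" shows "\<gamma> = \<gamma>'"
proof -
  obtain U p q V W where B: "B = basic_set X s U p q V" "openin X U"
     "homeomorphic_map (subtopology X U) (subtopology X W) (s ^^ p)"
    using assms(1) unfolding gens_def by blast
  have "inj_on (s ^^ p) U" using homeomorphic_imp_injective_map[OF B(3)] openin_subset[OF B(2)]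
    by (simp add: Int_absorb1)
  moreover obtain x n z x' n' z' where "\<gamma> = (x, n, z)" "\<gamma>' = (x', n', z')" by (metis prod.collapse)
  ultimately show ?thesis using assms(2-4) unfolding B(1) by (auto simp: in_basic_set inj_on_def)
qed

lemma topspace_G [simp]: "topspace G = A"
proof -
  have "\<gamma> \<in> \<Union>gens" if "\<gamma> \<in> A" for \<gamma>
  proof -
    obtain x n z where g: "\<gamma> = (x, n, z)" by (metis prod.collapse)
    have "(x, n, z) \<in> A" using that g by simp
    then obtain p q where "x \<in> topspace X" "z \<in> topspace X" "n = int p - int q" "(s ^^ p) x = (s ^^ q) z"
      by (rule arrowsE)
    then show ?thesis using small_gen[OF openin_topspace openin_topspace] g by blast
  qed
  then show ?thesis unfolding G_eq topology_generated_by_topspace using gens_subset by blast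
qed

lemma basic_open: assumes "openin X U" "openin X V" shows "openin G (basic_set X s U p q V)"
proof (subst openin_subopen, intro ballI)
  fix \<gamma> assume g: "\<gamma> \<in> basic_set X s U p q V"
  then obtain x z where xz: "\<gamma> = (x, int p - int q, z)" "x \<in> U" "z \<in> V" "(s ^^ p) x = (s ^^ q) z"
    unfolding basic_set_def by blast
  obtain B where "B \<in> gens" "\<gamma> \<in> B" "B \<subseteq> basic_set X s U p q V"
    using small_gen[OF assms xz(2-4)] xz(1) by blast
  then show "\<exists>T. openin G T \<and> \<gamma> \<in> T \<and> T \<subseteq> basic_set X s U p q V"
    unfolding G_eq using topology_generated_by_Basis by blast
qed

lemma continuous_into_G:
  assumes "\<And>z. z \<in> topspace Z \<Longrightarrow> f z \<in> A"
    "\<And>U p q V. openin X U \<Longrightarrow> openin X V \<Longrightarrow> openin Z {z \<in> topspace Z. f z \<in> basic_set X s U p q V}"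
  shows "continuous_map Z G f"
  unfolding G_eq
proof (rule continuous_on_generated_topo)
  show "f ` topspace Z \<subseteq> \<Union>gens" using assms(1) topspace_G unfolding G_eq topology_generated_by_topspace by blast
  fix B assume "B \<in> gens"
  then obtain U p q V where B: "B = basic_set X s U p q V" "openin X U" "openin X V" unfolding gens_def by blast
  have "f -` B \<inter> topspace Z = {z \<in> topspace Z. f z \<in> B}" by blast
  then show "openin Z (f -` B \<inter> topspace Z)" using assms(2)[OF B(2,3)] unfolding B(1) by simp
qed

lemma range_preimage_open: assumes "openin X U" shows "openin G {\<gamma> \<in> A. fst \<gamma> \<in> U}"
proof -
  have "{\<gamma> \<in> A. fst \<gamma> \<in> U} = (\<Union>p q. basic_set X s U p q (topspace X))"
    using openin_subset[OF assms] unfolding arrows_def basic_set_def by force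
  also have "openin G ..." using basic_open[OF assms openin_topspace] by blast
  finally show ?thesis .
qed

lemma source_preimage_open: assumes "openin X V" shows "openin G {\<gamma> \<in> A. snd (snd \<gamma>) \<in> V}"
proof -
  have "{\<gamma> \<in> A. snd (snd \<gamma>) \<in> V} = (\<Union>p q. basic_set X s (topspace X) p q V)"
    using openin_subset[OF assms] unfolding arrows_def basic_set_def by force
  also have "openin G ..." using basic_open[OF openin_topspace assms] by blast
  finally show ?thesis .
qed

lemma degree_open: "openin G {\<gamma> \<in> A. fst (snd \<gamma>) = n}"
proof -
  have "{\<gamma> \<in> A. fst (snd \<gamma>) = n} = (\<Union>(p, q)\<in>{(p, q). n = int p - int q}. basic_set X s (topspace X) p q (topspace X))"
    unfolding arrows_def basic_set_def by force
  then show ?thesis using basic_open[OF openin_topspace openin_topspace] by auto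
qed

lemma arrow_topspace: assumes "\<gamma> \<in> A" shows "fst \<gamma> \<in> topspace X" "snd (snd \<gamma>) \<in> topspace X"
  using assms unfolding arrows_def by auto

lemma range_cont: "continuous_map G X fst"
  using range_preimage_open arrow_topspace by (auto simp: continuous_map_def)

lemma source_cont: "continuous_map G X (\<lambda>\<gamma>. snd (snd \<gamma>))"
  using source_preimage_open arrow_topspace by (auto simp: continuous_map_def)

lemma degree_cont: "continuous_map G (discrete_topology UNIV) (\<lambda>\<gamma>. fst (snd \<gamma>))"
proof -
  have "{\<gamma> \<in> A. fst (snd \<gamma>) \<in> U} = (\<Union>n\<in>U. {\<gamma> \<in> A. fst (snd \<gamma>) = n})" for U by blast
  then show ?thesis using degree_open by (auto simp: continuous_map_def)
qed

lemma Hausdorff_G: "Hausdorff_space G"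
proof (rule Hausdorff_space_injective_preimage)
  show "Hausdorff_space (prod_topology X (prod_topology (discrete_topology (UNIV::int set)) X))"
    by (simp add: Hausdorff_space_prod_topology Hausdorff_X Hausdorff_space_discrete_topology)
  show "continuous_map G (prod_topology X (prod_topology (discrete_topology (UNIV::int set)) X))
      (\<lambda>\<gamma>. (fst \<gamma>, (fst (snd \<gamma>), snd (snd \<gamma>))))"
    by (intro continuous_map_pairedI range_cont source_cont degree_cont)
  show "inj_on (\<lambda>\<gamma>. (fst \<gamma>, (fst (snd \<gamma>), snd (snd \<gamma>)))) (topspace G)" by (auto simp: inj_on_def)
qed

section \<open>Graphs of powers and compactly supported functions\<close>

definition graph :: "nat \<Rightarrow> 'x \<Rightarrow> 'x arrow" where
  "graph p x = (x, int p, (s ^^ p) x)"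

lemma graph_A: "x \<in> topspace X \<Longrightarrow> graph p x \<in> A"
  unfolding graph_def using pow_topspace by (intro arrowsI[of _ _ p 0]) auto

lemma graph_eq: "graph p ` topspace X = basic_set X s (topspace X) p 0 (topspace X)"
  unfolding graph_def basic_set_def using pow_topspace by force

lemma graph_cont: "continuous_map X G (graph p)"
proof (rule continuous_into_G)
  fix U a b V assume o: "openin X U" "openin X V"
  have "{x \<in> topspace X. graph p x \<in> basic_set X s U a b V} =
     (if int p = int a - int b then {x \<in> U. (s ^^ p) x \<in> V} else {})"
  proof (cases "int p = int a - int b")
    case True
    then have "a = p + b" by simp
    then have "(s ^^ a) x = (s ^^ b) ((s ^^ p) x)" for x by (simp add: funpow_add add.commute[of p b])
    then show ?thesis using True openin_subset[OF o(1)] unfolding graph_def by (auto simp: in_basic_set)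
  qed (auto simp: graph_def in_basic_set)
  then show "openin X {x \<in> topspace X. graph p x \<in> basic_set X s U a b V}"
    using openin_preimage[OF o] by auto
qed (rule graph_A)

text \<open>The graph of a power is a basic set and also the image of the compact unit space under a
  continuous section.\<close>

lemma graph_clopen:
  "openin G (graph p ` topspace X)" "compactin G (graph p ` topspace X)" "closedin G (graph p ` topspace X)"
proof -
  show "openin G (graph p ` topspace X)" unfolding graph_eq by (intro basic_open) auto
  show "compactin G (graph p ` topspace X)"
    using image_compactin graph_cont compact_X compact_space_def by blast
  then show "closedin G (graph p ` topspace X)" using compactin_imp_closedin Hausdorff_G by blast
qed

definition graph_fun :: "nat \<Rightarrow> ('x \<Rightarrow> complex) \<Rightarrow> 'x vec" where
  "graph_fun p \<phi> \<gamma> = (if \<gamma> \<in> graph p ` topspace X then \<phi> (fst \<gamma>) else 0)"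

abbreviation "CX \<equiv> {\<phi>. continuous_map X (euclidean :: complex topology) \<phi>}"

lemma CcI:
  assumes "\<And>\<gamma>. \<gamma> \<notin> A \<Longrightarrow> f \<gamma> = 0" "continuous_map G euclidean f" "compactin G K" "{\<gamma>. f \<gamma> \<noteq> 0} \<subseteq> K"
  shows "f \<in> Cc X s"
proof -
  have "closedin G K" using compactin_imp_closedin Hausdorff_G assms(3) by blast
  then have "G closure_of {\<gamma>. f \<gamma> \<noteq> 0} \<subseteq> K" using closure_of_minimal assms(4) by metis
  then have "compactin G (G closure_of {\<gamma>. f \<gamma> \<noteq> 0})"
    by (rule closed_compactin[OF assms(3) _ closedin_closure_of])
  then show ?thesis unfolding Cc_def using assms by blast
qed

lemma CcD:
  assumes "f \<in> Cc X s"
  shows "\<gamma> \<notin> A \<Longrightarrow> f \<gamma> = 0" "continuous_map G euclidean f"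
    "compactin G (G closure_of {\<gamma>. f \<gamma> \<noteq> 0})" "{\<gamma>. f \<gamma> \<noteq> 0} \<subseteq> G closure_of {\<gamma>. f \<gamma> \<noteq> 0}"
proof -
  show "\<gamma> \<notin> A \<Longrightarrow> f \<gamma> = 0" "continuous_map G euclidean f" "compactin G (G closure_of {\<gamma>. f \<gamma> \<noteq> 0})"
    using assms unfolding Cc_def by blast+
  have "{\<gamma>. f \<gamma> \<noteq> 0} \<subseteq> A" using assms unfolding Cc_def by blast
  then show "{\<gamma>. f \<gamma> \<noteq> 0} \<subseteq> G closure_of {\<gamma>. f \<gamma> \<noteq> 0}" by (simp add: closure_of_subset)
qed

lemma graph_fun_Cc: assumes "\<phi> \<in> CX" shows "graph_fun p \<phi> \<in> Cc X s"
proof (rule CcI)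
  show "continuous_map G euclidean (graph_fun p \<phi>)" unfolding graph_fun_def[abs_def]
  proof (rule continuous_map_extend_by_zero[OF graph_clopen(1,3)])
    have "continuous_map G euclidean (\<phi> \<circ> fst)" using range_cont continuous_map_compose assms by blast
    then show "continuous_map (subtopology G (graph p ` topspace X)) euclidean (\<lambda>\<gamma>. \<phi> (fst \<gamma>))"
      by (simp add: continuous_map_from_subtopology o_def)
  qed
  show "compactin G (graph p ` topspace X)" by (rule graph_clopen)
qed (auto simp: graph_fun_def graph_A)

lemma Cc_diff: assumes "f \<in> Cc X s" "g \<in> Cc X s" shows "(\<lambda>\<gamma>. f \<gamma> - g \<gamma>) \<in> Cc X s"
proof (rule CcI)
  show "continuous_map G euclidean (\<lambda>\<gamma>. f \<gamma> - g \<gamma>)"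
    by (rule continuous_map_diff) (use CcD(2) assms in blast)+
  show "compactin G (G closure_of {\<gamma>. f \<gamma> \<noteq> 0} \<union> G closure_of {\<gamma>. g \<gamma> \<noteq> 0})"
    using CcD(3) assms compactin_Un by blast
  show "{\<gamma>. f \<gamma> - g \<gamma> \<noteq> 0} \<subseteq> G closure_of {\<gamma>. f \<gamma> \<noteq> 0} \<union> G closure_of {\<gamma>. g \<gamma> \<noteq> 0}"
  proof
    fix \<gamma> assume "\<gamma> \<in> {\<gamma>. f \<gamma> - g \<gamma> \<noteq> 0}"
    then have "\<gamma> \<in> {\<gamma>. f \<gamma> \<noteq> 0} \<or> \<gamma> \<in> {\<gamma>. g \<gamma> \<noteq> 0}" by auto
    then show "\<gamma> \<in> G closure_of {\<gamma>. f \<gamma> \<noteq> 0} \<union> G closure_of {\<gamma>. g \<gamma> \<noteq> 0}"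
      using CcD(4)[OF assms(1)] CcD(4)[OF assms(2)] by blast
  qed
qed (simp add: CcD(1)[OF assms(1)] CcD(1)[OF assms(2)])

subsection \<open>Weighted partial bijections\<close>

text \<open>Diagonal operators, the generators \<open>S\<^sub>\<alpha>\<close>, their adjoints and the gauge unitaries are all of
  the form \<open>wop D \<kappa> c\<close> below, with \<open>\<kappa>\<close> a homeomorphism between clopen sets of arrows.\<close>

definition pbij where
  "pbij D \<kappa> \<kappa>' \<longleftrightarrow> openin G D \<and> closedin G D \<and> openin G (\<kappa> ` D) \<and> closedin G (\<kappa> ` D) \<and>
     continuous_map (subtopology G D) G \<kappa> \<and> continuous_map (subtopology G (\<kappa> ` D)) G \<kappa>' \<and>
     (\<forall>\<gamma>\<in>D. \<kappa>' (\<kappa> \<gamma>) = \<gamma> \<and> snd (snd (\<kappa> \<gamma>)) = snd (snd \<gamma>))"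

definition wfun :: "'x arrow set \<Rightarrow> ('x arrow \<Rightarrow> 'x arrow) \<Rightarrow> ('x arrow \<Rightarrow> complex) \<Rightarrow> 'x vec \<Rightarrow> 'x vec" where
  "wfun D \<kappa> c \<xi> = (\<lambda>\<gamma>. if \<gamma> \<in> D then c \<gamma> * \<xi> (\<kappa> \<gamma>) else 0)"

definition wop where "wop D \<kappa> c = restrict_op X s (wfun D \<kappa> c)"

lemma pbij_inverse: assumes "pbij D \<kappa> \<kappa>'" shows "pbij (\<kappa> ` D) \<kappa>' \<kappa>" "\<kappa>' ` \<kappa> ` D = D"
proof -
  show i: "\<kappa>' ` \<kappa> ` D = D" using assms unfolding pbij_def by (force simp: image_image)
  show "pbij (\<kappa> ` D) \<kappa>' \<kappa>" using assms unfolding pbij_def i by auto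
qed

lemma pbijD:
  assumes "pbij D \<kappa> \<kappa>'"
  shows "D \<subseteq> A" "\<kappa> ` D \<subseteq> A" "inj_on \<kappa> D" "\<And>\<gamma>. \<gamma> \<in> D \<Longrightarrow> \<kappa>' (\<kappa> \<gamma>) = \<gamma>"
    "\<And>\<gamma>. \<gamma> \<in> D \<Longrightarrow> snd (snd (\<kappa> \<gamma>)) = snd (snd \<gamma>)"
proof -
  show "D \<subseteq> A" "\<kappa> ` D \<subseteq> A" using assms openin_subset unfolding pbij_def topspace_G[symmetric] by blast+
  show "\<And>\<gamma>. \<gamma> \<in> D \<Longrightarrow> \<kappa>' (\<kappa> \<gamma>) = \<gamma>" "\<And>\<gamma>. \<gamma> \<in> D \<Longrightarrow> snd (snd (\<kappa> \<gamma>)) = snd (snd \<gamma>)"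
    using assms unfolding pbij_def by blast+
  then show "inj_on \<kappa> D" by (metis inj_onI)
qed

text \<open>The support of the new function is carried by \<open>\<kappa>'\<close> from the
  intersection of the old support with the closed image of \<open>D\<close>, which is
  compact.\<close>

lemma wfun_Cc:
  assumes p: "pbij D \<kappa> \<kappa>'" and c: "continuous_map (subtopology G D) euclidean c" and f: "f \<in> Cc X s"
  shows "wfun D \<kappa> c f \<in> Cc X s"
proof (rule CcI)
  show "continuous_map G euclidean (wfun D \<kappa> c f)" unfolding wfun_def
  proof (rule continuous_map_extend_by_zero)
    have "continuous_map (subtopology G D) euclidean (f \<circ> \<kappa>)"
      using p CcD(2)[OF f] continuous_map_compose unfolding pbij_def by blast
    then show "continuous_map (subtopology G D) euclidean (\<lambda>\<gamma>. c \<gamma> * f (\<kappa> \<gamma>))"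
      using c by (intro continuous_map_mult) (simp_all add: o_def)
  qed (use p in \<open>auto simp: pbij_def\<close>)
  let ?K = "G closure_of {\<gamma>. f \<gamma> \<noteq> 0} \<inter> \<kappa> ` D"
  have "compactin (subtopology G (\<kappa> ` D)) ?K"
    using compact_Int_closedin[OF CcD(3)[OF f], of "\<kappa> ` D"] p unfolding pbij_def
    by (simp add: compactin_subtopology)
  then show "compactin G (\<kappa>' ` ?K)" using p image_compactin unfolding pbij_def by blast
  show "{\<gamma>. wfun D \<kappa> c f \<gamma> \<noteq> 0} \<subseteq> \<kappa>' ` ?K"
  proof
    fix \<gamma> assume "\<gamma> \<in> {\<gamma>. wfun D \<kappa> c f \<gamma> \<noteq> 0}"
    then have g: "\<gamma> \<in> D" "f (\<kappa> \<gamma>) \<noteq> 0" unfolding wfun_def by (auto split: if_splits)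
    then have "\<kappa> \<gamma> \<in> ?K" using CcD(4)[OF f] by blast
    moreover have "\<kappa>' (\<kappa> \<gamma>) = \<gamma>" using pbijD(4)[OF p g(1)] .
    ultimately show "\<gamma> \<in> \<kappa>' ` ?K" by (metis imageI)
  qed
qed (use pbijD(1)[OF p] in \<open>auto simp: wfun_def\<close>)

subsection \<open>The Hilbert module\<close>

lemma fibre_iff: "\<gamma> \<in> source_fibre X s z \<longleftrightarrow> \<gamma> \<in> A \<and> snd (snd \<gamma>) = z"
  unfolding source_fibre_def by blast

lemma norm_leD:
  assumes "module_norm_le X s \<xi> c"
  shows "0 \<le> c" "z \<in> topspace X \<Longrightarrow> (\<lambda>\<gamma>. (cmod (\<xi> \<gamma>))\<^sup>2) summable_on source_fibre X s z"
    "z \<in> topspace X \<Longrightarrow> (\<Sum>\<^sub>\<infinity>\<gamma>\<in>source_fibre X s z. (cmod (\<xi> \<gamma>))\<^sup>2) \<le> c\<^sup>2"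
  using assms unfolding module_norm_le_def by blast+

lemma norm_le_point:
  assumes "module_norm_le X s \<xi> c" "\<gamma> \<in> A" shows "cmod (\<xi> \<gamma>) \<le> c"
proof -
  let ?z = "snd (snd \<gamma>)"
  have z: "?z \<in> topspace X" using arrow_topspace assms(2) by blast
  have "(\<Sum>\<gamma>\<in>{\<gamma>}. (cmod (\<xi> \<gamma>))\<^sup>2) \<le> (\<Sum>\<^sub>\<infinity>\<gamma>\<in>source_fibre X s ?z. (cmod (\<xi> \<gamma>))\<^sup>2)"
    by (rule finite_sum_le_infsum[OF norm_leD(2)[OF assms(1) z]]) (use assms(2) in \<open>auto simp: fibre_iff\<close>)
  then have "(cmod (\<xi> \<gamma>))\<^sup>2 \<le> c\<^sup>2" using norm_leD(3)[OF assms(1) z] by simp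
  then show ?thesis using norm_leD(1)[OF assms(1)] by (simp add: abs_le_square_iff[symmetric])
qed

text \<open>A crude triangle inequality, which suffices since only smallness of norms matters.\<close>

lemma norm_le_diff:
  assumes "module_norm_le X s \<xi> a" "module_norm_le X s \<eta> b"
  shows "module_norm_le X s (\<lambda>\<gamma>. \<xi> \<gamma> - \<eta> \<gamma>) (2 * (a + b))"
proof -
  have ab: "0 \<le> a" "0 \<le> b" using norm_leD(1) assms by blast+
  have *: "(cmod (u - v))\<^sup>2 \<le> 2 * (cmod u)\<^sup>2 + 2 * (cmod v)\<^sup>2" for u v
  proof -
    have "(cmod (u - v))\<^sup>2 \<le> (cmod u + cmod v)\<^sup>2" by (intro power_mono norm_triangle_ineq4) simp
    moreover have "(cmod u - cmod v)\<^sup>2 \<ge> 0" by simp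
    ultimately show ?thesis by (simp add: power2_eq_square algebra_simps)
  qed
  have "(\<lambda>\<gamma>. (cmod (\<xi> \<gamma> - \<eta> \<gamma>))\<^sup>2) summable_on source_fibre X s z \<and>
      (\<Sum>\<^sub>\<infinity>\<gamma>\<in>source_fibre X s z. (cmod (\<xi> \<gamma> - \<eta> \<gamma>))\<^sup>2) \<le> (2 * (a + b))\<^sup>2" if z: "z \<in> topspace X" for z
  proof -
    note s1 = norm_leD(2)[OF assms(1) z] and s2 = norm_leD(2)[OF assms(2) z]
    note s1' = summable_on_cmult_right[OF s1, of 2] and s2' = summable_on_cmult_right[OF s2, of 2]
    note s3 = summable_on_add[OF s1' s2']
    have s4: "(\<lambda>\<gamma>. (cmod (\<xi> \<gamma> - \<eta> \<gamma>))\<^sup>2) summable_on source_fibre X s z"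
      by (rule summable_on_comparison_test[OF s3]) (use * in auto)
    have "(\<Sum>\<^sub>\<infinity>\<gamma>\<in>source_fibre X s z. (cmod (\<xi> \<gamma> - \<eta> \<gamma>))\<^sup>2) \<le>
       (\<Sum>\<^sub>\<infinity>\<gamma>\<in>source_fibre X s z. 2 * (cmod (\<xi> \<gamma>))\<^sup>2 + 2 * (cmod (\<eta> \<gamma>))\<^sup>2)"
      by (rule infsum_mono[OF s4 s3]) (rule *)
    also have "... = 2 * (\<Sum>\<^sub>\<infinity>\<gamma>\<in>source_fibre X s z. (cmod (\<xi> \<gamma>))\<^sup>2) + 2 * (\<Sum>\<^sub>\<infinity>\<gamma>\<in>source_fibre X s z. (cmod (\<eta> \<gamma>))\<^sup>2)"
      by (simp add: infsum_add[OF s1' s2'] infsum_cmult_right')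
    also have "... \<le> 2 * a\<^sup>2 + 2 * b\<^sup>2" using norm_leD(3)[OF assms(1) z] norm_leD(3)[OF assms(2) z] by simp
    also have "... \<le> (2 * (a + b))\<^sup>2" using ab by (simp add: power2_eq_square algebra_simps)
    finally show ?thesis using s4 by blast
  qed
  then show ?thesis unfolding module_norm_le_def using ab by simp
qed

text \<open>Being injective and source-preserving, \<open>\<kappa>\<close> maps a part of each
  source fibre injectively into the same fibre.\<close>

lemma norm_le_wfun:
  assumes inj: "inj_on \<kappa> D" and A: "\<kappa> ` D \<subseteq> A" and src: "\<And>\<gamma>. \<gamma> \<in> D \<Longrightarrow> snd (snd (\<kappa> \<gamma>)) = snd (snd \<gamma>)"
    and c: "\<And>\<gamma>. \<gamma> \<in> D \<Longrightarrow> cmod (c \<gamma>) \<le> M" "0 \<le> M" and \<xi>: "module_norm_le X s \<xi> r"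
  shows "module_norm_le X s (wfun D \<kappa> c \<xi>) (M * r)"
proof -
  have "(\<lambda>\<gamma>. (cmod (wfun D \<kappa> c \<xi> \<gamma>))\<^sup>2) summable_on source_fibre X s z \<and>
      (\<Sum>\<^sub>\<infinity>\<gamma>\<in>source_fibre X s z. (cmod (wfun D \<kappa> c \<xi> \<gamma>))\<^sup>2) \<le> (M * r)\<^sup>2" if z: "z \<in> topspace X" for z
  proof -
    let ?F = "source_fibre X s z" let ?E = "?F \<inter> D"
    have sub: "\<kappa> ` ?E \<subseteq> ?F" using A src by (auto simp: fibre_iff)
    have inj': "inj_on \<kappa> ?E" using inj by (meson inf_le2 inj_on_subset)
    note sF = norm_leD(2)[OF \<xi> z]
    have sE: "(\<lambda>\<gamma>. (cmod (\<xi> \<gamma>))\<^sup>2) summable_on \<kappa> ` ?E" using summable_on_subset_banach[OF sF sub] .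
    then have sE': "(\<lambda>\<gamma>. (cmod (\<xi> (\<kappa> \<gamma>)))\<^sup>2) summable_on ?E"
      unfolding summable_on_reindex[OF inj'] by (simp add: o_def)
    have b: "(cmod (wfun D \<kappa> c \<xi> \<gamma>))\<^sup>2 \<le> M\<^sup>2 * (cmod (\<xi> (\<kappa> \<gamma>)))\<^sup>2" if "\<gamma> \<in> ?E" for \<gamma>
    proof -
      have "cmod (c \<gamma>) \<le> M" using c(1) that by blast
      then have "(cmod (c \<gamma>))\<^sup>2 \<le> M\<^sup>2" by (intro power_mono) auto
      then show ?thesis using that by (simp add: wfun_def norm_mult power_mult_distrib mult_right_mono)
    qed
    note sM = summable_on_cmult_right[OF sE', of "M\<^sup>2"]
    have s1: "(\<lambda>\<gamma>. (cmod (wfun D \<kappa> c \<xi> \<gamma>))\<^sup>2) summable_on ?E"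
      by (rule summable_on_comparison_test[OF sM]) (use b in auto)
    then have s2: "(\<lambda>\<gamma>. (cmod (wfun D \<kappa> c \<xi> \<gamma>))\<^sup>2) summable_on ?F"
      by (rule iffD1[OF summable_on_cong_neutral, rotated -1]) (auto simp: wfun_def)
    have "(\<Sum>\<^sub>\<infinity>\<gamma>\<in>?F. (cmod (wfun D \<kappa> c \<xi> \<gamma>))\<^sup>2) = (\<Sum>\<^sub>\<infinity>\<gamma>\<in>?E. (cmod (wfun D \<kappa> c \<xi> \<gamma>))\<^sup>2)"
      by (rule infsum_cong_neutral) (auto simp: wfun_def)
    also have "... \<le> (\<Sum>\<^sub>\<infinity>\<gamma>\<in>?E. M\<^sup>2 * (cmod (\<xi> (\<kappa> \<gamma>)))\<^sup>2)" by (rule infsum_mono[OF s1 sM b])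
    also have "... = M\<^sup>2 * (\<Sum>\<^sub>\<infinity>\<gamma>\<in>\<kappa> ` ?E. (cmod (\<xi> \<gamma>))\<^sup>2)"
      by (simp add: infsum_cmult_right' infsum_reindex[OF inj'] o_def)
    also have "... \<le> M\<^sup>2 * (\<Sum>\<^sub>\<infinity>\<gamma>\<in>?F. (cmod (\<xi> \<gamma>))\<^sup>2)"
      by (intro mult_left_mono infsum_mono_neutral[OF sE sF]) (use sub in auto)
    also have "... \<le> M\<^sup>2 * r\<^sup>2" using norm_leD(3)[OF \<xi> z] by (intro mult_left_mono) auto
    finally show ?thesis using s2 by (simp add: power_mult_distrib)
  qed
  then show ?thesis unfolding module_norm_le_def using c(2) norm_leD(1)[OF \<xi>] by simp
qed

text \<open>Finitely many generators cover the compact support, and each of them meets a source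
  fibre at most once; so the number of nonzero values is bounded uniformly over all fibres.\<close>

lemma Cc_bounds:
  assumes "f \<in> Cc X s"
  shows "\<exists>n M. 0 \<le> M \<and> (\<forall>\<gamma>. cmod (f \<gamma>) \<le> M) \<and>
    (\<forall>z. finite {\<gamma> \<in> source_fibre X s z. f \<gamma> \<noteq> 0} \<and> card {\<gamma> \<in> source_fibre X s z. f \<gamma> \<noteq> 0} \<le> n)"
proof -
  let ?K = "G closure_of {\<gamma>. f \<gamma> \<noteq> 0}"
  note K = CcD(3)[OF assms]
  have "\<forall>B\<in>gens. openin G B" unfolding G_eq using topology_generated_by_Basis by blast
  moreover have "?K \<subseteq> \<Union>gens" using closure_of_subset_topspace[of G] topspace_G
    unfolding G_eq topology_generated_by_topspace by blast
  ultimately obtain F where F: "finite F" "F \<subseteq> gens" "?K \<subseteq> \<Union>F"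
    using K unfolding compactin_def by meson
  have fin1: "finite (B \<inter> source_fibre X s z)" "card (B \<inter> source_fibre X s z) \<le> 1" if "B \<in> F" for B z
  proof -
    have "B \<inter> source_fibre X s z \<subseteq> {\<gamma>}" if "\<gamma> \<in> B \<inter> source_fibre X s z" for \<gamma>
    proof
      fix \<delta> assume "\<delta> \<in> B \<inter> source_fibre X s z"
      moreover have "B \<in> gens" using \<open>B \<in> F\<close> F(2) by blast
      ultimately show "\<delta> \<in> {\<gamma>}" using gens_inj[of B \<delta> \<gamma>] that by (simp add: fibre_iff)
    qed
    then have "\<exists>\<gamma>. B \<inter> source_fibre X s z \<subseteq> {\<gamma>}" by (cases "B \<inter> source_fibre X s z = {}") blast+
    then obtain \<gamma> where "B \<inter> source_fibre X s z \<subseteq> {\<gamma>}" by blast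
    then show "finite (B \<inter> source_fibre X s z)" "card (B \<inter> source_fibre X s z) \<le> 1"
      using finite_subset card_mono[of "{\<gamma>}"] by auto
  qed
  have sub: "{\<gamma> \<in> source_fibre X s z. f \<gamma> \<noteq> 0} \<subseteq> (\<Union>B\<in>F. B \<inter> source_fibre X s z)" for z
    using F(3) CcD(4)[OF assms] by blast
  have finU: "finite (\<Union>B\<in>F. B \<inter> source_fibre X s z)" for z using F(1) fin1 by blast
  have "card {\<gamma> \<in> source_fibre X s z. f \<gamma> \<noteq> 0} \<le> card F" for z
  proof -
    have "card {\<gamma> \<in> source_fibre X s z. f \<gamma> \<noteq> 0} \<le> card (\<Union>B\<in>F. B \<inter> source_fibre X s z)"
      using sub finU card_mono by blast
    also have "... \<le> (\<Sum>B\<in>F. card (B \<inter> source_fibre X s z))" by (rule card_UN_le[OF F(1)])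
    also have "... \<le> (\<Sum>B\<in>F. 1)" by (rule sum_mono) (rule fin1)
    finally show ?thesis by simp
  qed
  moreover have "compactin euclidean (f ` ?K)" using image_compactin[OF K CcD(2)[OF assms]] .
  then have "bounded (f ` ?K)" by (simp add: compact_imp_bounded)
  then obtain M where M: "\<And>\<gamma>. \<gamma> \<in> ?K \<Longrightarrow> cmod (f \<gamma>) \<le> M" unfolding bounded_iff by blast
  have "cmod (f \<gamma>) \<le> max M 0" for \<gamma>
  proof (cases "f \<gamma> = 0")
    case False
    then have "\<gamma> \<in> ?K" using CcD(4)[OF assms] by blast
    then show ?thesis using M by (simp add: le_max_iff_disj)
  qed simp
  moreover have "finite {\<gamma> \<in> source_fibre X s z. f \<gamma> \<noteq> 0}" for z using sub finU finite_subset by blast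
  ultimately show ?thesis by (intro exI[of _ "card F"] exI[of _ "max M 0"]) simp
qed

lemma Cc_norm: assumes "f \<in> Cc X s" shows "\<exists>c. module_norm_le X s f c"
proof -
  obtain n M where b: "0 \<le> M" "\<And>\<gamma>. cmod (f \<gamma>) \<le> M" "\<And>z. finite {\<gamma> \<in> source_fibre X s z. f \<gamma> \<noteq> 0}"
    "\<And>z. card {\<gamma> \<in> source_fibre X s z. f \<gamma> \<noteq> 0} \<le> n" using Cc_bounds[OF assms] by blast
  have "(\<lambda>\<gamma>. (cmod (f \<gamma>))\<^sup>2) summable_on source_fibre X s z \<and>
      (\<Sum>\<^sub>\<infinity>\<gamma>\<in>source_fibre X s z. (cmod (f \<gamma>))\<^sup>2) \<le> (sqrt n * M)\<^sup>2" for z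
  proof -
    let ?E = "{\<gamma> \<in> source_fibre X s z. f \<gamma> \<noteq> 0}"
    have "(\<lambda>\<gamma>. (cmod (f \<gamma>))\<^sup>2) summable_on ?E" using b(3) by (rule summable_on_finite)
    then have s: "(\<lambda>\<gamma>. (cmod (f \<gamma>))\<^sup>2) summable_on source_fibre X s z"
      by (rule iffD1[OF summable_on_cong_neutral, rotated -1]) auto
    have "(\<Sum>\<^sub>\<infinity>\<gamma>\<in>source_fibre X s z. (cmod (f \<gamma>))\<^sup>2) = (\<Sum>\<^sub>\<infinity>\<gamma>\<in>?E. (cmod (f \<gamma>))\<^sup>2)"
      by (rule infsum_cong_neutral) auto
    also have "... = (\<Sum>\<gamma>\<in>?E. (cmod (f \<gamma>))\<^sup>2)" using b(3) by simp
    also have "... \<le> (\<Sum>\<gamma>\<in>?E. M\<^sup>2)" by (intro sum_mono power_mono b) auto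
    also have "... \<le> real n * M\<^sup>2" using b(4) by (simp add: mult_right_mono)
    finally show ?thesis using s by (simp add: power_mult_distrib)
  qed
  then have "module_norm_le X s f (sqrt n * M)" unfolding module_norm_le_def using b(1) by simp
  then show ?thesis by blast
qed

lemma l2D:
  assumes "\<xi> \<in> l2 X s"
  shows "\<gamma> \<notin> A \<Longrightarrow> \<xi> \<gamma> = 0" "\<epsilon> > 0 \<Longrightarrow> \<exists>f\<in>Cc X s. module_norm_le X s (\<lambda>\<gamma>. \<xi> \<gamma> - f \<gamma>) \<epsilon>"
  using assms unfolding l2_def by blast+

lemma norm_zero: "0 \<le> c \<Longrightarrow> module_norm_le X s (\<lambda>_. 0) c"
  unfolding module_norm_le_def by simp

lemma Cc_l2: "f \<in> Cc X s \<Longrightarrow> f \<in> l2 X s"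
  unfolding l2_def using CcD(1) by (auto intro!: bexI[of _ f] norm_zero)

lemma l2_norm: assumes "\<xi> \<in> l2 X s" shows "\<exists>c. module_norm_le X s \<xi> c"
proof -
  obtain f where f: "f \<in> Cc X s" "module_norm_le X s (\<lambda>\<gamma>. \<xi> \<gamma> - f \<gamma>) 1" using l2D(2)[OF assms, of 1] by auto
  obtain c where c: "module_norm_le X s f c" using Cc_norm[OF f(1)] by blast
  then have "module_norm_le X s (\<lambda>\<gamma>. 0 - f \<gamma>) (2 * (0 + c))" by (intro norm_le_diff norm_zero) auto
  then have "module_norm_le X s (\<lambda>\<gamma>. (\<xi> \<gamma> - f \<gamma>) - (0 - f \<gamma>)) (2 * (1 + 2 * (0 + c)))"
    by (rule norm_le_diff[OF f(2)])
  then show ?thesis by auto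
qed

lemma l2_diff: assumes "\<xi> \<in> l2 X s" "\<eta> \<in> l2 X s" shows "(\<lambda>\<gamma>. \<xi> \<gamma> - \<eta> \<gamma>) \<in> l2 X s"
proof -
  have "\<exists>h\<in>Cc X s. module_norm_le X s (\<lambda>\<gamma>. (\<xi> \<gamma> - \<eta> \<gamma>) - h \<gamma>) \<epsilon>" if "\<epsilon> > 0" for \<epsilon>
  proof -
    obtain f where f: "f \<in> Cc X s" "module_norm_le X s (\<lambda>\<gamma>. \<xi> \<gamma> - f \<gamma>) (\<epsilon> / 4)"
      using l2D(2)[OF assms(1), of "\<epsilon> / 4"] \<open>\<epsilon> > 0\<close> by auto
    obtain g where g: "g \<in> Cc X s" "module_norm_le X s (\<lambda>\<gamma>. \<eta> \<gamma> - g \<gamma>) (\<epsilon> / 4)"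
      using l2D(2)[OF assms(2), of "\<epsilon> / 4"] \<open>\<epsilon> > 0\<close> by auto
    have "module_norm_le X s (\<lambda>\<gamma>. (\<xi> \<gamma> - f \<gamma>) - (\<eta> \<gamma> - g \<gamma>)) (2 * (\<epsilon> / 4 + \<epsilon> / 4))"
      by (rule norm_le_diff[OF f(2) g(2)])
    then show ?thesis by (intro bexI[OF _ Cc_diff[OF f(1) g(1)]]) (simp add: algebra_simps)
  qed
  then show ?thesis unfolding l2_def using l2D(1)[OF assms(1)] l2D(1)[OF assms(2)] by auto
qed

lemma wfun_l2:
  assumes p: "pbij D \<kappa> \<kappa>'" and c: "continuous_map (subtopology G D) euclidean c"
    and M: "\<And>\<gamma>. \<gamma> \<in> D \<Longrightarrow> cmod (c \<gamma>) \<le> M" and \<xi>: "\<xi> \<in> l2 X s"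
  shows "wfun D \<kappa> c \<xi> \<in> l2 X s"
proof -
  have "\<exists>h\<in>Cc X s. module_norm_le X s (\<lambda>\<gamma>. wfun D \<kappa> c \<xi> \<gamma> - h \<gamma>) \<epsilon>" if "\<epsilon> > 0" for \<epsilon>
  proof -
    define M' where "M' = max M 1"
    have M': "\<And>\<gamma>. \<gamma> \<in> D \<Longrightarrow> cmod (c \<gamma>) \<le> M'" "0 < M'" using M unfolding M'_def by (auto simp: le_max_iff_disj)
    have "\<epsilon> / M' > 0" using \<open>\<epsilon> > 0\<close> M'(2) by simp
    then obtain f where f: "f \<in> Cc X s" "module_norm_le X s (\<lambda>\<gamma>. \<xi> \<gamma> - f \<gamma>) (\<epsilon> / M')"
      using l2D(2)[OF \<xi>] by blast
    have "module_norm_le X s (wfun D \<kappa> c (\<lambda>\<gamma>. \<xi> \<gamma> - f \<gamma>)) (M' * (\<epsilon> / M'))"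
      using norm_le_wfun[OF pbijD(3,2,5)[OF p] M'(1) _ f(2)] M'(2) by simp
    moreover have "wfun D \<kappa> c (\<lambda>\<gamma>. \<xi> \<gamma> - f \<gamma>) = (\<lambda>\<gamma>. wfun D \<kappa> c \<xi> \<gamma> - wfun D \<kappa> c f \<gamma>)"
      unfolding wfun_def by (auto simp: algebra_simps)
    ultimately show ?thesis using M'(2) by (intro bexI[OF _ wfun_Cc[OF p c f(1)]]) simp
  qed
  moreover have "wfun D \<kappa> c \<xi> \<gamma> = 0" if "\<gamma> \<notin> A" for \<gamma> using pbijD(1)[OF p] that unfolding wfun_def by auto
  ultimately show ?thesis unfolding l2_def by blast
qed

lemma wop_operator:
  assumes "pbij D \<kappa> \<kappa>'" "continuous_map (subtopology G D) euclidean c" "\<And>\<gamma>. \<gamma> \<in> D \<Longrightarrow> cmod (c \<gamma>) \<le> M"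
  shows "wop D \<kappa> c \<in> operators X s"
  unfolding operators_def wop_def restrict_op_def using wfun_l2[OF assms] by auto

lemma wop_apply: "\<xi> \<in> l2 X s \<Longrightarrow> wop D \<kappa> c \<xi> = wfun D \<kappa> c \<xi>"
  unfolding wop_def restrict_op_def by simp

text \<open>Reindexing each source fibre along \<open>\<kappa>\<close> moves the weight to the other
  side of the inner product.\<close>

lemma wop_adjoint:
  assumes p: "pbij D \<kappa> \<kappa>'"
  shows "is_adjoint X s (wop D \<kappa> c) (wop (\<kappa> ` D) \<kappa>' (\<lambda>\<delta>. cnj (c (\<kappa>' \<delta>))))"
  unfolding is_adjoint_def
proof (intro ballI)
  fix \<xi> \<eta> z assume l: "\<xi> \<in> l2 X s" "\<eta> \<in> l2 X s"
  let ?F = "source_fibre X s z" let ?E = "?F \<inter> D" let ?E' = "?F \<inter> \<kappa> ` D"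
  have "module_inner X s (wop D \<kappa> c \<xi>) \<eta> z = (\<Sum>\<^sub>\<infinity>\<gamma>\<in>?E. cnj (\<xi> (\<kappa> \<gamma>)) * (cnj (c \<gamma>) * \<eta> \<gamma>))"
    unfolding module_inner_def wop_apply[OF l(1)]
    by (rule infsum_cong_neutral) (auto simp: wfun_def mult_ac)
  also have "... = (\<Sum>\<^sub>\<infinity>\<gamma>\<in>?E. (\<lambda>\<delta>. cnj (\<xi> \<delta>) * (cnj (c (\<kappa>' \<delta>)) * \<eta> (\<kappa>' \<delta>))) (\<kappa> \<gamma>))"
    by (rule infsum_cong) (use pbijD(4)[OF p] in auto)
  also have "... = (\<Sum>\<^sub>\<infinity>\<delta>\<in>?E'. cnj (\<xi> \<delta>) * (cnj (c (\<kappa>' \<delta>)) * \<eta> (\<kappa>' \<delta>)))"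
  proof (rule infsum_reindex_bij_betw)
    have "\<kappa> ` ?E = ?E'" using pbijD[OF p] by (auto simp: fibre_iff)
    moreover have "inj_on \<kappa> ?E" using pbijD(3)[OF p] by (meson inf_le2 inj_on_subset)
    ultimately show "bij_betw \<kappa> ?E ?E'" by (simp add: bij_betw_def)
  qed
  also have "... = module_inner X s \<xi> (wop (\<kappa> ` D) \<kappa>' (\<lambda>\<delta>. cnj (c (\<kappa>' \<delta>))) \<eta>) z"
    unfolding module_inner_def wop_apply[OF l(2)]
    by (rule infsum_cong_neutral) (auto simp: wfun_def mult_ac)
  finally show "module_inner X s (wop D \<kappa> c \<xi>) \<eta> z = module_inner X s \<xi> (wop (\<kappa> ` D) \<kappa>' (\<lambda>\<delta>. cnj (c (\<kappa>' \<delta>))) \<eta>) z" .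
qed

lemma wop_adjoint_operator:
  assumes p: "pbij D \<kappa> \<kappa>'" and c: "continuous_map (subtopology G D) euclidean c"
    and M: "\<And>\<gamma>. \<gamma> \<in> D \<Longrightarrow> cmod (c \<gamma>) \<le> M"
  shows "wop (\<kappa> ` D) \<kappa>' (\<lambda>\<delta>. cnj (c (\<kappa>' \<delta>))) \<in> operators X s"
proof (rule wop_operator[OF pbij_inverse(1)[OF p]])
  have "continuous_map (subtopology G (\<kappa> ` D)) (subtopology G D) \<kappa>'"
    using p pbijD(4)[OF p] unfolding pbij_def by (auto intro!: continuous_map_into_subtopology)
  then have "continuous_map (subtopology G (\<kappa> ` D)) euclidean (c \<circ> \<kappa>')" using c continuous_map_compose by blast
  then have "continuous_map (subtopology G (\<kappa> ` D)) euclidean (cnj \<circ> (c \<circ> \<kappa>'))"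
    by (rule continuous_map_compose) (simp add: continuous_on_cnj)
  then show "continuous_map (subtopology G (\<kappa> ` D)) euclidean (\<lambda>\<delta>. cnj (c (\<kappa>' \<delta>)))" by (simp add: o_def)
  show "\<And>\<gamma>. \<gamma> \<in> \<kappa> ` D \<Longrightarrow> cmod (cnj (c (\<kappa>' \<gamma>))) \<le> M" using M pbijD(4)[OF p] by auto
qed

lemma inner_summable:
  assumes "\<xi> \<in> l2 X s" "\<eta> \<in> l2 X s" "z \<in> topspace X"
  shows "(\<lambda>\<gamma>. cnj (\<xi> \<gamma>) * \<eta> \<gamma>) summable_on source_fibre X s z"
proof -
  obtain a where a: "module_norm_le X s \<xi> a" using l2_norm assms(1) by blast
  obtain b where b: "module_norm_le X s \<eta> b" using l2_norm assms(2) by blast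
  have *: "cmod (cnj u * v) \<le> (cmod u)\<^sup>2 + (cmod v)\<^sup>2" for u v
  proof -
    have "2 * (cmod u * cmod v) \<le> (cmod u)\<^sup>2 + (cmod v)\<^sup>2" using sum_squares_bound[of "cmod u" "cmod v"] by simp
    moreover have "0 \<le> cmod u * cmod v" by simp
    ultimately show ?thesis unfolding norm_mult complex_mod_cnj by linarith
  qed
  have "(\<lambda>\<gamma>. norm (cnj (\<xi> \<gamma>) * \<eta> \<gamma>)) summable_on source_fibre X s z"
  proof (rule summable_on_comparison_test)
    show "(\<lambda>\<gamma>. (cmod (\<xi> \<gamma>))\<^sup>2 + (cmod (\<eta> \<gamma>))\<^sup>2) summable_on source_fibre X s z"
      by (intro summable_on_add norm_leD(2)[OF a] norm_leD(2)[OF b] assms)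
  qed (rule *, simp)
  then show ?thesis by (rule abs_summable_summable)
qed

text \<open>Cauchy--Schwarz on finite parts of the fibre; the common bound gives absolute
  summability and passes to the limit.\<close>

lemma inner_bound:
  assumes "module_norm_le X s \<xi> a" "module_norm_le X s \<eta> b" "z \<in> topspace X"
  shows "cmod (module_inner X s \<xi> \<eta> z) \<le> a * b"
proof -
  let ?F = "source_fibre X s z"
  let ?S = "\<lambda>\<xi>. (\<Sum>\<^sub>\<infinity>\<gamma>\<in>?F. (cmod (\<xi> \<gamma>))\<^sup>2)"
  note s = norm_leD(2)[OF assms(1,3)] norm_leD(2)[OF assms(2,3)]
  have bd: "(\<Sum>\<gamma>\<in>E. cmod (cnj (\<xi> \<gamma>) * \<eta> \<gamma>)) \<le> a * b" if E: "finite E" "E \<subseteq> ?F" for E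
  proof -
    have "(\<Sum>\<gamma>\<in>E. cmod (cnj (\<xi> \<gamma>) * \<eta> \<gamma>)) = (\<Sum>\<gamma>\<in>E. \<bar>cmod (\<xi> \<gamma>)\<bar> * \<bar>cmod (\<eta> \<gamma>)\<bar>)"
      by (simp add: norm_mult)
    also have "... \<le> L2_set (\<lambda>\<gamma>. cmod (\<xi> \<gamma>)) E * L2_set (\<lambda>\<gamma>. cmod (\<eta> \<gamma>)) E" by (rule L2_set_mult_ineq)
    also have "... \<le> a * b"
    proof (rule mult_mono)
      have "(\<Sum>\<gamma>\<in>E. (cmod (\<xi> \<gamma>))\<^sup>2) \<le> a\<^sup>2" "(\<Sum>\<gamma>\<in>E. (cmod (\<eta> \<gamma>))\<^sup>2) \<le> b\<^sup>2"
        using finite_sum_le_infsum[OF s(1) E] finite_sum_le_infsum[OF s(2) E]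
          norm_leD(3)[OF assms(1,3)] norm_leD(3)[OF assms(2,3)] by fastforce+
      then show "L2_set (\<lambda>\<gamma>. cmod (\<xi> \<gamma>)) E \<le> a" "L2_set (\<lambda>\<gamma>. cmod (\<eta> \<gamma>)) E \<le> b"
        unfolding L2_set_def using norm_leD(1) assms(1,2) by (auto intro: real_le_lsqrt sum_nonneg)
    qed (use norm_leD(1) assms(1) in \<open>auto simp: L2_set_nonneg\<close>)
    finally show ?thesis .
  qed
  have sn: "(\<lambda>\<gamma>. cmod (cnj (\<xi> \<gamma>) * \<eta> \<gamma>)) summable_on ?F"
    by (rule nonneg_bounded_partial_sums_imp_summable_on[of _ _ "a * b"]) (use bd in \<open>auto intro!: eventually_finite_subsets_at_top_weakI\<close>)
  have "cmod (module_inner X s \<xi> \<eta> z) \<le> (\<Sum>\<^sub>\<infinity>\<gamma>\<in>?F. cmod (cnj (\<xi> \<gamma>) * \<eta> \<gamma>))"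
    unfolding module_inner_def by (rule norm_infsum_bound[OF sn])
  also have "... \<le> a * b" by (rule infsum_le_finite_sums[OF sn bd])
  finally show ?thesis .
qed

lemma inner_diff_right:
  assumes "\<xi> \<in> l2 X s" "\<eta> \<in> l2 X s" "\<zeta> \<in> l2 X s" "z \<in> topspace X"
  shows "module_inner X s \<xi> (\<lambda>\<gamma>. \<eta> \<gamma> - \<zeta> \<gamma>) z = module_inner X s \<xi> \<eta> z - module_inner X s \<xi> \<zeta> z"
proof -
  note s2 = inner_summable[OF assms(1,2,4)] and s3 = inner_summable[OF assms(1,3,4)]
  have "(\<lambda>\<gamma>. cnj (\<xi> \<gamma>) * (\<eta> \<gamma> - \<zeta> \<gamma>)) = (\<lambda>\<gamma>. cnj (\<xi> \<gamma>) * \<eta> \<gamma> + (-1) * (cnj (\<xi> \<gamma>) * \<zeta> \<gamma>))"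
    by (simp add: algebra_simps)
  then show ?thesis unfolding module_inner_def
    using infsum_add[OF s2 summable_on_cmult_right[OF s3, of "-1"]] infsum_cmult_right'[of "-1"] by simp
qed

lemma inner_commute: "module_inner X s \<eta> \<xi> z = cnj (module_inner X s \<xi> \<eta> z)"
  unfolding module_inner_def by (simp flip: infsum_cnj add: mult.commute)

lemma inner_self:
  assumes "\<xi> \<in> l2 X s" "\<And>z. z \<in> topspace X \<Longrightarrow> module_inner X s \<xi> \<xi> z = 0" shows "\<xi> = (\<lambda>_. 0)"
proof
  fix \<gamma> show "\<xi> \<gamma> = 0"
  proof (cases "\<gamma> \<in> A")
    case True
    let ?z = "snd (snd \<gamma>)"
    have z: "?z \<in> topspace X" using arrow_topspace True by blast
    obtain a where a: "module_norm_le X s \<xi> a" using l2_norm assms(1) by blast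
    have "((\<lambda>\<gamma>. of_real ((cmod (\<xi> \<gamma>))\<^sup>2) :: complex) has_sum of_real (\<Sum>\<^sub>\<infinity>\<gamma>\<in>source_fibre X s ?z. (cmod (\<xi> \<gamma>))\<^sup>2)) (source_fibre X s ?z)"
      by (rule has_sum_of_real) (rule has_sum_infsum[OF norm_leD(2)[OF a z]])
    moreover have "(\<lambda>\<gamma>. of_real ((cmod (\<xi> \<gamma>))\<^sup>2)) = (\<lambda>\<gamma>. cnj (\<xi> \<gamma>) * \<xi> \<gamma>)"
      by (simp add: complex_norm_square mult.commute del: of_real_power)
    ultimately have "((\<lambda>\<gamma>. cnj (\<xi> \<gamma>) * \<xi> \<gamma>) has_sum of_real (\<Sum>\<^sub>\<infinity>\<gamma>\<in>source_fibre X s ?z. (cmod (\<xi> \<gamma>))\<^sup>2)) (source_fibre X s ?z)"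
      by simp
    from infsumI[OF this] have "(\<Sum>\<^sub>\<infinity>\<gamma>\<in>source_fibre X s ?z. (cmod (\<xi> \<gamma>))\<^sup>2) = 0"
      using assms(2)[OF z] unfolding module_inner_def by simp
    then have "(cmod (\<xi> \<gamma>))\<^sup>2 = 0"
      using nonneg_infsum_le_0D[OF _ norm_leD(2)[OF a z], of \<gamma>] True by (simp add: fibre_iff)
    then show ?thesis by simp
  qed (use l2D(1)[OF assms(1)] in blast)
qed

lemma inner_ext:
  assumes "\<eta> \<in> l2 X s" "\<zeta> \<in> l2 X s"
    "\<And>\<xi> z. \<xi> \<in> l2 X s \<Longrightarrow> z \<in> topspace X \<Longrightarrow> module_inner X s \<xi> \<eta> z = module_inner X s \<xi> \<zeta> z"
  shows "\<eta> = \<zeta>"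
proof -
  let ?d = "\<lambda>\<gamma>. \<eta> \<gamma> - \<zeta> \<gamma>"
  have d: "?d \<in> l2 X s" using l2_diff assms by blast
  have "?d = (\<lambda>_. 0)" by (rule inner_self[OF d]) (simp add: inner_diff_right[OF d assms(1,2)] assms(3)[OF d])
  then have "\<eta> \<gamma> - \<zeta> \<gamma> = 0" for \<gamma> by metis
  then show ?thesis by auto
qed

lemma operator_l2: "T \<in> operators X s \<Longrightarrow> \<xi> \<in> l2 X s \<Longrightarrow> T \<xi> \<in> l2 X s"
  unfolding operators_def by blast

lemma operator_ext:
  assumes "S \<in> operators X s" "T \<in> operators X s" "\<And>\<xi>. \<xi> \<in> l2 X s \<Longrightarrow> S \<xi> = T \<xi>" shows "S = T"
proof
  fix \<xi> show "S \<xi> = T \<xi>" using assms unfolding operators_def by (cases "\<xi> \<in> l2 X s") auto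
qed

text \<open>\<open>op_star\<close> is a definite description, so every computation of an adjoint
  rests on this uniqueness, through \<open>op_star_eqI\<close>.\<close>

lemma adjoint_unique:
  assumes "S \<in> operators X s" "S' \<in> operators X s" "is_adjoint X s T S" "is_adjoint X s T S'" shows "S = S'"
proof (rule operator_ext[OF assms(1,2)])
  fix \<eta> assume \<eta>: "\<eta> \<in> l2 X s"
  show "S \<eta> = S' \<eta>"
  proof (rule inner_ext)
    show "S \<eta> \<in> l2 X s" "S' \<eta> \<in> l2 X s" using operator_l2 assms(1,2) \<eta> by blast+
    show "module_inner X s \<xi> (S \<eta>) z = module_inner X s \<xi> (S' \<eta>) z"
      if "\<xi> \<in> l2 X s" "z \<in> topspace X" for \<xi> z
    proof -
      have "module_inner X s (T \<xi>) \<eta> z = module_inner X s \<xi> (S \<eta>) z"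
        "module_inner X s (T \<xi>) \<eta> z = module_inner X s \<xi> (S' \<eta>) z"
        using assms(3,4) that \<eta> unfolding is_adjoint_def by blast+
      then show ?thesis by simp
    qed
  qed
qed

lemma op_star_eqI:
  assumes "S \<in> operators X s" "is_adjoint X s T S" shows "op_star X s T = S"
  unfolding op_star_def by (rule the_equality) (use assms adjoint_unique in blast)+

end

lemma continuous_map_indicator:
  assumes "openin Z C" "closedin Z C"
  shows "continuous_map Z euclidean (indicator C :: _ \<Rightarrow> 'b :: {topological_space, zero_neq_one})"
proof -
  have "continuous_map Z euclidean (\<lambda>z. if z \<in> C then 1 :: 'b else 0)"
    using assms by (rule continuous_map_extend_by_zero) simp
  then show ?thesis unfolding indicator_def by (simp add: of_bool_def)
qed

section \<open>Faithfulness of evaluation at the unit vector\<close>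

context dr_system
begin

text \<open>The indicator of the units as a vector. An operator applied to it yields the function on
  the groupoid that represents the operator; see \<open>conv_e0\<close> and
  \<open>reduced_faithful\<close>.\<close>

definition e0 :: "'x vec" where "e0 = graph_fun 0 (\<lambda>_. 1)"

lemma e0_apply: "e0 (x, n, z) = (if x \<in> topspace X \<and> n = 0 \<and> z = x then 1 else 0)"
  unfolding e0_def graph_fun_def graph_def by auto

lemma e0_Cc: "e0 \<in> Cc X s"
  unfolding e0_def by (rule graph_fun_Cc) simp

lemma e0_l2: "e0 \<in> l2 X s"
  using e0_Cc Cc_l2 by blast

lemma unit_A: "x \<in> topspace X \<Longrightarrow> (x, 0, x) \<in> A"
  by (rule arrowsI[of x x 0 0]) auto

lemma e0_norm: "module_norm_le X s e0 1"
proof -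
  have "(\<lambda>\<gamma>. (cmod (e0 \<gamma>))\<^sup>2) summable_on source_fibre X s z \<and>
      (\<Sum>\<^sub>\<infinity>\<gamma>\<in>source_fibre X s z. (cmod (e0 \<gamma>))\<^sup>2) \<le> 1\<^sup>2" if z: "z \<in> topspace X" for z
  proof -
    have e: "e0 \<gamma> = (if \<gamma> = (z, 0, z) then 1 else 0)" if "\<gamma> \<in> source_fibre X s z" for \<gamma>
      using that z unfolding fibre_iff by (cases \<gamma>) (auto simp: e0_apply)
    have zf: "(z, 0, z) \<in> source_fibre X s z" using z unit_A by (simp add: fibre_iff)
    have "(\<lambda>\<gamma>. (cmod (e0 \<gamma>))\<^sup>2) summable_on {(z, 0, z)}" by (rule summable_on_finite) simp
    then have s: "(\<lambda>\<gamma>. (cmod (e0 \<gamma>))\<^sup>2) summable_on source_fibre X s z"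
      by (rule iffD1[OF summable_on_cong_neutral, rotated -1]) (use e zf in auto)
    have "(\<Sum>\<^sub>\<infinity>\<gamma>\<in>source_fibre X s z. (cmod (e0 \<gamma>))\<^sup>2) = (\<Sum>\<^sub>\<infinity>\<gamma>\<in>{(z, 0, z)}. (cmod (e0 \<gamma>))\<^sup>2)"
      by (rule infsum_cong_neutral) (use e zf in auto)
    also have "... = 1" using e[OF zf] by simp
    finally show ?thesis using s by simp
  qed
  then show ?thesis unfolding module_norm_le_def by simp
qed

lemma continuous_bounded:
  assumes "continuous_map X (euclidean :: complex topology) \<phi>"
  shows "\<exists>M. \<forall>x\<in>topspace X. cmod (\<phi> x) \<le> M"
proof -
  have "compactin euclidean (\<phi> ` topspace X)" using image_compactin assms compact_X compact_space_def by blast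
  then have "bounded (\<phi> ` topspace X)" by (simp add: compact_imp_bounded)
  then show ?thesis unfolding bounded_iff by blast
qed

lemma pbij_id: "pbij A id id"
  unfolding pbij_def using openin_topspace[of G] closedin_topspace[of G]
  by (simp add: continuous_map_from_subtopology)

lemma mult_cont:
  assumes "continuous_map G euclidean c" shows "continuous_map (subtopology G A) euclidean c"
  using assms by (rule continuous_map_from_subtopology)

text \<open>The right action of C(X) on the module, by functions of the source; \<open>diag\<close>
  below uses functions of the range.\<close>

definition rmul :: "('x \<Rightarrow> complex) \<Rightarrow> 'x vec \<Rightarrow> 'x vec" where
  "rmul b = wfun A id (\<lambda>\<gamma>. b (snd (snd \<gamma>)))"

lemma source_fun_cont: "b \<in> CX \<Longrightarrow> continuous_map (subtopology G A) euclidean (\<lambda>\<gamma>. b (snd (snd \<gamma>)))"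
  using mult_cont continuous_map_compose[OF source_cont, of euclidean b] by (simp add: o_def)

lemma range_fun_cont: "b \<in> CX \<Longrightarrow> continuous_map (subtopology G D) euclidean (\<lambda>\<gamma>. b (fst \<gamma>))"
  using continuous_map_from_subtopology continuous_map_compose[OF range_cont, of euclidean b] by (simp add: o_def)

lemma rmul_l2: assumes "b \<in> CX" "\<xi> \<in> l2 X s" shows "rmul b \<xi> \<in> l2 X s"
proof -
  obtain M where "\<forall>x\<in>topspace X. cmod (b x) \<le> M" using continuous_bounded assms(1) by blast
  then show ?thesis unfolding rmul_def
    by (intro wfun_l2[OF pbij_id source_fun_cont[OF assms(1)] _ assms(2), of M]) (use arrow_topspace in auto)
qed

text \<open>Adjointable maps are module maps: the scalar at \<open>z\<close> comes out of the inner
  product at \<open>z\<close>, on either side of the adjoint.\<close>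

lemma module_linear:
  assumes T: "T \<in> adjointables X s" and b: "b \<in> CX" and \<xi>: "\<xi> \<in> l2 X s"
  shows "T (rmul b \<xi>) = rmul b (T \<xi>)"
proof -
  obtain S where S: "S \<in> operators X s" "is_adjoint X s T S" and T': "T \<in> operators X s"
    using T unfolding adjointables_def by blast
  have l: "rmul b \<xi> \<in> l2 X s" "T \<xi> \<in> l2 X s" "T (rmul b \<xi>) \<in> l2 X s" "rmul b (T \<xi>) \<in> l2 X s"
    using rmul_l2 b \<xi> operator_l2 T' by metis+
  have r: "module_inner X s (rmul b \<zeta>) \<eta> z = cnj (b z) * module_inner X s \<zeta> \<eta> z" for \<zeta> \<eta> z
  proof -
    have "module_inner X s (rmul b \<zeta>) \<eta> z = (\<Sum>\<^sub>\<infinity>\<gamma>\<in>source_fibre X s z. cnj (b z) * (cnj (\<zeta> \<gamma>) * \<eta> \<gamma>))"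
      unfolding module_inner_def rmul_def wfun_def by (rule infsum_cong) (auto simp: fibre_iff)
    then show ?thesis unfolding module_inner_def by (simp add: infsum_cmult_right')
  qed
  show ?thesis
  proof (rule inner_ext[OF l(3,4)])
    fix \<eta> z assume \<eta>: "\<eta> \<in> l2 X s" "z \<in> topspace X"
    have "module_inner X s (T (rmul b \<xi>)) \<eta> z = module_inner X s (rmul b \<xi>) (S \<eta>) z"
      using S(2) l(1) \<eta> unfolding is_adjoint_def by blast
    also have "... = cnj (b z) * module_inner X s (T \<xi>) \<eta> z"
      using S(2) \<xi> \<eta> unfolding is_adjoint_def r by metis
    also have "... = module_inner X s (rmul b (T \<xi>)) \<eta> z" by (simp add: r)
    finally show "module_inner X s \<eta> (T (rmul b \<xi>)) z = module_inner X s \<eta> (rmul b (T \<xi>)) z"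
      using inner_commute by metis
  qed
qed

lemma conv_apply: "\<xi> \<in> l2 X s \<Longrightarrow> conv_op X s f \<xi> \<gamma> = (\<Sum>\<^sub>\<infinity>(\<beta>, \<delta>)\<in>factorizations X s \<gamma>. f \<beta> * \<xi> \<delta>)"
  unfolding conv_op_def restrict_op_def by simp

lemma factorization_cases:
  assumes "\<beta>\<delta> \<in> factorizations X s \<gamma>"
  obtains x n z m w where "\<beta>\<delta> = ((x, n, z), (z, m, w))" "(x, n, z) \<in> A" "(z, m, w) \<in> A" "\<gamma> = (x, n + m, w)"
  using assms unfolding factorizations_def by blast

lemma arrow_comp: assumes "(x, n, z) \<in> A" "(z, m, w) \<in> A" shows "(x, n + m, w) \<in> A"
proof -
  obtain p q where 1: "x \<in> topspace X" "n = int p - int q" "(s ^^ p) x = (s ^^ q) z" using assms(1) by (rule arrowsE)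
  obtain a b where 2: "w \<in> topspace X" "m = int a - int b" "(s ^^ a) z = (s ^^ b) w" using assms(2) by (rule arrowsE)
  have "(s ^^ (a + p)) x = (s ^^ (q + b)) w"
    by (simp add: funpow_add 1(3) 2(3)[symmetric]) (metis 2(3) add.commute comp_apply funpow_add)
  then show ?thesis using 1 2 by (intro arrowsI[of _ _ "a + p" "q + b"]) auto
qed

lemma factorizations_empty: "\<gamma> \<notin> A \<Longrightarrow> factorizations X s \<gamma> = {}"
  by (auto elim!: factorization_cases dest: arrow_comp)

lemma conv_e0: assumes "\<gamma> \<in> A" shows "conv_op X s f e0 \<gamma> = f \<gamma>"
proof -
  obtain x n z where g: "\<gamma> = (x, n, z)" by (metis prod.collapse)
  have z: "z \<in> topspace X" using arrow_topspace assms g by auto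
  let ?i = "((x, n, z), (z, 0, z))"
  have "conv_op X s f e0 \<gamma> = (\<Sum>\<^sub>\<infinity>(\<beta>, \<delta>)\<in>{?i}. f \<beta> * e0 \<delta>)"
    unfolding conv_apply[OF e0_l2]
  proof (rule infsum_cong_neutral)
    show "\<And>y. y \<in> {?i} - factorizations X s \<gamma> \<Longrightarrow> (case y of (\<beta>, \<delta>) \<Rightarrow> f \<beta> * e0 \<delta>) = 0"
      using assms unit_A[OF z] g unfolding factorizations_def by auto
    fix y assume y: "y \<in> factorizations X s \<gamma> - {?i}"
    then have "y \<in> factorizations X s \<gamma>" by blast
    then show "(case y of (\<beta>, \<delta>) \<Rightarrow> f \<beta> * e0 \<delta>) = 0"
      by (rule factorization_cases) (use y g in \<open>auto simp: e0_apply\<close>)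
  qed auto
  also have "... = f \<gamma>" using z g by (simp add: e0_apply)
  finally show ?thesis .
qed

text \<open>In a factorization of \<gamma> the second factor determines the first and lies over the
  source of \<gamma>, so at most \<open>n\<close> terms of the convolution are nonzero.\<close>

lemma conv_bound:
  assumes f: "\<And>\<beta>. \<beta> \<in> A \<Longrightarrow> cmod (f \<beta>) \<le> \<epsilon>" "0 \<le> \<epsilon>" and \<xi>: "\<xi> \<in> Cc X s"
    and M: "0 \<le> M" "\<And>\<gamma>. cmod (\<xi> \<gamma>) \<le> M"
     "\<And>z. finite {\<gamma> \<in> source_fibre X s z. \<xi> \<gamma> \<noteq> 0} \<and> card {\<gamma> \<in> source_fibre X s z. \<xi> \<gamma> \<noteq> 0} \<le> n"
  shows "cmod (conv_op X s f \<xi> \<gamma>) \<le> real n * (\<epsilon> * M)"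
proof -
  obtain x0 k w where g: "\<gamma> = (x0, k, w)" by (metis prod.collapse)
  let ?P = "{y \<in> factorizations X s \<gamma>. \<xi> (snd y) \<noteq> 0}"
  have inj: "inj_on snd ?P"
    by (auto simp: inj_on_def elim!: factorization_cases)
  have sub: "snd ` ?P \<subseteq> {\<gamma> \<in> source_fibre X s w. \<xi> \<gamma> \<noteq> 0}"
    using g by (auto simp: fibre_iff elim!: factorization_cases)
  have finP: "finite ?P" using finite_imageD[OF finite_subset[OF sub] inj] M(3) by blast
  have "card ?P = card (snd ` ?P)" using card_image[OF inj] by simp
  also have "... \<le> n" using card_mono[OF _ sub] M(3)[of w] by (meson order_trans)
  finally have cardP: "card ?P \<le> n" .
  have "conv_op X s f \<xi> \<gamma> = (\<Sum>\<^sub>\<infinity>(\<beta>, \<delta>)\<in>?P. f \<beta> * \<xi> \<delta>)"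
    unfolding conv_apply[OF Cc_l2[OF \<xi>]] by (rule infsum_cong_neutral) auto
  also have "... = (\<Sum>(\<beta>, \<delta>)\<in>?P. f \<beta> * \<xi> \<delta>)" using finP by (rule infsum_finite)
  also have "cmod ... \<le> (\<Sum>y\<in>?P. \<epsilon> * M)"
  proof (rule sum_norm_le)
    fix y assume "y \<in> ?P"
    then have "y \<in> factorizations X s \<gamma>" by blast
    then have "fst y \<in> A" by (rule factorization_cases) auto
    then have "cmod (f (fst y)) * cmod (\<xi> (snd y)) \<le> \<epsilon> * M" using f M by (intro mult_mono) auto
    then show "cmod (case y of (\<beta>, \<delta>) \<Rightarrow> f \<beta> * \<xi> \<delta>) \<le> \<epsilon> * M" by (simp add: case_prod_beta norm_mult)
  qed
  also have "... \<le> real n * (\<epsilon> * M)" using cardP f(2) M(1) by (simp add: mult_right_mono)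
  finally show ?thesis .
qed

lemma reducedD:
  assumes "Q \<in> reduced_cstar X s"
  shows "Q \<in> adjointables X s" "Q \<in> operators X s"
    "\<epsilon> > 0 \<Longrightarrow> \<exists>f\<in>Cc X s. op_norm_le X s (op_diff Q (conv_op X s f)) \<epsilon>"
  using assms unfolding reduced_cstar_def adjointables_def by blast+

text \<open>A function \<open>f\<close> approximating \<open>Q\<close> is uniformly small because
  \<open>Q e0 = 0\<close>, so by \<open>conv_bound\<close> \<open>Q\<close> vanishes on
  \<open>Cc\<close>. Members of \<open>operators\<close> carry no norm bound, so the passage to
  \<open>l2\<close> goes through the adjoint \<open>R\<close>: each \<open>R \<eta>\<close> is
  orthogonal to the dense set \<open>Cc\<close>, hence \<open>R\<close> vanishes, and with it
  \<open>Q\<close>.\<close>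

lemma reduced_faithful:
  assumes Q: "Q \<in> reduced_cstar X s" and 0: "Q e0 = (\<lambda>_. 0)"
  shows "Q = (\<lambda>_ _. 0)"
proof -
  have Cc0: "Q \<xi> \<gamma> = 0" if \<xi>: "\<xi> \<in> Cc X s" for \<xi> \<gamma>
  proof (cases "\<gamma> \<in> A")
    case False
    then show ?thesis using l2D(1)[OF operator_l2[OF reducedD(2)[OF Q] Cc_l2[OF \<xi>]]] by blast
  next
    case True
    obtain n M where M: "0 \<le> M" "\<And>\<gamma>. cmod (\<xi> \<gamma>) \<le> M"
      "\<And>z. finite {\<gamma> \<in> source_fibre X s z. \<xi> \<gamma> \<noteq> 0} \<and> card {\<gamma> \<in> source_fibre X s z. \<xi> \<gamma> \<noteq> 0} \<le> n"
      using Cc_bounds[OF \<xi>] by blast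
    obtain c where c: "module_norm_le X s \<xi> c" using Cc_norm[OF \<xi>] by blast
    then have c0: "0 \<le> c" by (rule norm_leD)
    have b: "cmod (Q \<xi> \<gamma>) \<le> \<epsilon> * (c + real n * M)" if \<epsilon>: "\<epsilon> > 0" for \<epsilon>
    proof -
      obtain f where f: "f \<in> Cc X s" "op_norm_le X s (op_diff Q (conv_op X s f)) \<epsilon>"
        using reducedD(3)[OF Q \<epsilon>] by blast
      have "module_norm_le X s (op_diff Q (conv_op X s f) e0) (\<epsilon> * 1)"
        using f(2) e0_l2 e0_norm unfolding op_norm_le_def by blast
      then have nf: "module_norm_le X s (\<lambda>\<gamma>. 0 - conv_op X s f e0 \<gamma>) \<epsilon>"
        unfolding op_diff_def 0 by simp
      have "cmod (f \<beta>) \<le> \<epsilon>" if "\<beta> \<in> A" for \<beta>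
        using norm_le_point[OF nf that] unfolding conv_e0[OF that] by simp
      then have 1: "cmod (conv_op X s f \<xi> \<gamma>) \<le> real n * (\<epsilon> * M)"
        using conv_bound[OF _ _ \<xi> M] \<epsilon> by simp
      have "module_norm_le X s (op_diff Q (conv_op X s f) \<xi>) (\<epsilon> * c)"
        using f(2) Cc_l2[OF \<xi>] c unfolding op_norm_le_def by blast
      then have "cmod (Q \<xi> \<gamma> - conv_op X s f \<xi> \<gamma>) \<le> \<epsilon> * c"
        using norm_le_point[OF _ True] unfolding op_diff_def by blast
      then show ?thesis using 1 norm_triangle_sub[of "Q \<xi> \<gamma>" "conv_op X s f \<xi> \<gamma>"] by (simp add: algebra_simps)
    qed
    have "cmod (Q \<xi> \<gamma>) \<le> 0 + e" if e: "e > 0" for e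
    proof -
      let ?C = "c + real n * M"
      have C: "?C \<ge> 0" using c0 M(1) by simp
      have "cmod (Q \<xi> \<gamma>) \<le> e / (?C + 1) * ?C" using b[of "e / (?C + 1)"] e C by simp
      also have "... \<le> e" using e C by (simp add: field_simps)
      finally show ?thesis by simp
    qed
    then have "cmod (Q \<xi> \<gamma>) \<le> 0" by (rule field_le_epsilon)
    then show ?thesis by simp
  qed
  obtain R where R: "R \<in> operators X s" "is_adjoint X s Q R" using reducedD(1)[OF Q] unfolding adjointables_def by blast
  have R0: "R \<eta> = (\<lambda>_. 0)" if \<eta>: "\<eta> \<in> l2 X s" for \<eta>
  proof (rule inner_self)
    show l: "R \<eta> \<in> l2 X s" using operator_l2 R(1) \<eta> by blast
    fix z assume z: "z \<in> topspace X"
    obtain c where c: "module_norm_le X s (R \<eta>) c" using l2_norm[OF l] by blast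
    have c0: "0 \<le> c" using c by (rule norm_leD)
    have "cmod (module_inner X s (R \<eta>) (R \<eta>) z) \<le> 0 + e" if e: "e > 0" for e
    proof -
      define d where "d = e / (c + 1)"
      have d: "d > 0" "d * c \<le> e" unfolding d_def using e c0 by (auto simp: field_simps)
      obtain f where f: "f \<in> Cc X s" "module_norm_le X s (\<lambda>\<gamma>. R \<eta> \<gamma> - f \<gamma>) d" using l2D(2)[OF l d(1)] by blast
      have "module_inner X s f (R \<eta>) z = module_inner X s (Q f) \<eta> z"
        using R(2) Cc_l2[OF f(1)] \<eta> z unfolding is_adjoint_def by metis
      also have "... = 0" unfolding module_inner_def by (simp add: Cc0[OF f(1)])
      finally have "module_inner X s (R \<eta>) f z = 0" using inner_commute by (metis complex_cnj_zero)
      then have "module_inner X s (R \<eta>) (R \<eta>) z = module_inner X s (R \<eta>) (\<lambda>\<gamma>. R \<eta> \<gamma> - f \<gamma>) z"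
        using inner_diff_right[OF l l Cc_l2[OF f(1)] z] by simp
      also have "cmod ... \<le> c * d" by (rule inner_bound[OF c f(2) z])
      finally show ?thesis using d(2) by (simp add: mult.commute)
    qed
    then have "cmod (module_inner X s (R \<eta>) (R \<eta>) z) \<le> 0" by (rule field_le_epsilon)
    then show "module_inner X s (R \<eta>) (R \<eta>) z = 0" by simp
  qed
  have "Q \<xi> = (\<lambda>_. 0)" for \<xi>
  proof (cases "\<xi> \<in> l2 X s")
    case True
    show ?thesis
    proof (rule inner_self)
      show l: "Q \<xi> \<in> l2 X s" using operator_l2[OF reducedD(2)[OF Q] True] .
      fix z assume "z \<in> topspace X"
      then have "module_inner X s (Q \<xi>) (Q \<xi>) z = module_inner X s \<xi> (R (Q \<xi>)) z"
        using R(2) True l unfolding is_adjoint_def by blast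
      then show "module_inner X s (Q \<xi>) (Q \<xi>) z = 0" unfolding R0[OF l] module_inner_def by simp
    qed
  qed (use reducedD(2)[OF Q] in \<open>auto simp: operators_def\<close>)
  then show ?thesis by blast
qed

lemma reducedI:
  assumes "f \<in> Cc X s" "conv_op X s f \<in> adjointables X s" shows "conv_op X s f \<in> reduced_cstar X s"
proof -
  have "op_norm_le X s (op_diff (conv_op X s f) (conv_op X s f)) \<epsilon>" if "\<epsilon> > 0" for \<epsilon>
    unfolding op_norm_le_def op_diff_def using that norm_leD(1) by (auto intro!: norm_zero)
  then show ?thesis unfolding reduced_cstar_def using assms by blast
qed

subsection \<open>Functions on graphs of powers\<close>

text \<open>Left multiplication by the inverse of the arrow \<open>graph p x\<close>, where
  \<open>x\<close> is the range of \<gamma>.\<close>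

definition jmap :: "nat \<Rightarrow> 'x arrow \<Rightarrow> 'x arrow" where
  "jmap p \<gamma> = ((s ^^ p) (fst \<gamma>), fst (snd \<gamma>) - int p, snd (snd \<gamma>))"

lemma funpow_swap: "(s ^^ a) ((s ^^ b) x) = (s ^^ b) ((s ^^ a) x)"
  by (metis add.commute comp_apply funpow_add)

lemma jmap_A: assumes "\<gamma> \<in> A" shows "jmap p \<gamma> \<in> A"
proof -
  obtain x n z where g: "\<gamma> = (x, n, z)" by (metis prod.collapse)
  then have "(x, n, z) \<in> A" using assms by simp
  then obtain a b where "x \<in> topspace X" "z \<in> topspace X" "n = int a - int b" "(s ^^ a) x = (s ^^ b) z" by (rule arrowsE)
  moreover from this have "(s ^^ a) ((s ^^ p) x) = (s ^^ (b + p)) z"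
    using funpow_swap[of a p x] funpow_swap[of b p z] by (simp add: funpow_add)
  ultimately show ?thesis unfolding g jmap_def using pow_topspace
    by (intro arrowsI[of _ _ a "b + p"]) auto
qed

text \<open>The graph of a power contains exactly one arrow with the range of \<gamma>, so the
  convolution sum has a single term. The exponents 0 and 1 give the diagonal operators and the
  generators.\<close>

lemma conv_graph:
  "conv_op X s (graph_fun p \<phi>) = restrict_op X s (wfun A (jmap p) (\<lambda>\<gamma>. \<phi> (fst \<gamma>)))"
proof
  fix \<xi> show "conv_op X s (graph_fun p \<phi>) \<xi> = restrict_op X s (wfun A (jmap p) (\<lambda>\<gamma>. \<phi> (fst \<gamma>))) \<xi>"
  proof (cases "\<xi> \<in> l2 X s")
    case True
    have "conv_op X s (graph_fun p \<phi>) \<xi> \<gamma> = wfun A (jmap p) (\<lambda>\<gamma>. \<phi> (fst \<gamma>)) \<xi> \<gamma>" for \<gamma>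
    proof (cases "\<gamma> \<in> A")
      case False
      then show ?thesis unfolding conv_apply[OF True] factorizations_empty[OF False] by (simp add: wfun_def)
    next
      case g: True
      obtain x n w where xw: "\<gamma> = (x, n, w)" by (metis prod.collapse)
      have x: "x \<in> topspace X" using arrow_topspace(1)[OF g] xw by simp
      let ?i = "(graph p x, jmap p \<gamma>)"
      have i: "?i \<in> factorizations X s \<gamma>"
        using graph_A[OF x, of p] jmap_A[OF g, of p] xw unfolding factorizations_def graph_def jmap_def by auto
      have "conv_op X s (graph_fun p \<phi>) \<xi> \<gamma> = (\<Sum>\<^sub>\<infinity>(\<beta>, \<delta>)\<in>{?i}. graph_fun p \<phi> \<beta> * \<xi> \<delta>)"
        unfolding conv_apply[OF True]
      proof (rule infsum_cong_neutral)
        fix y assume y: "y \<in> factorizations X s \<gamma> - {?i}"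
        then have "y \<in> factorizations X s \<gamma>" by blast
        then show "(case y of (\<beta>, \<delta>) \<Rightarrow> graph_fun p \<phi> \<beta> * \<xi> \<delta>) = 0"
          by (rule factorization_cases) (use y xw in \<open>auto simp: graph_fun_def graph_def jmap_def\<close>)
      qed (use i in auto)
      also have "... = wfun A (jmap p) (\<lambda>\<gamma>. \<phi> (fst \<gamma>)) \<xi> \<gamma>"
        using g x xw by (auto simp: wfun_def graph_fun_def) (auto simp: graph_def)
      finally show ?thesis .
    qed
    then show ?thesis using True unfolding restrict_op_def by auto
  next
    case False then show ?thesis unfolding conv_op_def restrict_op_def by simp
  qed
qed

lemma jmap_0: "jmap 0 \<gamma> = \<gamma>"
  unfolding jmap_def by simp

definition diag :: "('x \<Rightarrow> complex) \<Rightarrow> 'x oper" where "diag \<phi> = conv_op X s (graph_fun 0 \<phi>)"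

lemma diag_wop: "diag \<phi> = wop A id (\<lambda>\<gamma>. \<phi> (fst \<gamma>))"
  unfolding diag_def conv_graph wop_def wfun_def jmap_0 id_def ..

lemma diag_apply: "\<xi> \<in> l2 X s \<Longrightarrow> diag \<phi> \<xi> \<gamma> = (if \<gamma> \<in> A then \<phi> (fst \<gamma>) * \<xi> \<gamma> else 0)"
  unfolding diag_wop wop_apply by (simp add: wop_apply wfun_def)

lemma diag_adj:
  assumes "\<phi> \<in> CX"
  shows "diag \<phi> \<in> operators X s" "is_adjoint X s (diag \<phi>) (diag (\<lambda>x. cnj (\<phi> x)))"
    "diag (\<lambda>x. cnj (\<phi> x)) \<in> operators X s"
proof -
  obtain M where "\<forall>x\<in>topspace X. cmod (\<phi> x) \<le> M" using continuous_bounded assms(1) by blast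
  then have M: "\<And>\<gamma>. \<gamma> \<in> A \<Longrightarrow> cmod (\<phi> (fst \<gamma>)) \<le> M" using arrow_topspace by blast
  show "diag \<phi> \<in> operators X s" unfolding diag_wop
    by (rule wop_operator[OF pbij_id range_fun_cont[OF assms] M])
  show "is_adjoint X s (diag \<phi>) (diag (\<lambda>x. cnj (\<phi> x)))" unfolding diag_wop
    using wop_adjoint[OF pbij_id, of "\<lambda>\<gamma>. \<phi> (fst \<gamma>)"] by simp
  show "diag (\<lambda>x. cnj (\<phi> x)) \<in> operators X s" unfolding diag_wop
    using wop_adjoint_operator[OF pbij_id range_fun_cont[OF assms] M] by simp
qed

lemma diag_star: "\<phi> \<in> CX \<Longrightarrow> op_star X s (diag \<phi>) = diag (\<lambda>x. cnj (\<phi> x))"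
  using op_star_eqI diag_adj by blast

lemma diag_reduced: "\<phi> \<in> CX \<Longrightarrow> diag \<phi> \<in> reduced_cstar X s"
  unfolding diag_def
  by (rule reducedI[OF graph_fun_Cc]) (use diag_adj in \<open>auto simp: adjointables_def diag_def\<close>)

lemma diag_norm:
  assumes "\<And>x. x \<in> topspace X \<Longrightarrow> cmod (\<phi> x) \<le> M" "0 \<le> M" shows "op_norm_le X s (diag \<phi>) M"
  unfolding op_norm_le_def
proof (intro ballI allI impI)
  fix \<xi> r assume "\<xi> \<in> l2 X s" "module_norm_le X s \<xi> r"
  then show "module_norm_le X s (diag \<phi> \<xi>) (M * r)" unfolding diag_wop wop_apply[OF \<open>\<xi> \<in> l2 X s\<close>]
    using assms arrow_topspace by (intro norm_le_wfun) auto
qed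

lemma diag_mult:
  assumes "\<psi> \<in> CX" shows "diag \<phi> \<circ> diag \<psi> = diag (\<lambda>x. \<phi> x * \<psi> x)"
proof
  fix \<xi> show "(diag \<phi> \<circ> diag \<psi>) \<xi> = diag (\<lambda>x. \<phi> x * \<psi> x) \<xi>"
  proof (cases "\<xi> \<in> l2 X s")
    case True
    then show ?thesis using diag_apply diag_apply[OF operator_l2[OF diag_adj(1)[OF assms] True]] by (auto simp: True)
  next
    case False
    then have 1: "diag \<psi> \<xi> = (\<lambda>_. 0)" "diag (\<lambda>x. \<phi> x * \<psi> x) \<xi> = (\<lambda>_. 0)" unfolding diag_wop wop_def restrict_op_def by auto
    have "(\<lambda>_. 0) \<in> l2 X s" using l2_diff[OF e0_l2 e0_l2] by simp
    then show ?thesis using 1 diag_apply by auto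
  qed
qed

lemma diag_add: "op_add (diag \<phi>) (diag \<psi>) = diag (\<lambda>x. \<phi> x + \<psi> x)"
  unfolding op_add_def diag_wop wop_def restrict_op_def wfun_def by (auto simp: fun_eq_iff algebra_simps)

lemma diag_diff: "op_diff (diag \<phi>) (diag \<psi>) = diag (\<lambda>x. \<phi> x - \<psi> x)"
  unfolding op_diff_def diag_wop wop_def restrict_op_def wfun_def by (auto simp: fun_eq_iff algebra_simps)

lemma diag_scale: "op_scale c (diag \<phi>) = diag (\<lambda>x. c * \<phi> x)"
  unfolding op_scale_def diag_wop wop_def restrict_op_def wfun_def by (auto simp: fun_eq_iff algebra_simps)

lemma diag_eq_iff: "diag \<phi> = diag \<psi> \<longleftrightarrow> (\<forall>x\<in>topspace X. \<phi> x = \<psi> x)"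
proof
  assume "diag \<phi> = diag \<psi>"
  then show "\<forall>x\<in>topspace X. \<phi> x = \<psi> x"
    using diag_apply[OF e0_l2, of \<phi> "(_, 0, _)"] diag_apply[OF e0_l2, of \<psi> "(_, 0, _)"] unit_A
    by (metis e0_apply fst_conv mult.right_neutral)
next
  assume "\<forall>x\<in>topspace X. \<phi> x = \<psi> x"
  then show "diag \<phi> = diag \<psi>" unfolding diag_wop wop_def restrict_op_def wfun_def
    using arrow_topspace(1) by (auto simp: fun_eq_iff)
qed

subsection \<open>The gauge unitaries\<close>

definition bsum :: "('x \<Rightarrow> int) \<Rightarrow> nat \<Rightarrow> 'x \<Rightarrow> int" where
  "bsum F p x = (\<Sum>i<p. F ((s ^^ i) x))"

lemma bsum_add: "bsum F (p + d) x = bsum F p x + bsum F d ((s ^^ p) x)"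
proof (induction d)
  case (Suc d)
  have "(s ^^ (p + d)) x = (s ^^ d) ((s ^^ p) x)" by (metis add.commute comp_apply funpow_add)
  then show ?case using Suc by (simp add: bsum_def)
qed (simp add: bsum_def)

text \<open>Two representations of an arrow differ by a common increment of both exponents. As the
  orbits have met by then, both Birkhoff sums grow by the same amount, and the definite description
  has a unique value.\<close>

lemma cocycle_eq:
  assumes "(s ^^ p) x = (s ^^ q) z" "n = int p - int q"
  shows "cocycle s F (x, n, z) = bsum F p x - bsum F q z"
proof -
  have *: "bsum F a x - bsum F b z = bsum F (a + d) x - bsum F (b + d) z"
    if "(s ^^ a) x = (s ^^ b) z" for a b d using that by (simp add: bsum_add)
  have "bsum F a x - bsum F b z = bsum F p x - bsum F q z"
    if "n = int a - int b" "(s ^^ a) x = (s ^^ b) z" for a b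
  proof (cases "a \<le> p")
    case True
    then have "p = a + (p - a)" "q = b + (p - a)" using that(1) assms(2) by auto
    then show ?thesis using *[OF that(2), of "p - a"] by simp
  next
    case False
    then have "a = p + (a - p)" "b = q + (a - p)" using that(1) assms(2) by auto
    then show ?thesis using *[OF assms(1), of "a - p"] by simp
  qed
  moreover have "cocycle s F (x, n, z) = (THE k. \<exists>p q. n = int p - int q \<and> (s ^^ p) x = (s ^^ q) z \<and>
      k = bsum F p x - bsum F q z)" unfolding cocycle_def bsum_def by simp
  moreover have "(THE k. \<exists>p q. n = int p - int q \<and> (s ^^ p) x = (s ^^ q) z \<and>
      k = bsum F p x - bsum F q z) = bsum F p x - bsum F q z"
    by (rule the_equality) (use assms calculation(1) in blast)+
  ultimately show ?thesis by simp
qed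

lemma bsum_open:
  assumes "\<And>k. openin X {x \<in> topspace X. F x = k}"
  shows "openin X {x \<in> topspace X. bsum F p x = k}"
proof (induction p arbitrary: k)
  case 0 then show ?case by (cases "k = 0") (simp_all add: bsum_def)
next
  case (Suc p)
  have "{x \<in> topspace X. bsum F (Suc p) x = k} =
    (\<Union>j. {x \<in> {x \<in> topspace X. bsum F p x = j}. (s ^^ p) x \<in> {x \<in> topspace X. F x = k - j}})"
    using pow_topspace by (auto simp: bsum_def)
  also have "openin X ..." using openin_preimage[OF Suc assms] by blast
  finally show ?case .
qed

lemma cocycle_open:
  assumes "\<And>k. openin X {x \<in> topspace X. F x = k}"
  shows "openin G {\<gamma> \<in> A. cocycle s F \<gamma> = k}"
proof -
  let ?U = "\<lambda>p j. {x \<in> topspace X. bsum F p x = j}"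
  have "{\<gamma> \<in> A. cocycle s F \<gamma> = k} = (\<Union>p q j. basic_set X s (?U p j) p q (?U q (j - k)))"
  proof (intro equalityI subsetI)
    fix \<gamma> assume g: "\<gamma> \<in> {\<gamma> \<in> A. cocycle s F \<gamma> = k}"
    obtain x n z where xz: "\<gamma> = (x, n, z)" by (metis prod.collapse)
    then have "(x, n, z) \<in> A" using g by simp
    then obtain p q where pq: "x \<in> topspace X" "z \<in> topspace X" "n = int p - int q" "(s ^^ p) x = (s ^^ q) z" by (rule arrowsE)
    then have "k = bsum F p x - bsum F q z" using cocycle_eq[OF pq(4,3)] g xz by simp
    then have "\<gamma> \<in> basic_set X s (?U p (bsum F p x)) p q (?U q (bsum F p x - k))"
      using pq unfolding xz by (simp add: in_basic_set)
    then show "\<gamma> \<in> (\<Union>p q j. basic_set X s (?U p j) p q (?U q (j - k)))" by blast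
  next
    fix \<gamma> assume "\<gamma> \<in> (\<Union>p q j. basic_set X s (?U p j) p q (?U q (j - k)))"
    then obtain p q j where b: "\<gamma> \<in> basic_set X s (?U p j) p q (?U q (j - k))" by blast
    obtain x n z where xz: "\<gamma> = (x, n, z)" by (metis prod.collapse)
    have pq: "x \<in> topspace X" "z \<in> topspace X" "n = int p - int q" "(s ^^ p) x = (s ^^ q) z" "bsum F p x = j" "bsum F q z = j - k"
      using b unfolding xz by (auto simp: in_basic_set)
    then show "\<gamma> \<in> {\<gamma> \<in> A. cocycle s F \<gamma> = k}" using cocycle_eq[OF pq(4,3), of F] arrowsI[OF pq(1,2,4,3)] xz by simp
  qed
  also have "openin G ..." using basic_open[OF bsum_open[OF assms] bsum_open[OF assms]] by blast
  finally show ?thesis .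
qed

lemma gauge_wop:
  assumes "\<And>k. openin X {x \<in> topspace X. F x = k}"
  defines "c \<equiv> \<lambda>t \<gamma>. exp (2 * of_real pi * \<i> * of_int (cocycle s F \<gamma>) * of_real t)"
  shows "gauge_unitary X s F t = wop A id (c t)" "gauge_unitary X s F t \<in> operators X s"
    "op_star X s (gauge_unitary X s F t) = gauge_unitary X s F (- t)"
proof -
  have "continuous_map G euclidean (c t)" for t unfolding c_def
    by (rule continuous_map_locally_constant[where h = "cocycle s F"]) (simp add: cocycle_open[OF assms(1)])
  then have cc: "continuous_map (subtopology G A) euclidean (c t)" for t by (rule mult_cont)
  have n: "cmod (c t \<gamma>) \<le> 1" for t \<gamma>
  proof -
    have "c t \<gamma> = exp (\<i> * of_real (2 * pi * of_int (cocycle s F \<gamma>) * t))" unfolding c_def by (simp add: mult_ac)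
    then show ?thesis by (simp only: norm_exp_i_times)
  qed
  show w: "gauge_unitary X s F t = wop A id (c t)" for t
    unfolding gauge_unitary_def wop_def restrict_op_def wfun_def c_def using l2D(1) by (auto simp: fun_eq_iff)
  show o: "gauge_unitary X s F t \<in> operators X s" for t unfolding w by (rule wop_operator[OF pbij_id cc n])
  have "cnj (c t \<gamma>) = c (- t) \<gamma>" for \<gamma> unfolding c_def by (simp add: exp_cnj)
  then show "op_star X s (gauge_unitary X s F t) = gauge_unitary X s F (- t)"
    using op_star_eqI[OF o] wop_adjoint[OF pbij_id, of "c t"] unfolding w by simp
qed

subsection \<open>Partial isometries of injectivity sets\<close>

lemma jmap_cont: "continuous_map G G (jmap 1)"
proof (rule continuous_into_G)
  fix U p q V assume o: "openin X U" "openin X V"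
  have "{\<gamma> \<in> topspace G. jmap 1 \<gamma> \<in> basic_set X s U p q V} = basic_set X s {x \<in> topspace X. (s ^^ 1) x \<in> U} (Suc p) q V"
  proof (intro equalityI subsetI)
    fix \<gamma> assume g: "\<gamma> \<in> {\<gamma> \<in> topspace G. jmap 1 \<gamma> \<in> basic_set X s U p q V}"
    obtain x n z where xz: "\<gamma> = (x, n, z)" by (metis prod.collapse)
    show "\<gamma> \<in> basic_set X s {x \<in> topspace X. (s ^^ 1) x \<in> U} (Suc p) q V"
      using g arrow_topspace(1)[of \<gamma>] unfolding xz by (auto simp: jmap_def in_basic_set funpow_swap1)
  next
    fix \<gamma> assume g: "\<gamma> \<in> basic_set X s {x \<in> topspace X. (s ^^ 1) x \<in> U} (Suc p) q V"
    obtain x n z where xz: "\<gamma> = (x, n, z)" by (metis prod.collapse)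
    have b: "n = int (Suc p) - int q" "x \<in> topspace X" "(s ^^ 1) x \<in> U" "z \<in> V" "(s ^^ Suc p) x = (s ^^ q) z"
      using g unfolding xz in_basic_set by auto
    have "(x, n, z) \<in> A" using b openin_subset[OF o(2)] by (intro arrowsI[OF b(2) _ b(5,1)]) auto
    then show "\<gamma> \<in> {\<gamma> \<in> topspace G. jmap 1 \<gamma> \<in> basic_set X s U p q V}"
      using b unfolding xz by (auto simp: jmap_def in_basic_set funpow_swap1)
  qed
  then show "openin G {\<gamma> \<in> topspace G. jmap 1 \<gamma> \<in> basic_set X s U p q V}"
    using basic_open[OF openin_preimage[OF openin_topspace o(1)] o(2)] by metis
qed (use jmap_A in simp)

definition unjmap :: "'x set \<Rightarrow> 'x arrow \<Rightarrow> 'x arrow" where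
  "unjmap C \<gamma> = (inv_into C s (fst \<gamma>), fst (snd \<gamma>) + 1, snd (snd \<gamma>))"

context
  fixes C
  assumes oC: "openin X C" and cC: "closedin X C" and inj: "inj_on s C"
begin

abbreviation "DC \<equiv> {\<gamma> \<in> A. fst \<gamma> \<in> C}"

lemma C_sub: "C \<subseteq> topspace X"
  using oC openin_subset by blast

lemma unjmap_A: assumes "\<gamma> \<in> A" "fst \<gamma> \<in> s ` C" shows "unjmap C \<gamma> \<in> DC" "jmap 1 (unjmap C \<gamma>) = \<gamma>"
proof -
  obtain y n z where g: "\<gamma> = (y, n, z)" by (metis prod.collapse)
  have y: "y \<in> s ` C" using assms(2) g by simp
  let ?x = "inv_into C s y"
  have x: "?x \<in> C" "s ?x = y" using inv_into_into[OF y] f_inv_into_f[OF y] by blast+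
  have "(y, n, z) \<in> A" using assms g by simp
  then obtain p q where pq: "z \<in> topspace X" "n = int p - int q" "(s ^^ p) y = (s ^^ q) z" by (rule arrowsE)
  have "(s ^^ Suc p) ?x = (s ^^ q) z" using pq(3) x(2) by (simp only: funpow_Suc_right o_apply)
  then have "(?x, n + 1, z) \<in> A" using x(1) C_sub pq by (intro arrowsI[of _ _ "Suc p" q]) auto
  then show "unjmap C \<gamma> \<in> DC" "jmap 1 (unjmap C \<gamma>) = \<gamma>" using x unfolding g unjmap_def jmap_def by auto
qed

lemma jmap_image: "jmap 1 ` DC = {\<gamma> \<in> A. fst \<gamma> \<in> s ` C}"
proof (intro equalityI subsetI)
  fix \<gamma> assume "\<gamma> \<in> jmap 1 ` DC"
  then show "\<gamma> \<in> {\<gamma> \<in> A. fst \<gamma> \<in> s ` C}" using jmap_A[of _ 1] by (auto simp: jmap_def)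
next
  fix \<gamma> assume "\<gamma> \<in> {\<gamma> \<in> A. fst \<gamma> \<in> s ` C}"
  then show "\<gamma> \<in> jmap 1 ` DC" using unjmap_A[of \<gamma>] by (metis (no_types, lifting) imageI mem_Collect_eq)
qed

lemma range_preimage_closed: assumes "closedin X K" shows "closedin G {\<gamma> \<in> A. fst \<gamma> \<in> K}"
  using closedin_continuous_map_preimage[OF range_cont assms] by simp

lemma sC_closed: "closedin X (s ` C)"
  using compactin_imp_closedin[OF Hausdorff_X] image_compactin[OF closedin_compact_space[OF compact_X cC] cont_s] by blast

lemma sC_open: "openin X U \<Longrightarrow> openin X (s ` (U \<inter> C))"
  using openin_image[OF openin_Int[OF _ oC], of U 1] by simp

text \<open>Conditions on x in \<open>C\<close> are expressed by s x. For positive \<open>p\<close>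
  one factor of \<open>s ^^ p\<close> is absorbed in s x. For p = 0 there is none, and
  \<open>s\<close> is applied to both sides of x = s^q z instead; this loses nothing once
  \<open>V\<close> is restricted to points whose q-th image lies in \<open>C\<close>, where
  \<open>s\<close> is injective.\<close>

lemma unjmap_cont: "continuous_map (subtopology G (jmap 1 ` DC)) G (unjmap C)"
proof (rule continuous_into_G)
  let ?D' = "jmap 1 ` DC"
  have top: "topspace (subtopology G ?D') = ?D'" unfolding jmap_image by auto
  show "unjmap C \<gamma> \<in> A" if "\<gamma> \<in> topspace (subtopology G ?D')" for \<gamma>
  proof -
    have "\<gamma> \<in> A" "fst \<gamma> \<in> s ` C" using that unfolding top unfolding jmap_image by blast+
    then show ?thesis using unjmap_A(1) by blast
  qed
  fix U p q V assume o: "openin X U" "openin X V"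
  have inv: "inv_into C s (s x) = x" if "x \<in> C" for x using inj that by (rule inv_into_f_f)
  have "\<exists>B. openin G B \<and> {\<gamma> \<in> ?D'. unjmap C \<gamma> \<in> basic_set X s U p q V} = B \<inter> ?D'"
  proof (cases p)
    case (Suc p')
    have "(unjmap C \<gamma> \<in> basic_set X s U p q V) = (\<gamma> \<in> basic_set X s (s ` (U \<inter> C)) p' q V)" if g': "\<gamma> \<in> ?D'" for \<gamma>
    proof -
      obtain y n z where g: "\<gamma> = (y, n, z)" by (metis prod.collapse)
      obtain x where x: "x \<in> C" "y = s x" using g' unfolding jmap_image g by auto
      have "(y \<in> s ` (U \<inter> C)) = (x \<in> U)" using x inj by (auto simp: inj_on_def)
      moreover have "(s ^^ p) x = (s ^^ p') y" unfolding Suc x(2) by (simp only: funpow_Suc_right o_apply)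
      ultimately show ?thesis unfolding g unjmap_def x(2) using inv[OF x(1)] x(2) Suc by (auto simp: in_basic_set)
    qed
    then show ?thesis using basic_open[OF sC_open[OF o(1)] o(2), of p' q] by blast
  next
    case 0
    let ?V = "{z \<in> V. (s ^^ q) z \<in> C}"
    have "(unjmap C \<gamma> \<in> basic_set X s U p q V) = (\<gamma> \<in> basic_set X s (s ` (U \<inter> C)) 0 (Suc q) ?V)" if g': "\<gamma> \<in> ?D'" for \<gamma>
    proof -
      obtain y n z where g: "\<gamma> = (y, n, z)" by (metis prod.collapse)
      obtain x where x: "x \<in> C" "y = s x" using g' unfolding jmap_image g by auto
      have 1: "(y \<in> s ` (U \<inter> C)) = (x \<in> U)" using x inj by (auto simp: inj_on_def)
      have 2: "x = (s ^^ q) z \<longleftrightarrow> (s ^^ q) z \<in> C \<and> y = (s ^^ Suc q) z" using x inj by (auto simp: inj_on_def)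
      show ?thesis unfolding g unjmap_def x(2) using inv[OF x(1)] x(2) 0 1 2 by (auto simp: in_basic_set)
    qed
    then show ?thesis using basic_open[OF sC_open[OF o(1)] openin_preimage[OF o(2) oC], of 0 "Suc q" q] by blast
  qed
  then show "openin (subtopology G ?D') {\<gamma> \<in> topspace (subtopology G ?D'). unjmap C \<gamma> \<in> basic_set X s U p q V}"
    unfolding top openin_subtopology by blast
qed

lemma pbij_C: "pbij DC (jmap 1) (unjmap C)"
  unfolding pbij_def
proof (intro conjI ballI)
  show "openin G DC" using range_preimage_open[OF oC] .
  show "closedin G DC" using range_preimage_closed[OF cC] .
  show "openin G (jmap 1 ` DC)" unfolding jmap_image using range_preimage_open sC_open[OF openin_topspace] C_sub
    by (simp add: Int_absorb1)
  show "closedin G (jmap 1 ` DC)" unfolding jmap_image using range_preimage_closed[OF sC_closed] .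
  show "continuous_map (subtopology G DC) G (jmap 1)" using continuous_map_from_subtopology[OF jmap_cont] .
  show "continuous_map (subtopology G (jmap 1 ` DC)) G (unjmap C)" by (rule unjmap_cont)
  fix \<gamma> assume "\<gamma> \<in> DC"
  then show "unjmap C (jmap 1 \<gamma>) = \<gamma>" using inv_into_f_f[OF inj] unfolding unjmap_def jmap_def by (cases \<gamma>) auto
  show "snd (snd (jmap 1 \<gamma>)) = snd (snd \<gamma>)" unfolding jmap_def by simp
qed

context
  fixes \<phi> :: "'x \<Rightarrow> complex"
  assumes \<phi>: "\<phi> \<in> CX" and supp: "\<And>x. x \<in> topspace X \<Longrightarrow> x \<notin> C \<Longrightarrow> \<phi> x = 0"
begin

lemma isometry_wop: "conv_op X s (graph_fun 1 \<phi>) = wop DC (jmap 1) (\<lambda>\<gamma>. \<phi> (fst \<gamma>))"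
proof -
  have "wfun A (jmap 1) (\<lambda>\<gamma>. \<phi> (fst \<gamma>)) = wfun DC (jmap 1) (\<lambda>\<gamma>. \<phi> (fst \<gamma>))"
    unfolding wfun_def using supp arrow_topspace(1) by (auto simp: fun_eq_iff)
  then show ?thesis unfolding conv_graph wop_def by simp
qed

lemma isometry_adj:
  defines "R \<equiv> wop (jmap 1 ` DC) (unjmap C) (\<lambda>\<delta>. cnj (\<phi> (fst (unjmap C \<delta>))))"
  shows "conv_op X s (graph_fun 1 \<phi>) \<in> operators X s" "R \<in> operators X s" "is_adjoint X s (conv_op X s (graph_fun 1 \<phi>)) R"
proof -
  obtain M where "\<forall>x\<in>topspace X. cmod (\<phi> x) \<le> M" using continuous_bounded \<phi> by blast
  then have M: "\<And>\<gamma>. \<gamma> \<in> DC \<Longrightarrow> cmod (\<phi> (fst \<gamma>)) \<le> M" using arrow_topspace by blast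
  show "conv_op X s (graph_fun 1 \<phi>) \<in> operators X s" unfolding isometry_wop
    by (rule wop_operator[OF pbij_C range_fun_cont[OF \<phi>] M])
  show "R \<in> operators X s" unfolding R_def
    by (rule wop_adjoint_operator[OF pbij_C range_fun_cont[OF \<phi>] M])
  show "is_adjoint X s (conv_op X s (graph_fun 1 \<phi>)) R" unfolding R_def isometry_wop by (rule wop_adjoint[OF pbij_C])
qed

lemma isometry_reduced: "conv_op X s (graph_fun 1 \<phi>) \<in> reduced_cstar X s"
  by (rule reducedI[OF graph_fun_Cc[OF \<phi>]]) (use isometry_adj in \<open>auto simp: adjointables_def\<close>)

lemma isometry_apply:
  "\<xi> \<in> l2 X s \<Longrightarrow> \<gamma> \<in> A \<Longrightarrow> conv_op X s (graph_fun 1 \<phi>) \<xi> \<gamma> = \<phi> (fst \<gamma>) * \<xi> (jmap 1 \<gamma>)"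
  using supp arrow_topspace(1) unfolding isometry_wop by (auto simp: wop_apply wfun_def)

end

text \<open>Conjugating the multiplication by \<open>\<psi>\<close> with a generator gives the
  multiplication by \<open>\<psi> \<circ> s\<close>, cut down to \<open>C\<close>. Iteration turns
  the range projection of a word into the indicator of a cylinder.\<close>

lemma isometry_conjugate:
  assumes \<psi>: "\<psi> \<in> CX"
  shows "\<exists>R\<in>operators X s. is_adjoint X s (conv_op X s (graph_fun 1 (indicator C))) R \<and>
     conv_op X s (graph_fun 1 (indicator C)) \<circ> (diag \<psi> \<circ> R) = diag (\<lambda>x. indicator C x * \<psi> (s x))"
proof -
  let ?\<phi> = "indicator C :: 'x \<Rightarrow> complex"
  let ?T = "conv_op X s (graph_fun 1 ?\<phi>)"
  have ind: "?\<phi> \<in> CX" using continuous_map_indicator[OF oC cC] by simp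
  have ind0: "\<And>x. x \<in> topspace X \<Longrightarrow> x \<notin> C \<Longrightarrow> ?\<phi> x = 0" by simp
  note adj = isometry_adj[OF ind ind0]
  let ?R = "wop (jmap 1 ` DC) (unjmap C) (\<lambda>\<delta>. cnj (?\<phi> (fst (unjmap C \<delta>))))"
  have "(?T \<circ> (diag \<psi> \<circ> ?R)) \<xi> = diag (\<lambda>x. ?\<phi> x * \<psi> (s x)) \<xi>" for \<xi>
  proof (cases "\<xi> \<in> l2 X s")
    case True
    have l1: "?R \<xi> \<in> l2 X s" using operator_l2 adj(2) True by blast
    have l2: "diag \<psi> (?R \<xi>) \<in> l2 X s" using operator_l2 diag_adj(1)[OF \<psi>] l1 by blast
    have "?T (diag \<psi> (?R \<xi>)) \<gamma> = diag (\<lambda>x. ?\<phi> x * \<psi> (s x)) \<xi> \<gamma>" for \<gamma>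
    proof (cases "\<gamma> \<in> A")
      case False
      then show ?thesis using l2D(1)[OF operator_l2[OF adj(1) l2]] diag_apply[OF True] by simp
    next
      case g: True
      have "?T (diag \<psi> (?R \<xi>)) \<gamma> = ?\<phi> (fst \<gamma>) * (\<psi> (s (fst \<gamma>)) * ?R \<xi> (jmap 1 \<gamma>))"
        using isometry_apply[OF ind ind0 l2 g] diag_apply[OF l1] jmap_A[OF g, of 1]
        by (simp add: jmap_def)
      also have "... = ?\<phi> (fst \<gamma>) * \<psi> (s (fst \<gamma>)) * \<xi> \<gamma>"
      proof (cases "fst \<gamma> \<in> C")
        case True
        then have "\<gamma> \<in> DC" using g by blast
        then have "?R \<xi> (jmap 1 \<gamma>) = \<xi> \<gamma>"
          using pbijD(4)[OF pbij_C] \<open>\<xi> \<in> l2 X s\<close> True by (simp add: wop_apply wfun_def)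
        then show ?thesis by simp
      qed simp
      finally show ?thesis using diag_apply[OF True] g by simp
    qed
    then show ?thesis by auto
  next
    case False
    have z: "(\<lambda>_. 0) \<in> l2 X s" using l2_diff[OF e0_l2 e0_l2] by simp
    have "?R \<xi> = (\<lambda>_. 0)" "diag (\<lambda>x. ?\<phi> x * \<psi> (s x)) \<xi> = (\<lambda>_. 0)"
      using False unfolding diag_wop wop_def restrict_op_def by auto
    moreover have "diag \<psi> (\<lambda>_. 0) = (\<lambda>_. 0)" using diag_apply[OF z] by auto
    moreover have "?T (\<lambda>_. 0) = (\<lambda>_. 0)"
      unfolding conv_graph restrict_op_def wfun_def by auto
    ultimately show ?thesis unfolding o_apply by (simp only:)
  qed
  then show ?thesis using adj by blast
qed

end

lemma adjoint_comp:
  assumes "S \<in> operators X s" "S' \<in> operators X s" "T \<in> operators X s" "T' \<in> operators X s"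
    "is_adjoint X s S T" "is_adjoint X s S' T'"
  shows "is_adjoint X s (S \<circ> S') (T' \<circ> T)"
  using assms unfolding is_adjoint_def by (simp add: operator_l2)

text \<open>Operators are extended by zero outside the module; there \<open>T\<close> yields the
  zero vector, which \<open>S\<close> has to preserve.\<close>

lemma operator_comp:
  assumes "S \<in> operators X s" "T \<in> operators X s" "S (\<lambda>_. 0) = (\<lambda>_. 0)" shows "S \<circ> T \<in> operators X s"
  using assms unfolding operators_def by auto

end

section \<open>The path space of the minimal \<open>\<lambda>\<close>-graph system\<close>

definition locally_constant :: "'a topology \<Rightarrow> ('a \<Rightarrow> 'b) \<Rightarrow> bool" where
  "locally_constant Z h \<longleftrightarrow> (\<forall>k. openin Z {z \<in> topspace Z. h z = k})"

lemma locally_constant_comp: assumes "locally_constant Z h" shows "locally_constant Z (\<lambda>z. \<phi> (h z))"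
proof -
  have "openin Z {z \<in> topspace Z. \<phi> (h z) = k}" for k
  proof -
    have "{z \<in> topspace Z. \<phi> (h z) = k} = (\<Union>j\<in>{j. \<phi> j = k}. {z \<in> topspace Z. h z = j})" by blast
    also have "openin Z ..." using assms unfolding locally_constant_def by blast
    finally show ?thesis .
  qed
  then show ?thesis unfolding locally_constant_def by blast
qed

lemma locally_constant_cong:
  assumes "locally_constant Z g" "\<And>z. z \<in> topspace Z \<Longrightarrow> f z = g z" shows "locally_constant Z f"
proof -
  have "{z \<in> topspace Z. f z = k} = {z \<in> topspace Z. g z = k}" for k using assms(2) by auto
  then show ?thesis using assms(1) unfolding locally_constant_def by simp
qed

lemma locally_constant_pair:
  assumes "locally_constant Z h" "locally_constant Z g" shows "locally_constant Z (\<lambda>z. (h z, g z))"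
proof -
  have "{z \<in> topspace Z. (h z, g z) = k} = {z \<in> topspace Z. h z = fst k} \<inter> {z \<in> topspace Z. g z = snd k}" for k by auto
  then show ?thesis using assms unfolding locally_constant_def by (simp add: openin_Int)
qed

lemma locally_constant_list:
  assumes "\<And>i. i < n \<Longrightarrow> locally_constant Z (\<lambda>z. h z i)" shows "locally_constant Z (\<lambda>z. pre n (h z))"
  using assms
proof (induction n)
  case 0
  have "openin Z {z \<in> topspace Z. [] = k}" for k :: "'b list" by (cases "[] = k") auto
  then show ?case unfolding locally_constant_def by simp
next
  case (Suc n)
  then have "locally_constant Z (\<lambda>z. (pre n (h z), h z n))" by (intro locally_constant_pair) auto
  then show ?case using locally_constant_comp[of Z "\<lambda>z. (pre n (h z), h z n)" "\<lambda>(u, a). u @ [a]"]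
    by (simp add: pre_def)
qed

lemma locally_constant_open: "locally_constant Z h \<Longrightarrow> openin Z {z \<in> topspace Z. P (h z)}"
proof -
  assume "locally_constant Z h"
  then have "locally_constant Z (\<lambda>z. P (h z))" by (rule locally_constant_comp)
  then have "openin Z {z \<in> topspace Z. P (h z) = True}" unfolding locally_constant_def by blast
  then show ?thesis by simp
qed

lemma locally_constant_closed: assumes "locally_constant Z h" shows "closedin Z {z \<in> topspace Z. P (h z)}"
proof -
  have "topspace Z - {z \<in> topspace Z. P (h z)} = {z \<in> topspace Z. \<not> P (h z)}" by blast
  then show ?thesis unfolding closedin_def using locally_constant_open[OF assms, of "\<lambda>k. \<not> P k"] by auto
qed

lemma locally_constant_discrete:
  assumes "locally_constant Z h" "\<And>z. z \<in> topspace Z \<Longrightarrow> h z \<in> S" shows "continuous_map Z (discrete_topology S) h"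
  unfolding continuous_map_def using assms(2) locally_constant_open[OF assms(1)] by auto

lemma continuous_discrete_locally_constant:
  assumes "continuous_map Z (discrete_topology S) h" shows "locally_constant Z h"
  unfolding locally_constant_def
proof
  fix k
  have "{z \<in> topspace Z. h z = k} = {z \<in> topspace Z. h z \<in> {k} \<inter> S}"
    using assms unfolding continuous_map_def by auto
  also have "openin Z ..." using assms unfolding continuous_map_def by (simp only: openin_discrete_topology) blast
  finally show "openin Z {z \<in> topspace Z. h z = k}" .
qed

section \<open>Compactness of the path space; its shift as a local homeomorphism\<close>

context sshift
begin

abbreviation "Y \<equiv> X_top L"

lemma Omega_topspace: "topspace (Omega_top L) = Omega L"
  unfolding Omega_top_def by (auto simp: Omega_def)

lemma X_set_E:
  assumes "x \<in> X_set L"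
  shows "snd (x i) \<in> Omega L" "snd (x i) l \<in> vertices L l" "iota L l (snd (x i) (Suc l)) = snd (x i) l"
    "(snd (x i) l, fst (x (Suc i)), snd (x (Suc i)) (Suc l)) \<in> edges L l"
  using assms unfolding X_set_def E_graph_def Omega_def by (auto simp: prod.case_eq_if)

lemma topspace_Y [simp]: "topspace Y = X_set L"
proof -
  have "X_set L \<subseteq> topspace (product_topology (\<lambda>_. prod_topology (discrete_topology UNIV) (Omega_top L)) UNIV)"
    using X_set_E(1) by (fastforce simp: Omega_topspace mem_Times_iff)
  then show ?thesis unfolding X_top_def by (simp add: Int_absorb1)
qed

lemma continuous_into_Y:
  assumes "\<And>z. z \<in> topspace Z \<Longrightarrow> f z \<in> X_set L" "\<And>i. locally_constant Z (\<lambda>z. fst (f z i))"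
    "\<And>i l. locally_constant Z (\<lambda>z. snd (f z i) l)"
  shows "continuous_map Z Y f"
  unfolding X_top_def
proof (rule continuous_map_into_subtopology)
  show "continuous_map Z (product_topology (\<lambda>_. prod_topology (discrete_topology UNIV) (Omega_top L)) UNIV) f"
    unfolding continuous_map_componentwise_UNIV continuous_map_pairwise o_def
  proof (intro allI conjI)
    fix i
    show "continuous_map Z (discrete_topology UNIV) (\<lambda>z. fst (f z i))"
      using assms(2) by (rule locally_constant_discrete) simp
    show "continuous_map Z (Omega_top L) (\<lambda>z. snd (f z i))" unfolding Omega_top_def
    proof (rule continuous_map_into_subtopology)
      show "continuous_map Z (product_topology (\<lambda>l. discrete_topology (vertices L l)) UNIV) (\<lambda>z. snd (f z i))"
        unfolding continuous_map_componentwise_UNIV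
        using assms(3) X_set_E(2)[OF assms(1)] by (auto intro: locally_constant_discrete)
    qed (use X_set_E(1)[OF assms(1)] in auto)
  qed
qed (use assms(1) in auto)

lemma coordinate_cont:
  "continuous_map Y (prod_topology (discrete_topology UNIV) (Omega_top L)) (\<lambda>x. x i)"
  unfolding X_top_def by (rule continuous_map_from_subtopology) (rule continuous_map_product_projection, simp)

lemma label_locally_constant: "locally_constant Y (\<lambda>x. fst (x i))"
  using continuous_map_compose[OF coordinate_cont continuous_map_fst]
  by (intro continuous_discrete_locally_constant[of _ UNIV]) (simp add: o_def)

lemma vertex_locally_constant: "locally_constant Y (\<lambda>x. snd (x i) l)"
proof -
  have "continuous_map (Omega_top L) (discrete_topology (vertices L l)) (\<lambda>v. v l)"
    unfolding Omega_top_def by (rule continuous_map_from_subtopology) (rule continuous_map_product_projection, simp)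
  then show ?thesis
    using continuous_map_compose[OF continuous_map_compose[OF coordinate_cont continuous_map_snd]]
    by (intro continuous_discrete_locally_constant[of _ "vertices L l"]) (simp add: o_def)
qed

lemma edge_label: "(c, a, d) \<in> edges L l \<Longrightarrow> a \<in> {1..N}"
  unfolding edges_eq using X_range by blast

text \<open>Membership in \<Omega> and the existence of a vertex before the first letter involve all
  levels at once. Here they are resolved into conditions on finitely many coordinates each, the
  second one by \<open>predecessor_iff\<close>.\<close>

lemma X_set_conditions:
  "x \<in> X_set L \<longleftrightarrow> (\<forall>i l. snd (x i) l \<in> vertices L l \<and> iota L l (snd (x i) (Suc l)) = snd (x i) l \<and>
     (snd (x i) l, fst (x (Suc i)), snd (x (Suc i)) (Suc l)) \<in> edges L l) \<and>
     (\<exists>c. (c, fst (x 0), snd (x 0) 1) \<in> edges L 0)" (is "_ \<longleftrightarrow> ?R")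
proof
  assume x: "x \<in> X_set L"
  then have "\<exists>u. (u, fst (x 0), snd (x 0)) \<in> E_graph L" unfolding X_set_def by blast
  then show ?R using predecessor_iff[OF X_set_E(1)[OF x]] X_set_E(2-4)[OF x] by blast
next
  assume R: ?R
  then have O: "snd (x i) \<in> Omega L" for i unfolding Omega_def by blast
  then have "(snd (x i), fst (x (Suc i)), snd (x (Suc i))) \<in> E_graph L" for i
    using R unfolding E_graph_def by blast
  then show "x \<in> X_set L" using R predecessor_iff[OF O] unfolding X_set_def by blast
qed

lemma X_set_label: assumes "x \<in> X_set L" shows "fst (x i) \<in> {1..N}"
proof (cases i)
  case 0 then show ?thesis using assms edge_label unfolding X_set_conditions by blast
next
  case (Suc j) then show ?thesis using assms edge_label X_set_E(4) by blast
qed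

text \<open>\<open>X_top\<close> puts the discrete topology on all natural numbers as labels and has
  \<Omega> as a factor. So compactness is obtained in a product \<open>Q\<close> of finite discrete
  spaces, where \<open>X_set\<close> is closed by \<open>X_set_conditions\<close>, and carried over
  by the identity map.\<close>

lemma compact_Y: "compact_space Y"
proof -
  define Q :: "lpath topology" where "Q = product_topology (\<lambda>_. prod_topology (discrete_topology {1..N})
     (product_topology (\<lambda>l. discrete_topology (vertices L l)) UNIV)) UNIV"
  have cQ: "compact_space Q" unfolding Q_def
    by (simp add: compact_space_product_topology compact_space_prod_topology compact_space_discrete_topology finite_vertices)
  have Q: "continuous_map Q (prod_topology (discrete_topology {1..N})
     (product_topology (\<lambda>l. discrete_topology (vertices L l)) UNIV)) (\<lambda>x. x i)" for i
    unfolding Q_def by (rule continuous_map_product_projection) simp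
  have l1: "locally_constant Q (\<lambda>x. fst (x i))" for i
    using continuous_map_compose[OF Q continuous_map_fst]
    by (intro continuous_discrete_locally_constant[of _ "{1..N}"]) (simp add: o_def)
  have l2: "locally_constant Q (\<lambda>x. snd (x i) l)" for i l
  proof -
    have "continuous_map (product_topology (\<lambda>l. discrete_topology (vertices L l)) UNIV) (discrete_topology (vertices L l)) (\<lambda>v. v l)"
      by (rule continuous_map_product_projection) simp
    then show ?thesis using continuous_map_compose[OF continuous_map_compose[OF Q continuous_map_snd]]
      by (intro continuous_discrete_locally_constant[of _ "vertices L l"]) (simp add: o_def)
  qed
  define C1 where "C1 i l = {x \<in> topspace Q. case (snd (x i) l, snd (x i) (Suc l), fst (x (Suc i)), snd (x (Suc i)) (Suc l)) of
     (u, v, a, w) \<Rightarrow> u \<in> vertices L l \<and> iota L l v = u \<and> (u, a, w) \<in> edges L l}" for i l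
  define C2 where "C2 = {x \<in> topspace Q. case (fst (x 0), snd (x 0) 1) of (a, w) \<Rightarrow> \<exists>c. (c, a, w) \<in> edges L 0}"
  have "closedin Q (C1 i l)" for i l unfolding C1_def
    by (rule locally_constant_closed) (intro locally_constant_pair l1 l2)
  moreover have "closedin Q C2" unfolding C2_def
    by (rule locally_constant_closed) (intro locally_constant_pair l1 l2)
  ultimately have "closedin Q (C2 \<inter> (\<Inter>i. \<Inter>l. C1 i l))" by (intro closedin_Int closedin_INT) auto
  moreover have "x \<in> topspace Q" if "x \<in> X_set L" for x
    unfolding Q_def topspace_product_topology topspace_prod_topology topspace_discrete_topology PiE_UNIV_domain Pi_iff
    using X_set_label[OF that] X_set_E(2)[OF that] by (auto simp: mem_Times_iff)
  then have "X_set L = C2 \<inter> (\<Inter>i. \<Inter>l. C1 i l)"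
    unfolding C1_def C2_def using X_set_conditions by auto
  ultimately have "closedin Q (X_set L)" by simp
  then have "compactin Q (X_set L)" using cQ closedin_compact_space by blast
  then have c: "compactin (subtopology Q (X_set L)) (X_set L)" by (simp add: compactin_subtopology)
  have "continuous_map (subtopology Q (X_set L)) Y (\<lambda>x. x)"
  proof (rule continuous_into_Y)
    have *: "locally_constant (subtopology Q S) h" if "locally_constant Q h" for h :: "lpath \<Rightarrow> 'c" and S
    proof -
      have "{z \<in> topspace (subtopology Q S). h z = k} = {z \<in> topspace Q. h z = k} \<inter> S" for k by auto
      moreover have "openin (subtopology Q S) ({z \<in> topspace Q. h z = k} \<inter> S)" for k
        using that unfolding locally_constant_def by (intro openin_subtopology_Int) blast
      ultimately show ?thesis unfolding locally_constant_def by simp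
    qed
    show "locally_constant (subtopology Q (X_set L)) (\<lambda>z. fst (z i))" for i using *[OF l1] .
    show "locally_constant (subtopology Q (X_set L)) (\<lambda>z. snd (z i) l)" for i l using *[OF l2] .
  qed auto
  from image_compactin[OF c this] show ?thesis by (simp add: compact_space_def)
qed

lemma Hausdorff_Y: "Hausdorff_space Y"
  unfolding X_top_def Omega_top_def
  by (intro Hausdorff_space_subtopology)
     (auto simp: Hausdorff_space_product_topology Hausdorff_space_prod_topology Hausdorff_space_discrete_topology
        intro!: disjI2 Hausdorff_space_subtopology)

lemma shift_X_set: "x \<in> X_set L \<Longrightarrow> shift x \<in> X_set L"
  unfolding X_set_def shift_def by auto

lemma shift_cont: "continuous_map Y Y shift"
proof (rule continuous_into_Y)
  show "locally_constant Y (\<lambda>z. fst (shift z i))" "locally_constant Y (\<lambda>z. snd (shift z i) l)" for i l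
    unfolding shift_def using label_locally_constant vertex_locally_constant by blast+
qed (simp add: shift_X_set)

definition letter_set :: "nat \<Rightarrow> lpath set" where
  "letter_set \<alpha> = {x \<in> X_set L. fst (x 0) = \<alpha>}"

lemma letter_clopen: "openin Y (letter_set \<alpha>)" "closedin Y (letter_set \<alpha>)"
  using locally_constant_open[OF label_locally_constant, of "\<lambda>k. k = \<alpha>" 0]
    locally_constant_closed[OF label_locally_constant, of "\<lambda>k. k = \<alpha>" 0] by (simp_all add: letter_set_def)

text \<open>The first vertex is recovered from the next letter and vertex because the system is
  left-resolving.\<close>

lemma letter_inj: "inj_on shift (letter_set \<alpha>)"
proof (rule inj_onI)
  fix x y assume xy: "x \<in> letter_set \<alpha>" "y \<in> letter_set \<alpha>" "shift x = shift y"
  then have X: "x \<in> X_set L" "y \<in> X_set L" and f: "fst (x 0) = fst (y 0)" unfolding letter_set_def by auto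
  have S: "x (Suc i) = y (Suc i)" for i using fun_cong[OF xy(3)] unfolding shift_def .
  have "(snd (x 0), fst (x (Suc 0)), snd (x (Suc 0))) \<in> E_graph L" "(snd (y 0), fst (y (Suc 0)), snd (y (Suc 0))) \<in> E_graph L"
    using X unfolding X_set_def by blast+
  then have "snd (x 0) = snd (y 0)" using left_resolving unfolding S by blast
  then have "x i = y i" for i using f S by (cases i) (auto simp: prod_eq_iff)
  then show "x = y" by blast
qed

text \<open>By left-resolution the first letter of \<open>z\<close> and its level-2 vertex determine
  the level-1 part of the vertex before \<open>z\<close>, and by \<open>predecessor_iff\<close> this
  part decides whether \<alpha> can precede it. So finitely many coordinates of \<open>z\<close>
  describe the image.\<close>

lemma letter_image:
  "shift ` letter_set \<alpha> = {z \<in> X_set L. \<exists>c e. (c, \<alpha>, e) \<in> edges L 0 \<and> (e, fst (z 0), snd (z 0) 2) \<in> edges L 1}"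
proof (intro equalityI subsetI)
  fix z assume "z \<in> shift ` letter_set \<alpha>"
  then obtain x where x: "x \<in> X_set L" "fst (x 0) = \<alpha>" "z = shift x" unfolding letter_set_def by blast
  obtain c where "(c, \<alpha>, snd (x 0) 1) \<in> edges L 0" using x unfolding X_set_conditions by blast
  moreover have "(snd (x 0) 1, fst (z 0), snd (z 0) 2) \<in> edges L 1"
    using X_set_E(4)[OF x(1), of 0 1] unfolding x(3) shift_def by (simp add: numeral_2_eq_2)
  ultimately show "z \<in> {z \<in> X_set L. \<exists>c e. (c, \<alpha>, e) \<in> edges L 0 \<and> (e, fst (z 0), snd (z 0) 2) \<in> edges L 1}"
    using shift_X_set[OF x(1)] x(3) by blast
next
  fix z assume "z \<in> {z \<in> X_set L. \<exists>c e. (c, \<alpha>, e) \<in> edges L 0 \<and> (e, fst (z 0), snd (z 0) 2) \<in> edges L 1}"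
  then obtain c e where z: "z \<in> X_set L" "(c, \<alpha>, e) \<in> edges L 0" "(e, fst (z 0), snd (z 0) 2) \<in> edges L 1" by blast
  obtain v where v: "(v, fst (z 0), snd (z 0)) \<in> E_graph L" using z(1) unfolding X_set_def by blast
  have "v \<in> Omega L" using v unfolding E_graph_def by blast
  have "snd (z 0) (Suc 1) \<in> vertices L (Suc 1)" using X_set_E(2)[OF z(1)] by blast
  then obtain y where y: "psync (Suc 1) y" "cls (Suc 1) y = snd (z 0) (Suc 1)" unfolding vertices_eq by auto
  have "(v 1, fst (z 0), cls (Suc 1) y) \<in> edges L 1" using v unfolding y(2) E_graph_def by blast
  moreover have "(e, fst (z 0), cls (Suc 1) y) \<in> edges L 1" using z(3) unfolding y(2) by (simp add: numeral_2_eq_2)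
  ultimately have "v 1 = e" using edge_prepend(3)[OF y(1)] by metis
  then obtain u where u: "(u, \<alpha>, v) \<in> E_graph L" using predecessor_iff[OF \<open>v \<in> Omega L\<close>] z(2) by blast
  define x where "x i = (case i of 0 \<Rightarrow> (\<alpha>, v) | Suc j \<Rightarrow> z j)" for i
  have "(snd (x i), fst (x (Suc i)), snd (x (Suc i))) \<in> E_graph L" for i
    using v z(1) unfolding x_def X_set_def by (cases i) auto
  then have "x \<in> X_set L" unfolding X_set_def using u by (auto simp: x_def)
  moreover have "shift x = z" unfolding shift_def x_def by simp
  ultimately show "z \<in> shift ` letter_set \<alpha>" unfolding letter_set_def x_def by force
qed

lemma letter_image_open: "openin Y (shift ` letter_set \<alpha>)"
proof -
  have "locally_constant Y (\<lambda>z. (fst (z 0), snd (z 0) 2))"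
    by (intro locally_constant_pair label_locally_constant vertex_locally_constant)
  from locally_constant_open[OF this, of "\<lambda>(a, w). \<exists>c e. (c, \<alpha>, e) \<in> edges L 0 \<and> (e, a, w) \<in> edges L 1"]
  show ?thesis unfolding letter_image by simp
qed

text \<open>On one letter set the shift is injective with open image, so the image of an open part
  is that image minus the compact image of the remaining part.\<close>

lemma shift_open: "open_map Y Y shift"
  unfolding open_map_def
proof (intro allI impI)
  fix U assume U: "openin Y U"
  have "openin Y (shift ` (U \<inter> letter_set \<alpha>))" for \<alpha>
  proof -
    have "compactin Y (letter_set \<alpha> - U)"
      using closedin_compact_space[OF compact_Y closedin_diff[OF letter_clopen(2) U]] .
    then have "closedin Y (shift ` (letter_set \<alpha> - U))"
      using compactin_imp_closedin[OF Hausdorff_Y] image_compactin shift_cont by blast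
    moreover have "shift ` (U \<inter> letter_set \<alpha>) = shift ` letter_set \<alpha> - shift ` (letter_set \<alpha> - U)"
      using letter_inj[of \<alpha>] unfolding inj_on_def by blast
    ultimately show ?thesis using letter_image_open openin_diff by metis
  qed
  moreover have "U = (\<Union>\<alpha>. U \<inter> letter_set \<alpha>)" using openin_subset[OF U] unfolding letter_set_def by auto
  then have "shift ` U = (\<Union>\<alpha>. shift ` (U \<inter> letter_set \<alpha>))" by blast
  ultimately show "openin Y (shift ` U)" by (metis (no_types, lifting) imageE openin_Union)
qed

sublocale dr_system Y shift
proof
  show "compact_space Y" by (rule compact_Y)
  show "Hausdorff_space Y" by (rule Hausdorff_Y)
  show "continuous_map Y Y shift" by (rule shift_cont)
  show "open_map Y Y shift" by (rule shift_open)
  fix x assume "x \<in> topspace Y"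
  then have "x \<in> letter_set (fst (x 0))" unfolding letter_set_def by simp
  then show "\<exists>U. openin Y U \<and> x \<in> U \<and> inj_on shift U" using letter_clopen letter_inj by blast
qed

lemma labels_cont: "continuous_map Y (top_of_set X) labels"
proof (rule continuous_map_into_subtopology)
  have "continuous_map Y (euclidean :: nat topology) (\<lambda>x. fst (x i))" for i
    using continuous_map_locally_constant[of Y "\<lambda>x. fst (x i)" id] label_locally_constant[of i]
    unfolding locally_constant_def by simp
  then show "continuous_map Y euclidean labels"
    unfolding euclidean_product_topology[symmetric] continuous_map_componentwise_UNIV labels_def by simp
qed (use labels_X in simp)

lemma labels_shift: "labels (shift x) = shift (labels x)"
  unfolding labels_def shift_def by simp

end

section \<open>The path space over the one-sided subshift\<close>

context normal_sshift
begin

text \<open>The image is compact, hence closed, and by \<open>X_set_dense\<close> it meets every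
  cylinder.\<close>

lemma labels_surj: "labels ` X_set L = X"
proof (intro equalityI subsetI)
  fix x assume x: "x \<in> X"
  have "continuous_map Y euclidean labels" using labels_cont by (simp add: continuous_map_in_subtopology)
  then have "compactin euclidean (labels ` X_set L)" using image_compactin compact_Y unfolding compact_space_def by fastforce
  then have "closedin euclidean (labels ` X_set L)"
    using compactin_imp_closedin Hausdorff_sequences by blast
  then have "closed (labels ` X_set L)" by simp
  then have "open (- labels ` X_set L)" by (rule open_Compl)
  show "x \<in> labels ` X_set L"
  proof (rule ccontr)
    assume "x \<notin> labels ` X_set L"
    then obtain k where k: "\<And>y. pre k y = pre k x \<Longrightarrow> y \<in> - labels ` X_set L"
      using cylinder_nbhd[OF \<open>open (- labels ` X_set L)\<close>] by blast
    show False using X_set_dense[OF pre_all_words[OF x, of k]] k by auto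
  qed
qed (use labels_X in blast)

subsection \<open>The diagonal algebra\<close>

lemma X_nonempty: "X \<noteq> {}"
proof -
  have "L \<noteq> {}" using normal unfolding normal_subshift_def by auto
  then show ?thesis unfolding one_sided_def by blast
qed

lemma comp_labels_CX:
  assumes "continuous_on X g" shows "(\<lambda>x. g (labels x)) \<in> CX"
proof -
  have "continuous_map (top_of_set X) euclidean g" using assms by simp
  from continuous_map_compose[OF labels_cont this] show ?thesis by (simp add: o_def)
qed

lemma diag_elem_eq: "diag_elem L g = diag (\<lambda>x. g (labels x))"
proof -
  have "(\<lambda>(x, n, z). if x \<in> X_set L \<and> n = 0 \<and> z = x then g (labels x) else 0) = graph_fun 0 (\<lambda>x. g (labels x))"
    unfolding graph_fun_def graph_def by (rule ext) (auto simp: image_iff)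
  then show ?thesis unfolding diag_elem_def diag_def by simp
qed

lemma diag_elem_eq_iff: "diag_elem L g = diag_elem L g' \<longleftrightarrow> (\<forall>x\<in>X. g x = g' x)"
  unfolding diag_elem_eq diag_eq_iff topspace_Y labels_surj[symmetric] by blast

lemma S_letter_eq: "S_letter L \<alpha> = conv_op Y shift (graph_fun 1 (indicator (letter_set \<alpha>)))"
proof -
  have "(indicator {(x, 1, shift x) | x. x \<in> X_set L \<and> fst (x 0) = \<alpha>} :: lpath vec) = graph_fun 1 (indicator (letter_set \<alpha>))"
    unfolding graph_fun_def graph_def letter_set_def by (rule ext) (auto simp: image_iff indicator_def)
  then show ?thesis unfolding S_letter_def by simp
qed

lemma indicator_CX: "openin Y C \<Longrightarrow> closedin Y C \<Longrightarrow> indicator C \<in> CX"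
  using continuous_map_indicator by blast

lemma S_letter_reduced: "S_letter L \<alpha> \<in> reduced_cstar Y shift"
  unfolding S_letter_eq
  by (rule isometry_reduced[where C = "letter_set \<alpha>", OF letter_clopen letter_inj indicator_CX[OF letter_clopen]]) simp

definition cyl :: "nat list \<Rightarrow> (nat \<Rightarrow> nat) \<Rightarrow> complex" where
  "cyl \<mu> x = (if pre (length \<mu>) x = \<mu> then 1 else 0)"

lemma cyl_cont: "continuous_on S (cyl \<mu>)"
proof -
  have "continuous_map euclidean euclidean (cyl \<mu>)"
    unfolding cyl_def[abs_def]
    by (rule continuous_map_locally_constant[where h = "pre (length \<mu>)" and \<phi> = "\<lambda>w. if w = \<mu> then 1 else 0"])
       (simp add: open_cylinder flip: open_openin)
  then show ?thesis using continuous_on_subset by auto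
qed

lemma zero_l2: "(\<lambda>_. 0) \<in> l2 Y shift"
  using l2_diff[OF e0_l2 e0_l2] by simp

lemma diag_elem_zero: "diag_elem L g (\<lambda>_. 0) = (\<lambda>_. 0)"
  unfolding diag_elem_eq using diag_apply[OF zero_l2] by auto

lemma S_letter_zero: "S_letter L \<alpha> (\<lambda>_. 0) = (\<lambda>_. 0)"
  unfolding S_letter_eq conv_graph restrict_op_def wfun_def by auto

lemma S_letter_apply:
  "\<xi> \<in> l2 Y shift \<Longrightarrow> \<gamma> \<in> A \<Longrightarrow> S_letter L \<alpha> \<xi> \<gamma> = indicator (letter_set \<alpha>) (fst \<gamma>) * \<xi> (jmap 1 \<gamma>)"
  unfolding S_letter_eq
  by (rule isometry_apply[where C = "letter_set \<alpha>", OF letter_clopen letter_inj indicator_CX[OF letter_clopen]]) auto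

text \<open>An explicit adjoint \<open>R\<close> is carried through the induction, since
  \<open>op_star\<close> of a composite can be evaluated only once an adjoint has been exhibited.
  The step is \<open>isometry_conjugate\<close> applied to a cylinder function.\<close>

lemma S_word_star:
  "\<exists>R\<in>operators Y shift. S_word L \<mu> \<in> operators Y shift \<and> is_adjoint Y shift (S_word L \<mu>) R \<and>
    S_word L \<mu> \<circ> R = diag_elem L (cyl \<mu>) \<and> S_word L \<mu> (\<lambda>_. 0) = (\<lambda>_. 0)"
proof (induction \<mu>)
  case Nil
  have "S_word L [] = diag (\<lambda>_. 1)"
    unfolding S_word_def diag_wop wop_def restrict_op_def wfun_def using l2D(1) by (auto simp: fun_eq_iff)
  note S = this
  have c: "cyl [] = (\<lambda>_. 1)" unfolding cyl_def by auto
  have "diag (\<lambda>_. 1) \<in> operators Y shift" "is_adjoint Y shift (diag (\<lambda>_. 1)) (diag (\<lambda>_. 1))"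
    using diag_adj[of "\<lambda>_. 1"] by simp_all
  moreover have "diag (\<lambda>_. 1) \<circ> diag (\<lambda>_. 1) = diag (\<lambda>_. 1)" using diag_mult[of "\<lambda>_. 1" "\<lambda>_. 1"] by simp
  moreover have "diag (\<lambda>_. 1) (\<lambda>_. 0) = (\<lambda>_. 0)" using diag_apply[OF zero_l2, of "\<lambda>_. 1"] by auto
  ultimately show ?case unfolding diag_elem_eq S c by (intro bexI[of _ "diag (\<lambda>_. 1)"] conjI)
next
  case (Cons \<alpha> \<mu>)
  then obtain R where R: "R \<in> operators Y shift" "S_word L \<mu> \<in> operators Y shift" "is_adjoint Y shift (S_word L \<mu>) R"
    "S_word L \<mu> \<circ> R = diag_elem L (cyl \<mu>)" "S_word L \<mu> (\<lambda>_. 0) = (\<lambda>_. 0)" by blast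
  have SW: "S_word L (\<alpha> # \<mu>) = S_letter L \<alpha> \<circ> S_word L \<mu>" unfolding S_word_def by simp
  have cc: "(\<lambda>x. cyl \<mu> (labels x)) \<in> CX" by (rule comp_labels_CX[OF cyl_cont])
  obtain T where T: "T \<in> operators Y shift" "is_adjoint Y shift (S_letter L \<alpha>) T"
    "S_letter L \<alpha> \<circ> (diag (\<lambda>x. cyl \<mu> (labels x)) \<circ> T) = diag (\<lambda>x. indicator (letter_set \<alpha>) x * cyl \<mu> (labels (shift x)))"
    using isometry_conjugate[OF letter_clopen letter_inj cc] unfolding S_letter_eq by blast
  note Sl = reducedD(2)[OF S_letter_reduced, of \<alpha>]
  note Sl0 = S_letter_zero[of \<alpha>]
  have R0: "R (\<lambda>_. 0) = (\<lambda>_. 0)"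
  proof (rule inner_ext[OF operator_l2[OF R(1) zero_l2] zero_l2])
    fix \<xi> z assume "\<xi> \<in> l2 Y shift" "z \<in> topspace Y"
    then have "module_inner Y shift \<xi> (R (\<lambda>_. 0)) z = module_inner Y shift (S_word L \<mu> \<xi>) (\<lambda>_. 0) z"
      using R(3) zero_l2 unfolding is_adjoint_def by metis
    then show "module_inner Y shift \<xi> (R (\<lambda>_. 0)) z = module_inner Y shift \<xi> (\<lambda>_. 0) z" unfolding module_inner_def by simp
  qed
  have 1: "indicator (letter_set \<alpha>) x * cyl \<mu> (labels (shift x)) = cyl (\<alpha> # \<mu>) (labels x)" if "x \<in> X_set L" for x
    using that unfolding cyl_def letter_set_def labels_shift by (auto simp: pre_Suc labels_def)
  have "S_word L (\<alpha> # \<mu>) \<circ> (R \<circ> T) = S_letter L \<alpha> \<circ> ((S_word L \<mu> \<circ> R) \<circ> T)" unfolding SW by (simp add: comp_assoc)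
  also have "... = diag_elem L (cyl (\<alpha> # \<mu>))"
    unfolding R(4) diag_elem_eq T(3) diag_eq_iff using 1 by simp
  finally have 2: "S_word L (\<alpha> # \<mu>) \<circ> (R \<circ> T) = diag_elem L (cyl (\<alpha> # \<mu>))" .
  have "S_word L (\<alpha> # \<mu>) (\<lambda>_. 0) = (\<lambda>_. 0)" unfolding SW using Sl0 R(5) by simp
  then show ?case using adjoint_comp[OF Sl R(2) T(1) R(1) T(2) R(3)] operator_comp[OF R(1) T(1) R0]
      operator_comp[OF Sl R(2) Sl0] 2 unfolding SW[symmetric] by blast
qed

lemma S_word_projection: "S_word L \<mu> \<circ> op_star Y shift (S_word L \<mu>) = diag_elem L (cyl \<mu>)"
proof -
  obtain R where R: "R \<in> operators Y shift" "is_adjoint Y shift (S_word L \<mu>) R" "S_word L \<mu> \<circ> R = diag_elem L (cyl \<mu>)"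
    using S_word_star by blast
  then show ?thesis using op_star_eqI[OF R(1,2)] by simp
qed

lemma diag_elem_reduced: "continuous_on X g \<Longrightarrow> diag_elem L g \<in> reduced_cstar Y shift"
  unfolding diag_elem_eq by (intro diag_reduced comp_labels_CX)

text \<open>The limit function is read off from \<open>T e0\<close> on the units. There the
  \<open>g n\<close> approximate it uniformly along \<open>labels\<close>, so any choice of
  preimages under \<open>labels\<close> yields the uniform limit of the \<open>g n\<close> on
  \<open>X\<close>, which is continuous.\<close>

lemma diag_closed:
  assumes T: "T \<in> reduced_cstar Y shift"
    and a: "\<And>\<epsilon>. \<epsilon> > 0 \<Longrightarrow> \<exists>g. continuous_on X g \<and> op_norm_le Y shift (op_diff T (diag_elem L g)) \<epsilon>"
  shows "\<exists>g. continuous_on X g \<and> T = diag_elem L g"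
proof -
  have "\<exists>g. continuous_on X g \<and> op_norm_le Y shift (op_diff T (diag_elem L g)) (inverse (real (Suc n)))" for n
    by (rule a) simp
  then obtain g where g: "\<And>n. continuous_on X (g n)"
    "\<And>n. op_norm_le Y shift (op_diff T (diag_elem L (g n))) (inverse (real (Suc n)))" by metis
  define G where "G x = T e0 (x, 0, x)" for x
  have app: "diag_elem L (g n) \<xi> \<gamma> = g n (labels (fst \<gamma>)) * \<xi> \<gamma>" if "\<xi> \<in> l2 Y shift" "\<gamma> \<in> A" for n \<xi> \<gamma>
    unfolding diag_elem_eq diag_apply[OF that(1)] using that(2) by simp
  have b: "cmod (T \<xi> \<gamma> - g n (labels (fst \<gamma>)) * \<xi> \<gamma>) \<le> inverse (real (Suc n)) * r"
    if "\<xi> \<in> l2 Y shift" "\<gamma> \<in> A" "module_norm_le Y shift \<xi> r" for n \<xi> \<gamma> r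
  proof -
    have "module_norm_le Y shift (op_diff T (diag_elem L (g n)) \<xi>) (inverse (real (Suc n)) * r)"
      using g(2) that(1,3) unfolding op_norm_le_def by blast
    from norm_le_point[OF this that(2)] show ?thesis unfolding op_diff_def app[OF that(1,2)] .
  qed
  have G: "cmod (G x - g n (labels x)) \<le> inverse (real (Suc n))" if "x \<in> X_set L" for x n
    using b[OF e0_l2 unit_A e0_norm, of x n] that unfolding G_def by (simp add: e0_apply)
  define g0 where "g0 y = G (SOME x. x \<in> X_set L \<and> labels x = y)" for y
  have g0: "cmod (g0 y - g n y) \<le> inverse (real (Suc n))" if "y \<in> X" for y n
  proof -
    have "\<exists>x. x \<in> X_set L \<and> labels x = y" using that unfolding labels_surj[symmetric] by blast
    from someI_ex[OF this] show ?thesis unfolding g0_def using G[of "SOME x. x \<in> X_set L \<and> labels x = y" n] by simp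
  qed
  have lim: "(\<lambda>n. inverse (real (Suc n)) * r) \<longlonglongrightarrow> 0" for r
    by (rule tendsto_mult_left_zero[OF LIMSEQ_inverse_real_of_nat])
  have "uniform_limit X g g0 sequentially"
  proof (rule uniform_limitI)
    fix e :: real assume "e > 0"
    then obtain m where m: "\<And>n. n \<ge> m \<Longrightarrow> inverse (real (Suc n)) < e"
      using order_tendstoD(2)[OF LIMSEQ_inverse_real_of_nat] unfolding eventually_sequentially by blast
    have "dist (g n y) (g0 y) < e" if "n \<ge> m" "y \<in> X" for n y
      using g0[OF that(2), of n] m[OF that(1)] by (simp add: dist_norm norm_minus_commute)
    then show "\<forall>\<^sub>F n in sequentially. \<forall>y\<in>X. dist (g n y) (g0 y) < e" unfolding eventually_sequentially by blast
  qed
  then have c: "continuous_on X g0" using g(1) by (intro uniform_limit_theorem[where F = sequentially and f = g]) auto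
  have "T = diag_elem L g0"
  proof (rule operator_ext[OF reducedD(2)[OF T] reducedD(2)[OF diag_elem_reduced[OF c]]])
    fix \<xi> assume \<xi>: "\<xi> \<in> l2 Y shift"
    obtain r where r: "module_norm_le Y shift \<xi> r" using l2_norm[OF \<xi>] by blast
    have r0: "0 \<le> r" using norm_leD(1)[OF r] .
    show "T \<xi> = diag_elem L g0 \<xi>"
    proof
      fix \<gamma>
      show "T \<xi> \<gamma> = diag_elem L g0 \<xi> \<gamma>"
      proof (cases "\<gamma> \<in> A")
        case False
        then show ?thesis using l2D(1)[OF operator_l2[OF reducedD(2)[OF T] \<xi>]] unfolding diag_elem_eq diag_apply[OF \<xi>] by simp
      next
        case True
        let ?y = "labels (fst \<gamma>)"
        have y: "?y \<in> X" using arrow_topspace(1)[OF True] labels_X by simp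
        \<comment> \<open>One \<open>r\<close> accounts for the distance from \<open>T\<close> to
          \<open>g n\<close>, the other for that from \<open>g n\<close> to
          \<open>g0\<close>.\<close>
        have "cmod (T \<xi> \<gamma> - g0 ?y * \<xi> \<gamma>) \<le> inverse (real (Suc n)) * (2 * r)" for n
        proof -
          have "cmod (g0 ?y * \<xi> \<gamma> - g n ?y * \<xi> \<gamma>) \<le> inverse (real (Suc n)) * r"
            unfolding left_diff_distrib[symmetric] norm_mult using g0[OF y] norm_le_point[OF r True] by (intro mult_mono) auto
          then show ?thesis using b[OF \<xi> True r, of n] norm_triangle_ineq4[of "T \<xi> \<gamma> - g n ?y * \<xi> \<gamma>" "g0 ?y * \<xi> \<gamma> - g n ?y * \<xi> \<gamma>"] by simp
        qed
        then have "cmod (T \<xi> \<gamma> - g0 ?y * \<xi> \<gamma>) \<le> 0" by (intro LIMSEQ_le_const[OF lim]) blast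
        then show ?thesis unfolding diag_elem_eq diag_apply[OF \<xi>] using True by simp
      qed
    qed
  qed
  then show ?thesis using c by blast
qed

lemma diag_elem_subalgebra: "cstar_subalgebra Y shift {diag_elem L g | g. continuous_on X g}" (is "cstar_subalgebra _ _ ?B")
  unfolding cstar_subalgebra_def
proof (intro conjI ballI allI impI)
  show "?B \<subseteq> reduced_cstar Y shift" using diag_elem_reduced by blast
  show "?B \<noteq> {}" using continuous_on_const by blast
  fix S T assume "S \<in> ?B" "T \<in> ?B"
  then obtain g h where gh: "S = diag_elem L g" "T = diag_elem L h" "continuous_on X g" "continuous_on X h" by blast
  show "op_add S T \<in> ?B" unfolding gh(1,2) diag_elem_eq diag_add
    using continuous_on_add[OF gh(3,4)] by (auto simp: diag_elem_eq intro!: exI[of _ "\<lambda>x. g x + h x"])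
  show "S \<circ> T \<in> ?B" unfolding gh(1,2) diag_elem_eq diag_mult[OF comp_labels_CX[OF gh(4)]]
    using continuous_on_mult[OF gh(3,4)] by (auto simp: diag_elem_eq intro!: exI[of _ "\<lambda>x. g x * h x"])
next
  fix c T assume "T \<in> ?B"
  then obtain h where h: "T = diag_elem L h" "continuous_on X h" by blast
  show "op_scale c T \<in> ?B" unfolding h(1) diag_elem_eq diag_scale
    using continuous_on_mult[OF continuous_on_const h(2)] by (auto simp: diag_elem_eq intro!: exI[of _ "\<lambda>x. c * h x"])
next
  fix T assume "T \<in> ?B"
  then obtain h where h: "T = diag_elem L h" "continuous_on X h" by blast
  show "op_star Y shift T \<in> ?B" unfolding h(1) diag_elem_eq diag_star[OF comp_labels_CX[OF h(2)]]
    using continuous_on_cnj[OF h(2)] by (auto simp: diag_elem_eq intro!: exI[of _ "\<lambda>x. cnj (h x)"])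
next
  fix T assume T: "T \<in> reduced_cstar Y shift" "\<forall>\<epsilon>>0. \<exists>S\<in>?B. op_norm_le Y shift (op_diff T S) \<epsilon>"
  then have "\<And>\<epsilon>. \<epsilon> > 0 \<Longrightarrow> \<exists>g. continuous_on X g \<and> op_norm_le Y shift (op_diff T (diag_elem L g)) \<epsilon>" by blast
  from diag_closed[OF T(1) this] show "T \<in> ?B" by blast
qed

text \<open>By \<open>uniform_prefix\<close> a continuous function is uniformly close to one
  depending on the first \<open>m\<close> letters only, which is a finite combination of cylinder
  indicators.\<close>

lemma subalgebra_contains_diag:
  assumes B: "cstar_subalgebra Y shift B" and gen: "\<And>\<mu>. \<mu> \<in> all_words L \<Longrightarrow> diag_elem L (cyl \<mu>) \<in> B"
    and g: "continuous_on X g"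
  shows "diag_elem L g \<in> B"
proof -
  have fin: "diag_elem L (\<lambda>x. \<Sum>\<mu>\<in>M. c \<mu> * cyl \<mu> x) \<in> B" if "finite M" "M \<subseteq> all_words L" for M and c :: "nat list \<Rightarrow> complex"
    using that
  proof (induction M rule: finite_induct)
    case empty
    obtain x where "x \<in> X" using X_nonempty by blast
    then have "[] \<in> all_words L" using pre_all_words[of x 0] by simp
    then have "op_scale 0 (diag_elem L (cyl [])) \<in> B" using gen B unfolding cstar_subalgebra_def by blast
    then show ?case unfolding diag_elem_eq diag_scale by simp
  next
    case (insert \<mu> M)
    have "op_scale (c \<mu>) (diag_elem L (cyl \<mu>)) \<in> B" using gen insert B unfolding cstar_subalgebra_def by blast
    then have "op_add (op_scale (c \<mu>) (diag_elem L (cyl \<mu>))) (diag_elem L (\<lambda>x. \<Sum>\<mu>\<in>M. c \<mu> * cyl \<mu> x)) \<in> B"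
      using insert B unfolding cstar_subalgebra_def by blast
    then show ?case unfolding diag_elem_eq diag_scale diag_add using insert by simp
  qed
  have "\<exists>S\<in>B. op_norm_le Y shift (op_diff (diag_elem L g) S) \<epsilon>" if \<epsilon>: "\<epsilon> > 0" for \<epsilon>
  proof -
    obtain m where m: "\<forall>x\<in>X. \<forall>y\<in>X. pre m x = pre m y \<longrightarrow> dist (g x) (g y) < \<epsilon>" using uniform_prefix[OF g \<epsilon>] by blast
    define c where "c \<mu> = g (SOME x. x \<in> X \<and> pre m x = \<mu>)" for \<mu>
    let ?h = "\<lambda>x. \<Sum>\<mu>\<in>words L m. c \<mu> * cyl \<mu> x"
    have h: "?h x = c (pre m x)" if "x \<in> X" for x
    proof -
      have "?h x = (\<Sum>\<mu>\<in>words L m. if \<mu> = pre m x then c \<mu> else 0)"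
        by (rule sum.cong) (auto simp: cyl_def length_words)
      also have "... = c (pre m x)" using finite_words words_eq that by (simp add: sum.delta)
      finally show ?thesis .
    qed
    have "cmod (g x - ?h x) \<le> \<epsilon>" if "x \<in> X" for x
    proof -
      have "\<exists>x'. x' \<in> X \<and> pre m x' = pre m x" using that by blast
      from someI_ex[OF this] have "dist (g x) (c (pre m x)) < \<epsilon>" using m that unfolding c_def by metis
      then show ?thesis unfolding h[OF that] dist_norm by simp
    qed
    then have "op_norm_le Y shift (op_diff (diag_elem L g) (diag_elem L ?h)) \<epsilon>"
      unfolding diag_elem_eq diag_diff using \<epsilon> labels_X by (intro diag_norm) auto
    moreover have "diag_elem L ?h \<in> B" using fin[OF finite_words] words_iff by blast
    ultimately show ?thesis by blast
  qed
  then show ?thesis using B diag_elem_reduced[OF g] unfolding cstar_subalgebra_def by blast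
qed

lemma D_alg_eq: "D_alg L = {diag_elem L g | g. continuous_on X g}"
  unfolding D_alg_def cstar_generated_def S_word_projection
  using diag_elem_subalgebra subalgebra_contains_diag cyl_cont by blast

end

section \<open>From the algebra to the one-sided subshift\<close>

context sshift
begin

definition clop :: "(nat \<Rightarrow> nat) set \<Rightarrow> bool" where
  "clop V \<longleftrightarrow> openin (top_of_set X) V \<and> closedin (top_of_set X) V"

lemma clop_subset: "clop V \<Longrightarrow> V \<subseteq> X"
  unfolding clop_def using openin_subset by fastforce

lemma clop_X: "clop X" and clop_empty: "clop {}"
  unfolding clop_def by auto

lemma clop_Int: "clop V \<Longrightarrow> clop W \<Longrightarrow> clop (V \<inter> W)"
  unfolding clop_def by auto

lemma clop_Diff: "clop V \<Longrightarrow> clop W \<Longrightarrow> clop (V - W)"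
  unfolding clop_def by (auto intro: openin_diff closedin_diff)

lemma clop_Un: "clop V \<Longrightarrow> clop W \<Longrightarrow> clop (V \<union> W)"
  unfolding clop_def by auto

lemma shift_continuous_on: "continuous_on X shift"
  unfolding shift_def
  by (intro continuous_on_coordinatewise_then_product continuous_on_subset[OF continuous_on_product_coordinates subset_UNIV])

lemma clop_shift: assumes "clop V" shows "clop {x \<in> X. shift x \<in> V}"
proof -
  have "continuous_map (top_of_set X) (top_of_set X) shift"
    by (rule continuous_map_into_subtopology) (use shift_continuous_on shift_X in auto)
  then show ?thesis using assms openin_continuous_map_preimage[of "top_of_set X" "top_of_set X" shift V]
      closedin_continuous_map_preimage[of "top_of_set X" "top_of_set X" shift V]
    unfolding clop_def by simp
qed

lemma clop_cylinder: "clop {x \<in> X. pre k x = w}"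
proof -
  have "{x \<in> X. pre k x = w} = X \<inter> {x. pre k x = w}" by blast
  then have 1: "openin (top_of_set X) {x \<in> X. pre k x = w}" using openin_open_Int[OF open_cylinder] by metis
  have "open (\<Union>w'\<in>- {w}. {x :: nat \<Rightarrow> nat. pre k x = w'})" using open_cylinder by blast
  then have "openin (top_of_set X) (X \<inter> (\<Union>w'\<in>- {w}. {x. pre k x = w'}))" by (rule openin_open_Int)
  also have "X \<inter> (\<Union>w'\<in>- {w}. {x. pre k x = w'}) = X - {x \<in> X. pre k x = w}" by blast
  finally have "closedin (top_of_set X) {x \<in> X. pre k x = w}" unfolding closedin_def by simp
  then show ?thesis unfolding clop_def using 1 by blast
qed

lemma clop_nbhd:
  assumes "openin (top_of_set X) U" "x \<in> U" obtains V where "clop V" "x \<in> V" "V \<subseteq> U"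
proof -
  obtain T where T: "open T" "U = X \<inter> T" using assms(1) by (auto simp: openin_open)
  obtain k where "\<And>y. pre k y = pre k x \<Longrightarrow> y \<in> T" using cylinder_nbhd[OF T(1)] assms(2) T(2) by blast
  then show ?thesis using that[OF clop_cylinder[of k "pre k x"]] assms(2) T(2) by blast
qed

lemma clop_separate:
  assumes "x \<in> X" "y \<in> X" "x \<noteq> y" obtains V where "clop V" "x \<in> V" "y \<notin> V"
proof -
  obtain i where "x i \<noteq> y i" using assms(3) by blast
  then have "pre (Suc i) y \<noteq> pre (Suc i) x" unfolding pre_eq_iff by (metis lessI)
  then show ?thesis using that[OF clop_cylinder[of "Suc i" "pre (Suc i) x"]] assms by blast
qed

lemma clop_fun_cont:
  assumes "clop P" "clop M" shows "continuous_on X (\<lambda>x. \<phi> (x \<in> P) (x \<in> M) :: 'b :: topological_space)"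
proof -
  have l: "locally_constant (top_of_set X) (\<lambda>x. x \<in> V)" if "clop V" for V
  proof -
    have "{x \<in> topspace (top_of_set X). (x \<in> V) = k} = (if k then V else X - V)" for k
      using clop_subset[OF that] by auto
    then show ?thesis unfolding locally_constant_def using that clop_Diff[OF clop_X that] by (simp add: clop_def)
  qed
  have "continuous_map (top_of_set X) euclidean (\<lambda>x. (\<lambda>(p, m). \<phi> p m) (x \<in> P, x \<in> M))"
    by (rule continuous_map_locally_constant)
       (use locally_constant_pair[OF l[OF assms(1)] l[OF assms(2)]] in \<open>simp only: locally_constant_def\<close>)
  then show ?thesis by simp
qed

lemma clop_closed: "clop V \<Longrightarrow> closed V"
proof -
  assume "clop V"
  have "compactin euclidean X" using compact_X by simp
  then have "closedin euclidean X" using compactin_imp_closedin[OF Hausdorff_sequences] by blast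
  then show ?thesis using \<open>clop V\<close> unfolding clop_def by (metis closed_closedin closedin_trans_full)
qed

lemma clop_fip:
  assumes "\<And>V. V \<in> F \<Longrightarrow> clop V" "\<And>F'. finite F' \<Longrightarrow> F' \<subseteq> F \<Longrightarrow> X \<inter> \<Inter>F' \<noteq> {}"
  shows "X \<inter> \<Inter>F \<noteq> {}"
  using compact_X by (rule compact_imp_fip) (use assms clop_closed in blast)+

end

section \<open>Stone duality for one-sided subshifts\<close>

locale sshift_pair = S1: sshift N1 L1 + S2: sshift N2 L2 for N1 L1 N2 L2
begin

text \<open>\<open>h x\<close> is picked from the intersection of all \<open>\<kappa> V\<close> with
  x in \<open>V\<close>, nonempty by compactness. Complements turn the implication so obtained into
  an equivalence, and separation by clopen sets makes \<open>h\<close> bijective. A continuous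
  bijection from a compact to a Hausdorff space is a homeomorphism.\<close>

lemma stone_duality:
  assumes clop: "\<And>V. S1.clop V \<Longrightarrow> S2.clop (\<kappa> V)"
    and int: "\<And>V W. S1.clop V \<Longrightarrow> S1.clop W \<Longrightarrow> \<kappa> (V \<inter> W) = \<kappa> V \<inter> \<kappa> W"
    and compl: "\<And>V. S1.clop V \<Longrightarrow> \<kappa> (S1.X - V) = S2.X - \<kappa> V"
    and inj: "\<And>V W. S1.clop V \<Longrightarrow> S1.clop W \<Longrightarrow> \<kappa> V = \<kappa> W \<Longrightarrow> V = W"
    and surj: "\<And>W. S2.clop W \<Longrightarrow> \<exists>V. S1.clop V \<and> \<kappa> V = W"
  shows "\<exists>h. homeomorphic_map (top_of_set S1.X) (top_of_set S2.X) h \<and>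
    (\<forall>x\<in>S1.X. h x \<in> S2.X \<and> (\<forall>V. S1.clop V \<longrightarrow> (h x \<in> \<kappa> V \<longleftrightarrow> x \<in> V)))"
proof -
  have emp: "\<kappa> {} = {}" using int[OF S1.clop_X S1.clop_empty] compl[OF S1.clop_X] by auto
  have univ: "\<kappa> S1.X = S2.X" using compl[OF S1.clop_empty] emp by simp
  have fin: "\<exists>V. S1.clop V \<and> \<Inter>F \<inter> S1.X = V \<and> \<kappa> V = S2.X \<inter> \<Inter>(\<kappa> ` F)" if "finite F" "\<forall>V\<in>F. S1.clop V" for F
    using that
  proof (induction F rule: finite_induct)
    case empty then show ?case using S1.clop_X univ by auto
  next
    case (insert V F)
    then obtain W where W: "S1.clop W" "\<Inter>F \<inter> S1.X = W" "\<kappa> W = S2.X \<inter> \<Inter>(\<kappa> ` F)" by auto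
    have "\<kappa> (V \<inter> W) = S2.X \<inter> \<Inter>(\<kappa> ` insert V F)" using int[of V W] insert.prems W by auto
    moreover have "\<Inter>(insert V F) \<inter> S1.X = V \<inter> W" using W(2) by blast
    ultimately show ?case using S1.clop_Int[of V W] insert.prems W(1) by auto
  qed
  have ex1: "\<exists>y. y \<in> S2.X \<and> (\<forall>V. S1.clop V \<longrightarrow> x \<in> V \<longrightarrow> y \<in> \<kappa> V)" if x: "x \<in> S1.X" for x
  proof -
    have "S2.X \<inter> \<Inter>(\<kappa> ` {V. S1.clop V \<and> x \<in> V}) \<noteq> {}"
    proof (rule S2.clop_fip)
      fix F' assume F': "finite F'" "F' \<subseteq> \<kappa> ` {V. S1.clop V \<and> x \<in> V}"
      then obtain F where F: "finite F" "F \<subseteq> {V. S1.clop V \<and> x \<in> V}" "F' = \<kappa> ` F" by (meson finite_subset_image)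
      then obtain W where W: "S1.clop W" "\<Inter>F \<inter> S1.X = W" "\<kappa> W = S2.X \<inter> \<Inter>(\<kappa> ` F)" using fin[of F] by auto
      have "x \<in> W" using W(2) F(2) x by blast
      then have "\<kappa> W \<noteq> {}" using inj[OF W(1) S1.clop_empty] emp by blast
      then show "S2.X \<inter> \<Inter>F' \<noteq> {}" using W(3) F(3) by simp
    qed (use clop in blast)
    then obtain y where "y \<in> S2.X \<inter> \<Inter>(\<kappa> ` {V. S1.clop V \<and> x \<in> V})" by (meson ex_in_conv)
    then show ?thesis by (intro exI[of _ y]) auto
  qed
  then obtain h where h: "\<And>x. x \<in> S1.X \<Longrightarrow> h x \<in> S2.X"
    "\<And>x V. x \<in> S1.X \<Longrightarrow> S1.clop V \<Longrightarrow> x \<in> V \<Longrightarrow> h x \<in> \<kappa> V" by metis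
  have iff: "h x \<in> \<kappa> V \<longleftrightarrow> x \<in> V" if "x \<in> S1.X" "S1.clop V" for x V
  proof (cases "x \<in> V")
    case False
    then have "h x \<in> \<kappa> (S1.X - V)" using that h(2)[OF that(1) S1.clop_Diff[OF S1.clop_X that(2)]] by blast
    then show ?thesis using compl[OF that(2)] False by simp
  qed (use h(2)[OF that] in blast)
  have "inj_on h S1.X"
  proof (rule inj_onI, rule ccontr)
    fix x y assume xy: "x \<in> S1.X" "y \<in> S1.X" "h x = h y" "x \<noteq> y"
    then obtain V where "S1.clop V" "x \<in> V" "y \<notin> V" using S1.clop_separate by blast
    then show False using iff[OF xy(1)] iff[OF xy(2)] xy(3) by auto
  qed
  moreover have "y \<in> h ` S1.X" if y: "y \<in> S2.X" for y
  proof -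
    have "S1.X \<inter> \<Inter>{V. S1.clop V \<and> y \<in> \<kappa> V} \<noteq> {}"
    proof (rule S1.clop_fip)
      fix F assume F: "finite F" "F \<subseteq> {V. S1.clop V \<and> y \<in> \<kappa> V}"
      then obtain W where W: "S1.clop W" "\<Inter>F \<inter> S1.X = W" "\<kappa> W = S2.X \<inter> \<Inter>(\<kappa> ` F)" using fin[of F] by auto
      have "y \<in> \<kappa> W" using W(3) F(2) y by blast
      then show "S1.X \<inter> \<Inter>F \<noteq> {}" using emp W(2) by (metis empty_iff inf_commute)
    qed blast
    then obtain x where x: "x \<in> S1.X" "\<And>V. S1.clop V \<Longrightarrow> y \<in> \<kappa> V \<Longrightarrow> x \<in> V" by blast
    have "h x = y"
    proof (rule ccontr)
      assume "h x \<noteq> y"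
      then obtain W where W: "S2.clop W" "y \<in> W" "h x \<notin> W" using S2.clop_separate[OF y h(1)[OF x(1)]] by metis
      obtain V where V: "S1.clop V" "\<kappa> V = W" using surj[OF W(1)] by blast
      then show False using x(2)[OF V(1)] iff[OF x(1) V(1)] W by simp
    qed
    then show ?thesis using x(1) by blast
  qed
  then have "h ` S1.X = S2.X" using h(1) by blast
  moreover have "continuous_map (top_of_set S1.X) (top_of_set S2.X) h"
    unfolding continuous_map_def
  proof (intro conjI allI impI)
    fix U assume U: "openin (top_of_set S2.X) U"
    show "openin (top_of_set S1.X) {x \<in> topspace (top_of_set S1.X). h x \<in> U}"
    proof (subst openin_subopen, intro ballI)
      fix x assume x: "x \<in> {x \<in> topspace (top_of_set S1.X). h x \<in> U}"
      then obtain W where W: "S2.clop W" "h x \<in> W" "W \<subseteq> U" using S2.clop_nbhd[OF U] by blast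
      obtain V where V: "S1.clop V" "\<kappa> V = W" using surj[OF W(1)] by blast
      have "V \<subseteq> {x \<in> topspace (top_of_set S1.X). h x \<in> U}"
        using S1.clop_subset[OF V(1)] iff[OF _ V(1)] V(2) W(3) by auto
      moreover have "x \<in> V" using iff[OF _ V(1)] x V(2) W(2) by simp
      ultimately show "\<exists>T. openin (top_of_set S1.X) T \<and> x \<in> T \<and> T \<subseteq> {x \<in> topspace (top_of_set S1.X). h x \<in> U}"
        using V(1) unfolding S1.clop_def by blast
    qed
  qed (use h(1) in auto)
  moreover have "Hausdorff_space (top_of_set S2.X)"
    by (rule Hausdorff_space_subtopology[OF Hausdorff_sequences])
  moreover have "compact_space (top_of_set S1.X)"
    using S1.compact_X by (simp add: compact_space_subtopology)
  ultimately have "homeomorphic_map (top_of_set S1.X) (top_of_set S2.X) h"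
    by (intro continuous_imp_homeomorphic_map) auto
  then show ?thesis using h(1) iff by blast
qed

end

section \<open>Projections, generators and the gauge action at the unit vector\<close>

context normal_sshift
begin

definition E :: "(nat \<Rightarrow> nat) set \<Rightarrow> lpath oper" where "E V = diag_elem L (indicator V)"

lemma clop_indicator: "clop V \<Longrightarrow> continuous_on X (indicator V :: _ \<Rightarrow> complex)"
  using continuous_map_indicator[of "top_of_set X" V] unfolding clop_def by simp

lemma E_D: "clop V \<Longrightarrow> E V \<in> D_alg L"
  unfolding D_alg_eq E_def using clop_indicator by blast

lemma D_reduced: "T \<in> D_alg L \<Longrightarrow> T \<in> reduced_cstar Y shift"
  unfolding D_alg_eq using diag_elem_reduced by blast

lemma E_reduced: "clop V \<Longrightarrow> E V \<in> reduced_cstar Y shift"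
  using E_D D_reduced by blast

lemma diag_elem_mult: "continuous_on X g' \<Longrightarrow> diag_elem L g \<circ> diag_elem L g' = diag_elem L (\<lambda>x. g x * g' x)"
  unfolding diag_elem_eq using diag_mult[OF comp_labels_CX] by blast

lemma diag_elem_add: "op_add (diag_elem L g) (diag_elem L g') = diag_elem L (\<lambda>x. g x + g' x)"
  unfolding diag_elem_eq diag_add ..

lemma diag_elem_scale: "op_scale c (diag_elem L g) = diag_elem L (\<lambda>x. c * g x)"
  unfolding diag_elem_eq diag_scale ..

lemma E_Int: "clop W \<Longrightarrow> E V \<circ> E W = E (V \<inter> W)"
proof -
  assume "clop W"
  have "(\<lambda>x. indicator V x * indicator W x :: complex) = indicator (V \<inter> W)" by (auto simp: indicator_def fun_eq_iff)
  then show ?thesis unfolding E_def diag_elem_mult[OF clop_indicator[OF \<open>clop W\<close>]] by simp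
qed

lemma E_eq_iff: "clop V \<Longrightarrow> clop W \<Longrightarrow> E V = E W \<longleftrightarrow> V = W"
  unfolding E_def diag_elem_eq_iff using clop_subset by (auto simp: indicator_def split: if_splits)

lemma idempotent_E:
  assumes "T \<in> D_alg L" "T \<circ> T = T" shows "\<exists>V. clop V \<and> T = E V"
proof -
  obtain g where g: "continuous_on X g" "T = diag_elem L g" using assms(1) unfolding D_alg_eq by blast
  have "\<forall>x\<in>X. g x * g x = g x" using assms(2) unfolding g(2) diag_elem_mult[OF g(1)] diag_elem_eq_iff .
  then have 01: "g x = 0 \<or> g x = 1" if "x \<in> X" for x using that by auto
  define V where "V = {x \<in> X. g x = 1}"
  have "V = X \<inter> g -` {1}" unfolding V_def by blast
  then have "closedin (top_of_set X) V" using continuous_closedin_preimage[OF g(1), of "{1}"] by simp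
  moreover have "V = X \<inter> g -` ball 1 (1/2)" unfolding V_def using 01 by (force simp: dist_norm)
  then have "openin (top_of_set X) V" using continuous_openin_preimage_gen[OF g(1), of "ball 1 (1/2)"] by simp
  ultimately have "clop V" unfolding clop_def by blast
  moreover have "T = E V" unfolding g(2) E_def diag_elem_eq_iff V_def using 01 by (auto simp: indicator_def)
  ultimately show ?thesis by blast
qed

lemma E_X_left: assumes "T \<in> reduced_cstar Y shift" shows "E X \<circ> T = T"
proof
  fix \<xi> show "(E X \<circ> T) \<xi> = T \<xi>"
  proof (cases "\<xi> \<in> l2 Y shift")
    case True
    then have l: "T \<xi> \<in> l2 Y shift" using operator_l2 reducedD(2)[OF assms] by blast
    show ?thesis unfolding E_def diag_elem_eq o_apply
      using diag_apply[OF l] l2D(1)[OF l] arrow_topspace(1) labels_X by (auto simp: fun_eq_iff)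
  next
    case False
    then have "T \<xi> = (\<lambda>_. 0)" using reducedD(2)[OF assms] unfolding operators_def by blast
    then show ?thesis unfolding E_def diag_elem_eq o_apply using diag_apply[OF zero_l2] by auto
  qed
qed

text \<open>The product is again convolution by a function on the graph of the shift, which places
  it in the reduced algebra directly; injectivity of \<Phi> and faithfulness can then be applied to
  it.\<close>

lemma diag_letter:
  assumes "continuous_on X g"
  shows "diag_elem L g \<circ> S_letter L \<alpha> \<in> reduced_cstar Y shift"
    "\<xi> \<in> l2 Y shift \<Longrightarrow> \<gamma> \<in> A \<Longrightarrow>
      (diag_elem L g \<circ> S_letter L \<alpha>) \<xi> \<gamma> = g (labels (fst \<gamma>)) * (indicator (letter_set \<alpha>) (fst \<gamma>) * \<xi> (jmap 1 \<gamma>))"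
proof -
  let ?\<phi> = "\<lambda>x. g (labels x) * indicator (letter_set \<alpha>) x"
  have c: "?\<phi> \<in> CX" using continuous_map_mult[of Y "\<lambda>x. g (labels x)" "indicator (letter_set \<alpha>)"]
      comp_labels_CX[OF assms] indicator_CX[OF letter_clopen] by simp
  have s0: "\<And>x. x \<in> topspace Y \<Longrightarrow> x \<notin> letter_set \<alpha> \<Longrightarrow> ?\<phi> x = 0" by simp
  note red = isometry_reduced[where C = "letter_set \<alpha>", OF letter_clopen letter_inj c s0]
  have l: "S_letter L \<alpha> \<xi> \<in> l2 Y shift" if "\<xi> \<in> l2 Y shift" for \<xi>
    using operator_l2 reducedD(2) S_letter_reduced that by blast
  show ap: "(diag_elem L g \<circ> S_letter L \<alpha>) \<xi> \<gamma> = g (labels (fst \<gamma>)) * (indicator (letter_set \<alpha>) (fst \<gamma>) * \<xi> (jmap 1 \<gamma>))"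
    if "\<xi> \<in> l2 Y shift" "\<gamma> \<in> A" for \<xi> \<gamma>
    unfolding o_apply diag_elem_eq diag_apply[OF l[OF that(1)]] S_letter_apply[OF that] using that(2) by simp
  have "diag_elem L g \<circ> S_letter L \<alpha> \<in> operators Y shift"
    by (rule operator_comp[OF reducedD(2)[OF diag_elem_reduced[OF assms]] reducedD(2)[OF S_letter_reduced] diag_elem_zero])
  then have "diag_elem L g \<circ> S_letter L \<alpha> = conv_op Y shift (graph_fun 1 ?\<phi>)"
  proof (rule operator_ext[OF _ reducedD(2)[OF red]])
    fix \<xi> assume \<xi>: "\<xi> \<in> l2 Y shift"
    show "(diag_elem L g \<circ> S_letter L \<alpha>) \<xi> = conv_op Y shift (graph_fun 1 ?\<phi>) \<xi>"
    proof
      fix \<gamma> show "(diag_elem L g \<circ> S_letter L \<alpha>) \<xi> \<gamma> = conv_op Y shift (graph_fun 1 ?\<phi>) \<xi> \<gamma>"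
      proof (cases "\<gamma> \<in> A")
        case True
        show ?thesis unfolding ap[OF \<xi> True]
          using isometry_apply[where C = "letter_set \<alpha>", OF letter_clopen letter_inj c s0 \<xi> True] by simp
      next
        case False
        then show ?thesis using l2D(1)[OF operator_l2[OF reducedD(2)[OF red] \<xi>] False]
          unfolding o_apply diag_elem_eq diag_apply[OF l[OF \<xi>]] by simp
      qed
    qed
  qed
  then show "diag_elem L g \<circ> S_letter L \<alpha> \<in> reduced_cstar Y shift" using red by simp
qed

text \<open>A diagonal operator on the left sees the range x of an arrow; on the right it acts after
  \<open>jmap 1\<close>, hence at \<open>shift x\<close>.\<close>

lemma E_letter_commute:
  assumes "clop V" shows "E {x \<in> X. shift x \<in> V} \<circ> S_letter L \<alpha> = S_letter L \<alpha> \<circ> E V"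
proof -
  let ?V' = "{x \<in> X. shift x \<in> V}"
  note c = clop_indicator[OF clop_shift[OF assms]]
  note oE = reducedD(2)[OF E_reduced[OF assms]]
  note oS = reducedD(2)[OF S_letter_reduced, of \<alpha>]
  have o2: "S_letter L \<alpha> \<circ> E V \<in> operators Y shift" by (rule operator_comp[OF oS oE S_letter_zero])
  show ?thesis unfolding E_def[of ?V']
  proof (rule operator_ext[OF reducedD(2)[OF diag_letter(1)[OF c]] o2])
    fix \<xi> assume \<xi>: "\<xi> \<in> l2 Y shift"
    have l: "E V \<xi> \<in> l2 Y shift" using operator_l2 oE \<xi> by blast
    show "(diag_elem L (indicator ?V') \<circ> S_letter L \<alpha>) \<xi> = (S_letter L \<alpha> \<circ> E V) \<xi>"
    proof
      fix \<gamma> show "(diag_elem L (indicator ?V') \<circ> S_letter L \<alpha>) \<xi> \<gamma> = (S_letter L \<alpha> \<circ> E V) \<xi> \<gamma>"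
      proof (cases "\<gamma> \<in> A")
        case True
        have "(S_letter L \<alpha> \<circ> E V) \<xi> \<gamma> = indicator (letter_set \<alpha>) (fst \<gamma>) * E V \<xi> (jmap 1 \<gamma>)"
          unfolding o_apply by (rule S_letter_apply[OF l True])
        also have "E V \<xi> (jmap 1 \<gamma>) = indicator V (labels (fst (jmap 1 \<gamma>))) * \<xi> (jmap 1 \<gamma>)"
          unfolding E_def diag_elem_eq diag_apply[OF \<xi>] using jmap_A[OF True] by simp
        also have "labels (fst (jmap 1 \<gamma>)) = shift (labels (fst \<gamma>))" unfolding jmap_def by (simp add: labels_shift)
        also have "(indicator V (shift (labels (fst \<gamma>))) :: complex) = indicator ?V' (labels (fst \<gamma>))"
          using arrow_topspace(1)[OF True] labels_X by (simp add: indicator_def)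
        finally show ?thesis unfolding diag_letter(2)[OF c \<xi> True] by simp
      next
        case False
        then show ?thesis using l2D(1)[OF operator_l2[OF o2 \<xi>] False]
            l2D(1)[OF operator_l2[OF reducedD(2)[OF diag_letter(1)[OF c]] \<xi>] False] by simp
      qed
    qed
  qed
qed

text \<open>On units range and source coincide, so a projection acts on \<open>e0\<close> like a
  right multiplication, which passes through every adjointable operator by
  \<open>module_linear\<close>.\<close>

lemma E_e0:
  assumes "clop W" shows "E W e0 = rmul (\<lambda>x. indicator W (labels x)) e0"
proof
  fix \<gamma> :: "lpath arrow" obtain x n z where "\<gamma> = (x, n, z)" by (metis prod.collapse)
  then show "E W e0 \<gamma> = rmul (\<lambda>x. indicator W (labels x)) e0 \<gamma>"
    unfolding E_def diag_elem_eq diag_apply[OF e0_l2] rmul_def wfun_def by (auto simp: e0_apply)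
qed

lemma continuous_on_discrete_comp:
  fixes f :: "(nat \<Rightarrow> nat) \<Rightarrow> 'c :: discrete_topology"
  assumes "continuous_on X f" shows "continuous_on X (\<lambda>x. \<phi> (f x) :: 'b :: topological_space)"
proof -
  have "openin (top_of_set X) {x \<in> topspace (top_of_set X). f x = k}" for k
  proof -
    have "openin (top_of_set X) (X \<inter> f -` {k})"
      by (rule continuous_openin_preimage_gen[OF assms]) (simp add: open_discrete)
    moreover have "X \<inter> f -` {k} = {x \<in> topspace (top_of_set X). f x = k}" by auto
    ultimately show ?thesis by simp
  qed
  then have "continuous_map (top_of_set X) euclidean (\<lambda>x. \<phi> (f x))" by (rule continuous_map_locally_constant)
  then show ?thesis by simp
qed

lemma potential_open:
  assumes "continuous_on X f" shows "openin Y {x \<in> topspace Y. (f \<circ> labels) x = (k :: int)}"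
proof -
  have "openin (top_of_set X) (X \<inter> f -` {k})"
    by (rule continuous_openin_preimage_gen[OF assms]) (simp add: open_discrete)
  then have "openin Y {x \<in> topspace Y. labels x \<in> X \<inter> f -` {k}}"
    using openin_continuous_map_preimage[OF labels_cont] by blast
  moreover have "{x \<in> topspace Y. labels x \<in> X \<inter> f -` {k}} = {x \<in> topspace Y. (f \<circ> labels) x = k}"
    using labels_X by auto
  ultimately show ?thesis by simp
qed

text \<open>Additivity of the cocycle, with the first step split off. Both exponents are raised by
  one so that the power of \<open>x\<close> contains a step to split off even if the given exponent
  is 0.\<close>

lemma cocycle_jmap:
  assumes "\<gamma> \<in> A" shows "cocycle shift F \<gamma> = F (fst \<gamma>) + cocycle shift F (jmap 1 \<gamma>)"
proof -
  obtain x n z where g: "\<gamma> = (x, n, z)" by (metis prod.collapse)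
  then have "(x, n, z) \<in> A" using assms by simp
  then obtain p q where pq: "n = int p - int q" "(shift ^^ p) x = (shift ^^ q) z" by (rule arrowsE)
  have 1: "(shift ^^ Suc p) x = (shift ^^ Suc q) z" using pq(2) by simp
  have 2: "(shift ^^ p) (shift x) = (shift ^^ Suc q) z" using 1 by (simp add: funpow_swap1)
  have "bsum F (Suc p) x = F x + bsum F p (shift x)" using bsum_add[of F 1 p x] by (simp add: bsum_def)
  moreover have "cocycle shift F (x, n, z) = bsum F (Suc p) x - bsum F (Suc q) z"
    by (rule cocycle_eq[OF 1]) (simp add: pq)
  moreover have "cocycle shift F (shift x, n - 1, z) = bsum F p (shift x) - bsum F (Suc q) z"
    by (rule cocycle_eq[OF 2]) (simp add: pq)
  ultimately show ?thesis unfolding g jmap_def by simp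
qed

lemma gauge_letter:
  assumes f: "continuous_on X f"
  shows "gauge_action L f t (S_letter L \<alpha>) =
    diag_elem L (\<lambda>x. exp (2 * of_real pi * \<i> * of_int (f x) * of_real t)) \<circ> S_letter L \<alpha>"
proof -
  let ?F = "f \<circ> labels" let ?g = "\<lambda>x. exp (2 * of_real pi * \<i> * of_int (f x) * of_real t)"
  let ?U = "\<lambda>t. gauge_unitary Y shift ?F t"
  note po = potential_open[OF f]
  have g: "continuous_on X ?g"
    by (rule continuous_on_discrete_comp[OF f])
  have U: "?U t \<xi> \<gamma> = exp (2 * of_real pi * \<i> * of_int (cocycle shift ?F \<gamma>) * of_real t) * \<xi> \<gamma>"
    if "\<xi> \<in> l2 Y shift" for t \<xi> \<gamma> using that unfolding gauge_unitary_def restrict_op_def by simp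
  have Uo: "?U t \<in> operators Y shift" for t using gauge_wop(2)[OF po] .
  note oS = reducedD(2)[OF S_letter_reduced, of \<alpha>]
  note S0 = S_letter_zero[of \<alpha>]
  have U0: "?U t (\<lambda>_. 0) = (\<lambda>_. 0)" for t using U[OF zero_l2] by auto
  have ga: "gauge_action L f t (S_letter L \<alpha>) = ?U t \<circ> (S_letter L \<alpha> \<circ> ?U (- t))"
    unfolding gauge_action_def Let_def gauge_wop(3)[OF po] by (simp add: comp_assoc)
  show ?thesis unfolding ga
  proof (rule operator_ext[OF _ reducedD(2)[OF diag_letter(1)[OF g]]])
    show "?U t \<circ> (S_letter L \<alpha> \<circ> ?U (- t)) \<in> operators Y shift"
      using operator_comp[OF Uo operator_comp[OF oS Uo S0] U0] .
    fix \<xi> assume \<xi>: "\<xi> \<in> l2 Y shift"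
    have l1: "?U (- t) \<xi> \<in> l2 Y shift" using operator_l2 Uo \<xi> by blast
    have l2: "S_letter L \<alpha> (?U (- t) \<xi>) \<in> l2 Y shift" using operator_l2 oS l1 by blast
    show "(?U t \<circ> (S_letter L \<alpha> \<circ> ?U (- t))) \<xi> = (diag_elem L ?g \<circ> S_letter L \<alpha>) \<xi>"
    proof
      fix \<gamma> show "(?U t \<circ> (S_letter L \<alpha> \<circ> ?U (- t))) \<xi> \<gamma> = (diag_elem L ?g \<circ> S_letter L \<alpha>) \<xi> \<gamma>"
      proof (cases "\<gamma> \<in> A")
        case True
        let ?e = "\<lambda>k t. exp (2 * of_real pi * \<i> * of_int k * of_real t) :: complex"
        let ?c = "cocycle shift ?F (jmap 1 \<gamma>)"
        have "?e (?F (fst \<gamma>) + ?c) t * ?e ?c (- t) = ?e (?F (fst \<gamma>)) t"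
          unfolding exp_add[symmetric] by (simp add: algebra_simps)
        moreover have "(?U t \<circ> (S_letter L \<alpha> \<circ> ?U (- t))) \<xi> \<gamma> =
            (?e (?F (fst \<gamma>) + ?c) t * ?e ?c (- t)) * (indicator (letter_set \<alpha>) (fst \<gamma>) * \<xi> (jmap 1 \<gamma>))"
          unfolding o_apply[of "?U t"] o_apply[of "S_letter L \<alpha>"] U[OF l2] cocycle_jmap[OF True, of ?F] S_letter_apply[OF l1 True] U[OF \<xi>]
          by (simp only: mult_ac)
        ultimately show ?thesis unfolding diag_letter(2)[OF g \<xi> True] by (simp only: o_apply)
      next
        case False
        have "(?U t \<circ> (S_letter L \<alpha> \<circ> ?U (- t))) \<xi> \<gamma> = 0"
          unfolding o_apply[of "?U t"] o_apply[of "S_letter L \<alpha>"] U[OF l2] l2D(1)[OF l2 False] by (rule mult_zero_right)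
        then show ?thesis using l2D(1)[OF operator_l2[OF reducedD(2)[OF diag_letter(1)[OF g]] \<xi>] False] by (simp only:)
      qed
    qed
  qed
qed

text \<open>Both Birkhoff sums telescope, and their end terms cancel because the two orbits have
  met.\<close>

lemma cocycle_coboundary:
  assumes "\<And>x. x \<in> X_set L \<Longrightarrow> F x = b x - b (shift x)" "(x, n, z) \<in> A"
  shows "cocycle shift F (x, n, z) = b x - b z"
proof -
  obtain p q where pq: "x \<in> topspace Y" "z \<in> topspace Y" "n = int p - int q" "(shift ^^ p) x = (shift ^^ q) z"
    using assms(2) by (rule arrowsE)
  have "bsum F p x = b x - b ((shift ^^ p) x)" if "x \<in> topspace Y" for p x
  proof (induction p)
    case (Suc p)
    have "(shift ^^ p) x \<in> X_set L" using pow_topspace[OF that] by simp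
    then show ?case using Suc assms(1) by (simp add: bsum_def)
  qed (simp add: bsum_def)
  then show ?thesis using cocycle_eq[OF pq(4,3)] pq by simp
qed

text \<open>The cocycle vanishes on units, so the unitary on the right fixes \<open>e0\<close> and
  only the left one contributes a phase.\<close>

lemma gauge_e0:
  assumes f: "continuous_on X f" and T: "T \<in> operators Y shift"
  shows "gauge_action L f t T e0 \<gamma> = exp (2 * of_real pi * \<i> * of_int (cocycle shift (f \<circ> labels) \<gamma>) * of_real t) * T e0 \<gamma>"
proof -
  let ?U = "\<lambda>t. gauge_unitary Y shift (f \<circ> labels) t"
  note po = potential_open[OF f]
  have U: "?U t \<xi> \<gamma> = exp (2 * of_real pi * \<i> * of_int (cocycle shift (f \<circ> labels) \<gamma>) * of_real t) * \<xi> \<gamma>"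
    if "\<xi> \<in> l2 Y shift" for t \<xi> \<gamma> using that unfolding gauge_unitary_def restrict_op_def by simp
  have "?U (- t) e0 = e0"
  proof
    fix \<gamma> :: "lpath arrow" obtain x n z where g: "\<gamma> = (x, n, z)" by (metis prod.collapse)
    have "cocycle shift (f \<circ> labels) (x, 0, x) = 0"
      using cocycle_eq[of 0 x 0 x 0 "f \<circ> labels"] by simp
    then show "?U (- t) e0 \<gamma> = e0 \<gamma>" unfolding U[OF e0_l2] g e0_apply by auto
  qed
  then show ?thesis unfolding gauge_action_def Let_def gauge_wop(3)[OF po]
    using U[OF operator_l2[OF T e0_l2], of t \<gamma>] by (simp only: o_apply)
qed

end

section \<open>The map on clopen sets induced by a diagonal-preserving isomorphism\<close>

locale normal_pair = S1: normal_sshift N1 L1 + S2: normal_sshift N2 L2 for N1 L1 N2 L2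

sublocale normal_pair \<subseteq> sshift_pair ..

locale diagonal_isomorphism = normal_pair +
  fixes \<Phi> :: "lpath oper \<Rightarrow> lpath oper"
  assumes iso: "cstar_isomorphism (X_top L1) shift (X_top L2) shift \<Phi>"
    and diagonal: "\<Phi> ` D_alg L1 = D_alg L2"
    and gauge: "\<And>f t T. f \<in> CZ L1 \<Longrightarrow> T \<in> O_min L1 \<Longrightarrow>
        \<Phi> (gauge_action L1 f t T) = gauge_action L2 (image_potential L1 L2 \<Phi> f) t (\<Phi> T)"
begin

abbreviation "R1 \<equiv> reduced_cstar (X_top L1) shift"
abbreviation "R2 \<equiv> reduced_cstar (X_top L2) shift"

lemma \<Phi>_R: "T \<in> R1 \<Longrightarrow> \<Phi> T \<in> R2"
  using iso unfolding cstar_isomorphism_def bij_betw_def by blast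

lemma \<Phi>_inj: "S \<in> R1 \<Longrightarrow> T \<in> R1 \<Longrightarrow> \<Phi> S = \<Phi> T \<Longrightarrow> S = T"
  using iso unfolding cstar_isomorphism_def bij_betw_def inj_on_def by blast

lemma \<Phi>_surj: "T \<in> R2 \<Longrightarrow> \<exists>S\<in>R1. \<Phi> S = T"
proof -
  assume T: "T \<in> R2"
  have "\<Phi> ` R1 = R2" using iso unfolding cstar_isomorphism_def bij_betw_def by blast
  then have "T \<in> \<Phi> ` R1" using T by simp
  then obtain S where "T = \<Phi> S" "S \<in> R1" by (rule imageE)
  then show ?thesis by (intro bexI[of _ S]) simp_all
qed

lemma \<Phi>_add: "S \<in> R1 \<Longrightarrow> T \<in> R1 \<Longrightarrow> \<Phi> (op_add S T) = op_add (\<Phi> S) (\<Phi> T)"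
  and \<Phi>_mult: "S \<in> R1 \<Longrightarrow> T \<in> R1 \<Longrightarrow> \<Phi> (S \<circ> T) = \<Phi> S \<circ> \<Phi> T"
  and \<Phi>_scale: "T \<in> R1 \<Longrightarrow> \<Phi> (op_scale c T) = op_scale c (\<Phi> T)"
  using iso unfolding cstar_isomorphism_def by blast+

lemma ex_\<kappa>: "S1.clop V \<Longrightarrow> \<exists>W. S2.clop W \<and> \<Phi> (S1.E V) = S2.E W"
proof -
  assume V: "S1.clop V"
  have "\<Phi> (S1.E V) \<circ> \<Phi> (S1.E V) = \<Phi> (S1.E V)"
    using \<Phi>_mult[OF S1.E_reduced[OF V] S1.E_reduced[OF V]] S1.E_Int[OF V, of V] by simp
  moreover have "\<Phi> (S1.E V) \<in> D_alg L2" using diagonal S1.E_D[OF V] by blast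
  ultimately show ?thesis using S2.idempotent_E by blast
qed

definition \<kappa> where "\<kappa> V = (SOME W. S2.clop W \<and> \<Phi> (S1.E V) = S2.E W)"

lemma \<kappa>: assumes "S1.clop V" shows "S2.clop (\<kappa> V)" "\<Phi> (S1.E V) = S2.E (\<kappa> V)"
  using someI_ex[OF ex_\<kappa>[OF assms]] unfolding \<kappa>_def by blast+

lemma \<kappa>_eqI: "S1.clop V \<Longrightarrow> S2.clop W \<Longrightarrow> \<Phi> (S1.E V) = S2.E W \<Longrightarrow> \<kappa> V = W"
  using \<kappa>[of V] S2.E_eq_iff by metis

lemma \<kappa>_Int: assumes "S1.clop V" "S1.clop W" shows "\<kappa> (V \<inter> W) = \<kappa> V \<inter> \<kappa> W"
proof (rule \<kappa>_eqI[OF S1.clop_Int[OF assms] S2.clop_Int[OF \<kappa>(1)[OF assms(1)] \<kappa>(1)[OF assms(2)]]])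
  show "\<Phi> (S1.E (V \<inter> W)) = S2.E (\<kappa> V \<inter> \<kappa> W)"
    unfolding S1.E_Int[OF assms(2), symmetric] \<Phi>_mult[OF S1.E_reduced[OF assms(1)] S1.E_reduced[OF assms(2)]]
      \<kappa>(2)[OF assms(1)] \<kappa>(2)[OF assms(2)] by (rule S2.E_Int[OF \<kappa>(1)[OF assms(2)]])
qed

text \<open>\<open>cstar_isomorphism\<close> says nothing about units. The unit of the second
  algebra has a preimage \<open>T\<close>; as \<open>S1.E S1.X\<close> is a left unit for
  \<open>T\<close>, its image is a left unit for that unit, hence equal to it.\<close>

lemma \<kappa>_X: "\<kappa> S1.X = S2.X"
proof -
  obtain T where T: "T \<in> R1" "\<Phi> T = S2.E S2.X" using \<Phi>_surj[OF S2.E_reduced[OF S2.clop_X]] by blast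
  have "S2.E S2.X = \<Phi> (S1.E S1.X \<circ> T)" using S1.E_X_left[OF T(1)] T(2) by simp
  also have "... = S2.E (\<kappa> S1.X) \<circ> S2.E S2.X"
    unfolding \<Phi>_mult[OF S1.E_reduced[OF S1.clop_X] T(1)] \<kappa>(2)[OF S1.clop_X] T(2) ..
  also have "... = S2.E (\<kappa> S1.X \<inter> S2.X)" by (rule S2.E_Int[OF S2.clop_X])
  finally have "S2.X = \<kappa> S1.X \<inter> S2.X"
    using S2.E_eq_iff[OF S2.clop_X S2.clop_Int[OF \<kappa>(1)[OF S1.clop_X] S2.clop_X]] by blast
  then show ?thesis using S2.clop_subset[OF \<kappa>(1)[OF S1.clop_X]] by blast
qed

lemma \<kappa>_Diff: assumes V: "S1.clop V" shows "\<kappa> (S1.X - V) = S2.X - \<kappa> V"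
proof -
  have cV: "S1.clop (S1.X - V)" using S1.clop_Diff[OF S1.clop_X V] .
  have "op_add (S1.E V) (S1.E (S1.X - V)) = S1.E S1.X"
    unfolding S1.E_def S1.diag_elem_add S1.diag_elem_eq_iff by (auto simp: indicator_def)
  then have "op_add (S2.E (\<kappa> V)) (S2.E (\<kappa> (S1.X - V))) = S2.E S2.X"
    using \<Phi>_add[OF S1.E_reduced[OF V] S1.E_reduced[OF cV]] \<kappa>(2)[OF V] \<kappa>(2)[OF cV] \<kappa>(2)[OF S1.clop_X] \<kappa>_X by simp
  then have *: "indicator (\<kappa> V) x + indicator (\<kappa> (S1.X - V)) x = (indicator S2.X x :: complex)" if "x \<in> S2.X" for x
    using that unfolding S2.E_def S2.diag_elem_add S2.diag_elem_eq_iff by blast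
  have "x \<in> \<kappa> (S1.X - V) \<longleftrightarrow> x \<notin> \<kappa> V" if "x \<in> S2.X" for x
    using *[OF that] that by (auto simp: indicator_def split: if_splits)
  then show ?thesis using S2.clop_subset[OF \<kappa>(1)[OF cV]] by blast
qed

lemma \<kappa>_inj: "S1.clop V \<Longrightarrow> S1.clop W \<Longrightarrow> \<kappa> V = \<kappa> W \<Longrightarrow> V = W"
proof -
  assume VW: "S1.clop V" "S1.clop W" "\<kappa> V = \<kappa> W"
  have "\<Phi> (S1.E V) = \<Phi> (S1.E W)" using \<kappa>(2)[OF VW(1)] \<kappa>(2)[OF VW(2)] VW(3) by simp
  then have "S1.E V = S1.E W" by (rule \<Phi>_inj[OF S1.E_reduced[OF VW(1)] S1.E_reduced[OF VW(2)]])
  then show "V = W" using S1.E_eq_iff[OF VW(1,2)] by blast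
qed

lemma \<kappa>_surj: assumes W: "S2.clop W" shows "\<exists>V. S1.clop V \<and> \<kappa> V = W"
proof -
  have "S2.E W \<in> \<Phi> ` D_alg L1" using diagonal S2.E_D[OF W] by simp
  then obtain T where T': "S2.E W = \<Phi> T" and T: "T \<in> D_alg L1" by (rule imageE)
  note T = T T'[symmetric]
  have TR: "T \<in> R1" using S1.D_reduced T(1) by blast
  obtain g where g: "T = diag_elem L1 g" "continuous_on S1.X g" using T(1) unfolding S1.D_alg_eq by blast
  have "T \<circ> T = diag_elem L1 (\<lambda>x. g x * g x)" unfolding g(1) by (rule S1.diag_elem_mult[OF g(2)])
  then have "T \<circ> T \<in> R1" using S1.diag_elem_reduced[OF continuous_on_mult[OF g(2) g(2)]] by simp
  moreover have "\<Phi> (T \<circ> T) = \<Phi> T" unfolding \<Phi>_mult[OF TR TR] T(2) S2.E_Int[OF W] by simp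
  ultimately have "T \<circ> T = T" using \<Phi>_inj TR by blast
  then obtain V where V: "S1.clop V" "T = S1.E V" using S1.idempotent_E T(1) by blast
  then show ?thesis using \<kappa>_eqI[OF V(1) W] T(2) by blast
qed

lemma \<kappa>_empty: "\<kappa> {} = {}"
  using \<kappa>_Diff[OF S1.clop_X] \<kappa>_X by simp

lemma \<Phi>_zero: "\<Phi> (\<lambda>_ _. 0) = (\<lambda>_ _. 0)"
proof -
  have z: "op_scale 0 T = (\<lambda>_ _. 0)" for T :: "lpath oper" unfolding op_scale_def by simp
  show ?thesis using \<Phi>_scale[OF S1.E_reduced[OF S1.clop_X], of 0] unfolding z .
qed

text \<open>b - b \<circ> \<sigma> is 1 on \<open>V - sV\<close>, -1 on \<open>sV - V\<close> and 0
  elsewhere; \<open>f\<close> is its pullback, built from the clopen sets \<open>P\<close> and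
  \<open>M\<close> that correspond to the first two. At t = 1/2 the phase of \<open>f\<close> is 1
  minus twice the indicator of \<open>P \<union> M\<close>, so linearity and \<open>\<kappa>\<close>
  give its image.\<close>

lemma coboundary_potential:
  assumes V: "S2.clop V"
  defines "b \<equiv> \<lambda>y. of_bool (y \<in> V) :: int"
  obtains f where "f \<in> CZ L1" "continuous_on S1.X f" "continuous_on S2.X (image_potential L1 L2 \<Phi> f)"
    "\<And>y. y \<in> S2.X \<Longrightarrow> image_potential L1 L2 \<Phi> f y = b y - b (shift y)"
    "\<And>\<alpha>. \<Phi> (gauge_action L1 f (1/2) (S_letter L1 \<alpha>)) =
      diag_elem L2 (\<lambda>y. 1 - 2 * of_bool ((y \<in> V) \<noteq> (shift y \<in> V))) \<circ> \<Phi> (S_letter L1 \<alpha>)"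
proof -
  define sV where "sV = {y \<in> S2.X. shift y \<in> V}"
  have sV: "S2.clop sV" unfolding sV_def by (rule S2.clop_shift[OF V])
  obtain P where P: "S1.clop P" "\<kappa> P = V - sV" using \<kappa>_surj[OF S2.clop_Diff[OF V sV]] by blast
  obtain M where M: "S1.clop M" "\<kappa> M = sV - V" using \<kappa>_surj[OF S2.clop_Diff[OF sV V]] by blast
  have "\<kappa> (P \<inter> M) = \<kappa> {}" unfolding \<kappa>_Int[OF P(1) M(1)] P(2) M(2) \<kappa>_empty by blast
  then have PM: "P \<inter> M = {}" using \<kappa>_inj[OF S1.clop_Int[OF P(1) M(1)] S1.clop_empty] by blast
  define f0 where "f0 x = (of_bool (x \<in> P) - of_bool (x \<in> M) :: int)" for x
  define f where "f = restrict f0 S1.X"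
  define g0 where "g0 y = b y - b (shift y)" for y
  define g where "g = restrict g0 S2.X"
  have "continuous_on S1.X f0" unfolding f0_def by (rule S1.clop_fun_cont[OF P(1) M(1)])
  then have cf: "continuous_on S1.X f" unfolding f_def by (simp cong: continuous_on_cong)
  have g0: "g0 y = of_bool (y \<in> V - sV) - of_bool (y \<in> sV - V)" if "y \<in> S2.X" for y
    using that unfolding g0_def b_def sV_def by auto
  have "continuous_on S2.X (\<lambda>y. of_bool (y \<in> V - sV) - of_bool (y \<in> sV - V) :: int)"
    by (rule S2.clop_fun_cont[OF S2.clop_Diff[OF V sV] S2.clop_Diff[OF sV V]])
  then have cg: "continuous_on S2.X g" unfolding g_def using g0 by (simp cong: continuous_on_cong)
  have fCZ: "f \<in> CZ L1" unfolding CZ_def using cf unfolding f_def by simp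
  have gCZ: "g \<in> CZ L2" unfolding CZ_def using cg unfolding g_def by simp
  note ER = S1.E_reduced[OF P(1)] S1.E_reduced[OF M(1)]
  have sER: "op_scale c (S1.E W) \<in> R1" if "S1.clop W" for c W
    unfolding S1.E_def S1.diag_elem_scale
    by (intro S1.diag_elem_reduced continuous_on_mult continuous_on_const S1.clop_indicator that)
  have df: "diag_elem L1 (\<lambda>x. of_int (f x)) = op_add (S1.E P) (op_scale (-1) (S1.E M))"
    unfolding S1.E_def S1.diag_elem_scale S1.diag_elem_add S1.diag_elem_eq_iff f_def f0_def by (auto simp: indicator_def)
  have \<Phi>f: "\<Phi> (diag_elem L1 (\<lambda>x. of_int (f x))) = diag_elem L2 (\<lambda>y. of_int (g y))"
    unfolding df \<Phi>_add[OF ER(1) sER[OF M(1)]] \<Phi>_scale[OF ER(2)] \<kappa>(2)[OF P(1)] \<kappa>(2)[OF M(1)] P(2) M(2)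
    unfolding S2.E_def S2.diag_elem_scale S2.diag_elem_add S2.diag_elem_eq_iff g_def using g0 by (auto simp: indicator_def)
  have ip: "image_potential L1 L2 \<Phi> f = g"
    unfolding image_potential_def
  proof (rule the_equality)
    show "g \<in> CZ L2 \<and> diag_elem L2 (\<lambda>y. of_int (g y)) = \<Phi> (diag_elem L1 (\<lambda>x. of_int (f x)))" using gCZ \<Phi>f by simp
    fix g' assume g': "g' \<in> CZ L2 \<and> diag_elem L2 (\<lambda>y. of_int (g' y)) = \<Phi> (diag_elem L1 (\<lambda>x. of_int (f x)))"
    then have "\<forall>y\<in>S2.X. complex_of_int (g' y) = of_int (g y)" unfolding \<Phi>f S2.diag_elem_eq_iff by blast
    then have "\<forall>y\<in>S2.X. g' y = g y" by simp
    then show "g' = g" using g' gCZ unfolding CZ_def by (auto intro: extensionalityI)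
  qed
  let ?J = "\<lambda>x. exp (2 * of_real pi * \<i> * of_int (f x) * of_real (1/2)) :: complex"
  have J: "diag_elem L1 ?J = op_add (S1.E S1.X) (op_scale (-2) (S1.E (P \<union> M)))"
    unfolding S1.E_def S1.diag_elem_scale S1.diag_elem_add S1.diag_elem_eq_iff
    using PM by (auto simp: indicator_def f_def f0_def exp_minus mult.commute[of _ \<i>] mult_ac)
  have cPM: "S1.clop (P \<union> M)" using S1.clop_Un P(1) M(1) by blast
  have \<kappa>PM: "\<kappa> (P \<union> M) = (V - sV) \<union> (sV - V)"
  proof -
    \<comment> \<open>Rewritten with intersections and complements, the operations that
      \<open>\<kappa>\<close> is known to respect.\<close>
    have "P \<union> M = S1.X - ((S1.X - P) \<inter> (S1.X - M))" using S1.clop_subset P(1) M(1) by blast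
    then have "\<kappa> (P \<union> M) = S2.X - ((S2.X - (V - sV)) \<inter> (S2.X - (sV - V)))"
      using \<kappa>_Diff[OF S1.clop_Int[OF S1.clop_Diff[OF S1.clop_X P(1)] S1.clop_Diff[OF S1.clop_X M(1)]]]
        \<kappa>_Int[OF S1.clop_Diff[OF S1.clop_X P(1)] S1.clop_Diff[OF S1.clop_X M(1)]]
        \<kappa>_Diff[OF P(1)] \<kappa>_Diff[OF M(1)] P(2) M(2) by simp
    then show ?thesis using S2.clop_subset[OF V] S2.clop_subset[OF sV] by blast
  qed
  have cJ: "continuous_on S1.X ?J" by (rule S1.continuous_on_discrete_comp[OF cf])
  have \<Phi>J: "\<Phi> (diag_elem L1 ?J) = diag_elem L2 (\<lambda>y. 1 - 2 * of_bool ((y \<in> V) \<noteq> (shift y \<in> V)))"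
    unfolding J \<Phi>_add[OF S1.E_reduced[OF S1.clop_X] sER[OF cPM]] \<Phi>_scale[OF S1.E_reduced[OF cPM]]
      \<kappa>(2)[OF S1.clop_X] \<kappa>(2)[OF cPM] \<kappa>_X \<kappa>PM
    unfolding S2.E_def S2.diag_elem_scale S2.diag_elem_add S2.diag_elem_eq_iff
    by (auto simp: indicator_def sV_def)
  show thesis
  proof (rule that[of f])
    show "continuous_on S2.X (image_potential L1 L2 \<Phi> f)" unfolding ip by (rule cg)
    show "image_potential L1 L2 \<Phi> f y = b y - b (shift y)" if "y \<in> S2.X" for y
      using that unfolding ip g_def g0_def by simp
    show "\<Phi> (gauge_action L1 f (1/2) (S_letter L1 \<alpha>)) =
      diag_elem L2 (\<lambda>y. 1 - 2 * of_bool ((y \<in> V) \<noteq> (shift y \<in> V))) \<circ> \<Phi> (S_letter L1 \<alpha>)" for \<alpha>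
      unfolding S1.gauge_letter[OF cf] \<Phi>_mult[OF S1.diag_elem_reduced[OF cJ] S1.S_letter_reduced] \<Phi>J ..
  qed (use fCZ cf in auto)
qed

text \<open>The function of the image of a letter is supported on arrows \<open>(x, n, z)\<close> for which the label
  sequence of \<open>z\<close> is the shift of that of \<open>x\<close>: on such arrows all coboundaries
  \<open>b - b \<circ> \<sigma>\<close> have to agree with \<open>b(x) - b(z)\<close>.\<close>

lemma letter_image_support:
  assumes V: "S2.clop V" and g: "(x, n, z) \<in> S2.A" and nz: "\<Phi> (S_letter L1 \<alpha>) S2.e0 (x, n, z) \<noteq> 0"
  shows "labels z \<in> V \<longleftrightarrow> shift (labels x) \<in> V"
proof -
  let ?T = "\<Phi> (S_letter L1 \<alpha>)"
  let ?b = "\<lambda>y. of_bool (y \<in> V) :: int"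
  have TR: "?T \<in> R2" using \<Phi>_R S1.S_letter_reduced by blast
  obtain f where f: "f \<in> CZ L1" "continuous_on S1.X f" "continuous_on S2.X (image_potential L1 L2 \<Phi> f)"
    "\<And>y. y \<in> S2.X \<Longrightarrow> image_potential L1 L2 \<Phi> f y = ?b y - ?b (shift y)"
    "\<And>\<alpha>. \<Phi> (gauge_action L1 f (1/2) (S_letter L1 \<alpha>)) =
      diag_elem L2 (\<lambda>y. 1 - 2 * of_bool ((y \<in> V) \<noteq> (shift y \<in> V))) \<circ> \<Phi> (S_letter L1 \<alpha>)"
    using coboundary_potential[OF V] by blast
  let ?g = "image_potential L1 L2 \<Phi> f"
  have Tl: "?T S2.e0 \<in> l2 (X_top L2) shift" using S2.operator_l2[OF S2.reducedD(2)[OF TR] S2.e0_l2] .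
  have "gauge_action L2 ?g (1/2) ?T = diag_elem L2 (\<lambda>y. 1 - 2 * of_bool ((y \<in> V) \<noteq> (shift y \<in> V))) \<circ> ?T"
    using gauge[OF f(1), of "S_letter L1 \<alpha>" "1/2"] S1.S_letter_reduced f(5) unfolding O_min_def by metis
  then have "gauge_action L2 ?g (1/2) ?T S2.e0 (x, n, z) =
      diag_elem L2 (\<lambda>y. 1 - 2 * of_bool ((y \<in> V) \<noteq> (shift y \<in> V))) (?T S2.e0) (x, n, z)" by simp
  \<comment> \<open>The same function on the groupoid computed twice: once with the phase of the
    cocycle, once with a sign that depends on the range alone. Where the function is nonzero the two
    factors agree.\<close>
  then have *: "exp (2 * of_real pi * \<i> * of_int (cocycle shift (?g \<circ> labels) (x, n, z)) * of_real (1/2)) =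
     (1 - 2 * of_bool ((labels x \<in> V) \<noteq> (shift (labels x) \<in> V)) :: complex)"
    unfolding S2.gauge_e0[OF f(3) S2.reducedD(2)[OF TR]] S2.diag_elem_eq S2.diag_apply[OF Tl] using nz g by simp
  have "cocycle shift (?g \<circ> labels) (x, n, z) = ?b (labels x) - ?b (labels z)"
    by (rule S2.cocycle_coboundary[where b = "\<lambda>x. ?b (labels x)", OF _ g])
       (use f(4) S2.labels_X in \<open>auto simp: S2.labels_shift\<close>)
  moreover have "2 * of_real pi * \<i> * of_int k * of_real (1/2) = of_int k * (of_real pi * \<i>)" for k by simp
  ultimately have "exp (of_int (?b (labels x) - ?b (labels z)) * (of_real pi * \<i>)) =
     (1 - 2 * of_bool ((labels x \<in> V) \<noteq> (shift (labels x) \<in> V)) :: complex)"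
    using * by (simp only:)
  \<comment> \<open>The exponents are -1, 0 or 1, so the parities of b(x) - b(z) and of b(x) -
    b(\<sigma> x) agree; as b takes the values 0 and 1, b(z) = b(\<sigma> x).\<close>
  moreover have "exp (- (complex_of_real pi * \<i>)) = - 1" by (simp add: exp_minus)
  ultimately show ?thesis
    by (cases "labels x \<in> V"; cases "labels z \<in> V"; cases "shift (labels x) \<in> V") simp_all
qed

text \<open>The symmetric difference \<open>D\<close> of the two sides is pulled back to
  \<open>C\<close>, so that emptiness is concluded in the first algebra, where the letters are
  explicit.\<close>

lemma \<kappa>_shift: assumes V: "S1.clop V" shows "\<kappa> {x \<in> S1.X. shift x \<in> V} = {y \<in> S2.X. shift y \<in> \<kappa> V}"
proof -
  let ?V' = "{x \<in> S1.X. shift x \<in> V}" let ?W = "{y \<in> S2.X. shift y \<in> \<kappa> V}"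
  have V': "S1.clop ?V'" by (rule S1.clop_shift[OF V])
  have W: "S2.clop ?W" by (rule S2.clop_shift[OF \<kappa>(1)[OF V]])
  define D where "D = (\<kappa> ?V' - ?W) \<union> (?W - \<kappa> ?V')"
  have D: "S2.clop D" unfolding D_def using S2.clop_Un S2.clop_Diff \<kappa>(1)[OF V'] W by blast
  obtain C where C: "S1.clop C" "\<kappa> C = D" using \<kappa>_surj[OF D] by blast
  have zero: "S1.E C \<circ> S_letter L1 \<alpha> = (\<lambda>_ _. 0)" for \<alpha>
  proof -
    let ?T = "\<Phi> (S_letter L1 \<alpha>)"
    have SR: "S_letter L1 \<alpha> \<in> R1" by (rule S1.S_letter_reduced)
    have TR: "?T \<in> R2" by (rule \<Phi>_R[OF SR])
    have Tl: "?T S2.e0 \<in> l2 (X_top L2) shift" using S2.operator_l2[OF S2.reducedD(2)[OF TR] S2.e0_l2] .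
    have QR: "S1.E C \<circ> S_letter L1 \<alpha> \<in> R1" unfolding S1.E_def by (rule S1.diag_letter(1)[OF S1.clop_indicator[OF C(1)]])
    have Q: "\<Phi> (S1.E C \<circ> S_letter L1 \<alpha>) = S2.E D \<circ> ?T"
      unfolding \<Phi>_mult[OF S1.E_reduced[OF C(1)] SR] \<kappa>(2)[OF C(1)] C(2) ..
    \<comment> \<open>The image of \<open>E_letter_commute\<close>. Applied to \<open>e0\<close>, it
      compares at each arrow a condition on the range with one on the source.\<close>
    have "S2.E (\<kappa> ?V') \<circ> ?T = ?T \<circ> S2.E (\<kappa> V)"
      using S1.E_letter_commute[OF V, of \<alpha>] \<Phi>_mult[OF S1.E_reduced[OF V'] SR] \<Phi>_mult[OF SR S1.E_reduced[OF V]]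
      unfolding \<kappa>(2)[OF V'] \<kappa>(2)[OF V] by simp
    from fun_cong[OF this, of S2.e0] have "S2.E (\<kappa> ?V') (?T S2.e0) = ?T (S2.E (\<kappa> V) S2.e0)" unfolding o_apply .
    also have "... = S2.rmul (\<lambda>x. indicator (\<kappa> V) (labels x)) (?T S2.e0)"
      unfolding S2.E_e0[OF \<kappa>(1)[OF V]]
      by (rule S2.module_linear[OF S2.reducedD(1)[OF TR] S2.comp_labels_CX[OF S2.clop_indicator[OF \<kappa>(1)[OF V]]] S2.e0_l2])
    finally have eq: "S2.E (\<kappa> ?V') (?T S2.e0) = S2.rmul (\<lambda>x. indicator (\<kappa> V) (labels x)) (?T S2.e0)" .
    have "S2.E D (?T S2.e0) \<gamma> = 0" for \<gamma>
    proof (cases "\<gamma> \<in> S2.A \<and> ?T S2.e0 \<gamma> \<noteq> 0")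
      case False then show ?thesis unfolding S2.E_def S2.diag_elem_eq S2.diag_apply[OF Tl] by auto
    next
      case True
      obtain x n z where g: "\<gamma> = (x, n, z)" by (metis prod.collapse)
      have gA: "(x, n, z) \<in> S2.A" and nz: "?T S2.e0 (x, n, z) \<noteq> 0" using True g by auto
      have "indicator (\<kappa> ?V') (labels x) * ?T S2.e0 (x, n, z) = indicator (\<kappa> V) (labels z) * ?T S2.e0 (x, n, z)"
        using fun_cong[OF eq, of "(x, n, z)"] gA
        unfolding S2.E_def S2.diag_elem_eq S2.diag_apply[OF Tl] S2.rmul_def S2.wfun_def by simp
      then have "labels x \<in> \<kappa> ?V' \<longleftrightarrow> labels z \<in> \<kappa> V" using nz by (auto simp: indicator_def split: if_splits)
      moreover have "labels z \<in> \<kappa> V \<longleftrightarrow> shift (labels x) \<in> \<kappa> V" by (rule letter_image_support[OF \<kappa>(1)[OF V] gA nz])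
      moreover have "labels x \<in> S2.X" using S2.arrow_topspace(1)[OF gA] S2.labels_X by simp
      ultimately have "labels x \<notin> D" unfolding D_def by blast
      then show ?thesis unfolding g S2.E_def S2.diag_elem_eq S2.diag_apply[OF Tl] by simp
    qed
    then have "\<Phi> (S1.E C \<circ> S_letter L1 \<alpha>) S2.e0 = (\<lambda>_. 0)" unfolding Q by auto
    then have "\<Phi> (S1.E C \<circ> S_letter L1 \<alpha>) = (\<lambda>_ _. 0)" using S2.reduced_faithful[OF \<Phi>_R[OF QR]] by blast
    moreover have "(\<lambda>_ _. 0) \<in> R1"
    proof -
      have "diag_elem L1 (\<lambda>_. 0) = (\<lambda>_ _. 0)"
        unfolding S1.diag_elem_eq S1.diag_wop S1.wop_def restrict_op_def S1.wfun_def by (auto simp: fun_eq_iff)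
      then show ?thesis using S1.diag_elem_reduced[of "\<lambda>_. 0"] by simp
    qed
    ultimately show ?thesis using \<Phi>_inj[OF QR] \<Phi>_zero by simp
  qed
  have "C = {}"
  proof (rule ccontr)
    assume "C \<noteq> {}"
    then obtain c where c: "c \<in> C" by blast
    then have "c \<in> labels ` X_set L1" using S1.clop_subset[OF C(1)] S1.labels_surj by blast
    \<comment> \<open>At the arrow from this lift of \<open>c\<close> to its shift, the generator of
      its first letter applied to \<open>e0\<close> has the value 1, and \<open>E C\<close>
      preserves it.\<close>
    then obtain x where x: "x \<in> X_set L1" "labels x = c" by blast
    have g: "S1.graph 1 x \<in> S1.A" using S1.graph_A x(1) by simp
    have "S1.jmap 1 (S1.graph 1 x) = (shift x, 0, shift x)" unfolding S1.jmap_def S1.graph_def by simp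
    then have e: "S1.e0 (S1.jmap 1 (S1.graph 1 x)) = 1" using S1.shift_X_set[OF x(1)] by (simp add: S1.e0_apply)
    have "fst (S1.graph 1 x) = x" unfolding S1.graph_def by simp
    then have "(S1.E C \<circ> S_letter L1 (fst (x 0))) S1.e0 (S1.graph 1 x) = 1"
      unfolding S1.E_def S1.diag_letter(2)[OF S1.clop_indicator[OF C(1)] S1.e0_l2 g] e
      using c x by (simp add: S1.letter_set_def)
    then show False unfolding zero by simp
  qed
  then have "D = {}" using C(2) \<kappa>_empty by simp
  then show ?thesis unfolding D_def by blast
qed

text \<open>Clopen sets separate the points of the second subshift, and all of them are of the form
  \<open>\<kappa> V\<close>, so \<open>\<kappa>_shift\<close> passes from sets to points.\<close>

lemma one_sided_conjugate: "one_sided_conjugate L1 L2"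
proof -
  obtain h where h: "homeomorphic_map (top_of_set S1.X) (top_of_set S2.X) h"
    "\<And>x. x \<in> S1.X \<Longrightarrow> h x \<in> S2.X" "\<And>x V. x \<in> S1.X \<Longrightarrow> S1.clop V \<Longrightarrow> h x \<in> \<kappa> V \<longleftrightarrow> x \<in> V"
    using stone_duality[OF \<kappa>(1) \<kappa>_Int \<kappa>_Diff \<kappa>_inj \<kappa>_surj] by blast
  have "h (shift x) = shift (h x)" if x: "x \<in> S1.X" for x
  proof (rule ccontr)
    assume ne: "h (shift x) \<noteq> shift (h x)"
    have sx: "shift x \<in> S1.X" using S1.shift_X[OF x] .
    obtain W where W: "S2.clop W" "h (shift x) \<in> W" "shift (h x) \<notin> W"
      using S2.clop_separate[OF h(2)[OF sx] S2.shift_X[OF h(2)[OF x]] ne] by blast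
    obtain V where V: "S1.clop V" "\<kappa> V = W" using \<kappa>_surj[OF W(1)] by blast
    have "shift x \<in> V" using h(3)[OF sx V(1)] V(2) W(2) by simp
    then have "h x \<in> \<kappa> {x \<in> S1.X. shift x \<in> V}" using h(3)[OF x S1.clop_shift[OF V(1)]] x by simp
    then show False unfolding \<kappa>_shift[OF V(1)] V(2) using W(3) by simp
  qed
  then show ?thesis unfolding one_sided_conjugate_def using h(1) by blast
qed

end

section \<open>From the one-sided subshift to the path space\<close>

text \<open>One window length \<open>m\<close> serves both codes, so that everything proved for
  \<open>h\<close> is available for \<open>g\<close> through \<open>flip\<close>.\<close>

locale conjugacy = sshift_pair +
  fixes h :: "(nat \<Rightarrow> nat) \<Rightarrow> nat \<Rightarrow> nat" and g :: "(nat \<Rightarrow> nat) \<Rightarrow> nat \<Rightarrow> nat" and m :: nat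
  assumes h_X: "\<And>x. x \<in> S1.X \<Longrightarrow> h x \<in> S2.X" and g_X: "\<And>y. y \<in> S2.X \<Longrightarrow> g y \<in> S1.X"
    and gh: "\<And>x. x \<in> S1.X \<Longrightarrow> g (h x) = x" and hg: "\<And>y. y \<in> S2.X \<Longrightarrow> h (g y) = y"
    and h_shift: "\<And>x. x \<in> S1.X \<Longrightarrow> h (shift x) = shift (h x)"
    and h_block: "\<And>x y. x \<in> S1.X \<Longrightarrow> y \<in> S1.X \<Longrightarrow> pre m x = pre m y \<Longrightarrow> h x 0 = h y 0"
    and g_block: "\<And>x y. x \<in> S2.X \<Longrightarrow> y \<in> S2.X \<Longrightarrow> pre m x = pre m y \<Longrightarrow> g x 0 = g y 0"
begin

lemma g_shift: "y \<in> S2.X \<Longrightarrow> g (shift y) = shift (g y)"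
  by (metis g_X gh h_shift hg S1.shift_X)

lemma flip: "conjugacy N2 L2 N1 L1 g h m"
  by unfold_locales (fact h_X g_X gh hg g_shift h_block g_block)+

lemma h_shift_pow: "x \<in> S1.X \<Longrightarrow> h ((shift ^^ n) x) = (shift ^^ n) (h x)"
  by (induction n) (auto simp: h_shift S1.shift_pow_X)

lemma h_prefix:
  assumes "x \<in> S1.X" "y \<in> S1.X" "pre (n + m) x = pre (n + m) y" shows "pre n (h x) = pre n (h y)"
proof -
  have "h x i = h y i" if "i < n" for i
  proof -
    have "pre m ((shift ^^ i) x) = pre m ((shift ^^ i) y)"
      using assms(3) that unfolding pre_eq_iff shift_funpow by auto
    then have "h ((shift ^^ i) x) 0 = h ((shift ^^ i) y) 0" by (intro h_block S1.shift_pow_X assms)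
    then show ?thesis unfolding h_shift_pow[OF assms(1)] h_shift_pow[OF assms(2)] by (simp add: shift_funpow)
  qed
  then show ?thesis unfolding pre_eq_iff by blast
qed

text \<open>A point prolonging \<open>h x\<close> to the left is the code of some z, and z prolongs
  \<open>x\<close> because \<open>h\<close> is injective and commutes with the shift.\<close>

lemma Past_h:
  assumes x: "x \<in> S1.X" shows "S2.Past l (h x) = (\<lambda>\<nu>. pre l (h (app \<nu> x))) ` S1.Past l x"
proof (intro equalityI subsetI)
  fix \<mu> assume "\<mu> \<in> S2.Past l (h x)"
  then have \<mu>: "length \<mu> = l" "app \<mu> (h x) \<in> S2.X" unfolding S2.Past_def by auto
  let ?z = "g (app \<mu> (h x))"
  have z: "?z \<in> S1.X" "h ?z = app \<mu> (h x)" using g_X hg \<mu>(2) by auto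
  have "h ((shift ^^ l) ?z) = h x" unfolding h_shift_pow[OF z(1)] z(2) using shift_app \<mu>(1) by blast
  then have "(shift ^^ l) ?z = x" using gh S1.shift_pow_X z(1) x by metis
  then have a: "app (pre l ?z) x = ?z" using app_pre_shift by metis
  then have 1: "pre l ?z \<in> S1.Past l x" unfolding S1.Past_def using z(1) by simp
  have 2: "\<mu> = pre l (h (app (pre l ?z) x))" unfolding a z(2) using pre_app'[OF \<mu>(1)] by simp
  show "\<mu> \<in> (\<lambda>\<nu>. pre l (h (app \<nu> x))) ` S1.Past l x" by (rule image_eqI, rule 2, rule 1)
next
  fix \<mu> assume "\<mu> \<in> (\<lambda>\<nu>. pre l (h (app \<nu> x))) ` S1.Past l x"
  then obtain \<nu> where \<nu>: "length \<nu> = l" "app \<nu> x \<in> S1.X" "\<mu> = pre l (h (app \<nu> x))" unfolding S1.Past_def by blast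
  have "(shift ^^ l) (h (app \<nu> x)) = h x" using h_shift_pow[OF \<nu>(2), of l] shift_app[of \<nu> x] \<nu>(1) by simp
  then have "app \<mu> (h x) = h (app \<nu> x)" unfolding \<nu>(3) using app_pre_shift by metis
  then show "\<mu> \<in> S2.Past l (h x)" unfolding S2.Past_def using h_X[OF \<nu>(2)] \<nu>(3) by simp
qed

text \<open>Prepending the same \<nu> to \<open>x\<close> and \<open>y\<close> gives points with a
  common prefix of length \<open>l + m\<close>, which fixes the first \<open>l\<close> letters of
  their codes.\<close>

lemma Past_h_eq:
  assumes "x \<in> S1.X" "y \<in> S1.X" "pre m x = pre m y" "S1.Past l x = S1.Past l y"
  shows "S2.Past l (h x) = S2.Past l (h y)"
proof -
  have "pre l (h (app \<nu> x)) = pre l (h (app \<nu> y))" if "\<nu> \<in> S1.Past l x" for \<nu>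
  proof (rule h_prefix)
    show "app \<nu> x \<in> S1.X" "app \<nu> y \<in> S1.X" using that assms(4) unfolding S1.Past_def by auto
    have "length \<nu> = l" using that unfolding S1.Past_def by blast
    then show "pre (l + m) (app \<nu> x) = pre (l + m) (app \<nu> y)" using pre_app_add[of \<nu> m] assms(3) by metis
  qed
  then show ?thesis unfolding Past_h[OF assms(1)] Past_h[OF assms(2)] assms(4)[symmetric] by (rule image_cong[OF refl])
qed

lemma psync_h: assumes "S1.psync l x" shows "S2.psync l (h x)"
proof -
  interpret C: conjugacy N2 L2 N1 L1 g h m by (rule flip)
  obtain k where x: "x \<in> S1.X" and k: "\<And>y. y \<in> S1.X \<Longrightarrow> pre k y = pre k x \<Longrightarrow> S1.Past l y = S1.Past l x"
    using assms unfolding S1.psync_iff by blast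
  \<comment> \<open>Of the \<open>k + m + m\<close> letters, the code \<open>g\<close> consumes
    \<open>m\<close>; the remaining \<open>k + m\<close> cover both the synchronizing cylinder of
    \<open>x\<close> and the window required by \<open>Past_h_eq\<close>.\<close>
  have "S2.Past l y = S2.Past l (h x)" if y: "y \<in> S2.X" "pre (k + m + m) y = pre (k + m + m) (h x)" for y
  proof -
    have "pre (k + m) (g y) = pre (k + m) (g (h x))" by (rule C.h_prefix[OF y(1) h_X[OF x] y(2)])
    then have p: "pre (k + m) (g y) = pre (k + m) x" using gh[OF x] by simp
    have "pre k (g y) = pre k x" "pre m (g y) = pre m x" using pre_mono[OF p] by auto
    then have "S2.Past l (h (g y)) = S2.Past l (h x)" by (intro Past_h_eq g_X y x k)
    then show ?thesis using hg[OF y(1)] by simp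
  qed
  then show ?thesis unfolding S2.psync_iff using h_X[OF x] by blast
qed

lemma cls_h:
  assumes "S1.psync l x" "S1.psync l y" "S1.cls l x = S1.cls l y" "pre m x = pre m y"
  shows "S2.cls l (h x) = S2.cls l (h y)"
  using Past_h_eq[OF S1.psync_X[OF assms(1)] S1.psync_X[OF assms(2)] assms(4)]
    S1.cls_eq_iff[OF assms(1,2)] S2.cls_eq_iff[OF psync_h[OF assms(1)] psync_h[OF assms(2)]] assms(3) by blast

text \<open>By the previous lemma the choice of \<open>y\<close> is immaterial; without such a \<open>y\<close> the value is junk.\<close>

definition vmap :: "nat list \<Rightarrow> nat \<Rightarrow> nat list set \<Rightarrow> nat list set" where
  "vmap w l c = S2.cls l (h (SOME y. S1.psync l y \<and> S1.cls l y = c \<and> pre m y = w))"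

lemma vmap: assumes "S1.psync l y" shows "vmap (pre m y) l (S1.cls l y) = S2.cls l (h y)"
proof -
  let ?P = "\<lambda>y'. S1.psync l y' \<and> S1.cls l y' = S1.cls l y \<and> pre m y' = pre m y"
  have "?P (SOME y'. ?P y')" by (rule someI[of ?P y]) (use assms in simp)
  then show ?thesis unfolding vmap_def using cls_h assms by blast
qed

section \<open>The lifted conjugacy of path spaces\<close>

text \<open>Besides a vertex \<open>vmap\<close> takes the \<open>m\<close> letters that follow it.
  The vertex stored at position \<open>i\<close> stands behind the letter at \<open>i\<close>, so
  these letters start at \<open>Suc i\<close>.\<close>

definition lift :: "lpath \<Rightarrow> lpath" where
  "lift x = (\<lambda>i. (h (labels x) i, \<lambda>l. vmap (pre m ((shift ^^ Suc i) (labels x))) l (snd (x i) l)))"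

text \<open>The \<open>m\<close> additional steps supply the windows of the code at all positions up
  to \<open>n\<close>.\<close>

lemma approx_h:
  assumes "S1.apx (n + m) n v a x" "a \<in> S1.X"
  shows "S2.apx n n (\<lambda>i l. vmap (pre m ((shift ^^ i) a)) l (v i l)) (h a) (h x)"
proof -
  have x: "x \<in> S1.X" using S1.apxD(1)[OF assms(1)] .
  have "pre (n + m) x = pre (n + m) a" unfolding pre_eq_iff using S1.apxD(2)[OF assms(1)] by blast
  then have "pre n (h x) = pre n (h a)" by (rule h_prefix[OF x assms(2)])
  then have 1: "\<forall>i<n. h x i = h a i" unfolding pre_eq_iff .
  have "S2.psync j ((shift ^^ i) (h x)) \<and>
      S2.cls j ((shift ^^ i) (h x)) = vmap (pre m ((shift ^^ i) a)) j (v i j)" if "i \<le> n" "j \<le> n" for i j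
  proof -
    have p: "S1.psync j ((shift ^^ i) x)" "S1.cls j ((shift ^^ i) x) = v i j"
      using S1.apxD(3,4)[OF assms(1)] that by auto
    have "pre m ((shift ^^ i) x) = pre m ((shift ^^ i) a)"
      unfolding pre_eq_iff shift_funpow using S1.apxD(2)[OF assms(1)] that by auto
    then show ?thesis using psync_h[OF p(1)] vmap[OF p(1)] p(2) unfolding h_shift_pow[OF x] by simp
  qed
  then show ?thesis unfolding S2.apx_def using 1 h_X[OF x] by blast
qed

lemma path_h:
  assumes "S1.path v a" shows "S2.path (\<lambda>i l. vmap (pre m ((shift ^^ i) a)) l (v i l)) (h a)"
  by (rule S2.pathI) (use approx_h S1.path_approx[OF assms] S1.path_X[OF assms] in blast)

lemma lift_path: "lift (\<lambda>i. (a i, v (Suc i))) = (\<lambda>i. (h a i, \<lambda>l. vmap (pre m ((shift ^^ Suc i) a)) l (v (Suc i) l)))"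
  unfolding lift_def labels_def by simp

lemma lift_X: assumes "x \<in> X_set L1" shows "lift x \<in> X_set L2"
proof -
  obtain v a where va: "S1.path v a" "x = (\<lambda>i. (a i, v (Suc i)))" using assms unfolding S1.X_set_iff by blast
  show ?thesis unfolding va(2) lift_path S2.X_set_iff using path_h[OF va(1)] by blast
qed

lemma labels_lift: "labels (lift x) = h (labels x)"
  unfolding lift_def labels_def by simp

lemma lift_shift:
  assumes "x \<in> X_set L1" shows "lift (shift x) = shift (lift x)"
proof
  fix i
  have l: "labels x \<in> S1.X" using S1.labels_X[OF assms] .
  have "h (shift (labels x)) i = h (labels x) (Suc i)" unfolding h_shift[OF l] by (simp add: shift_def)
  moreover have "(shift ^^ Suc i) (shift (labels x)) = (shift ^^ Suc (Suc i)) (labels x)"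
    by (simp only: funpow_Suc_right o_apply)
  moreover have "shift (lift x) i = lift x (Suc i)" "shift x i = x (Suc i)" by (simp_all add: shift_def)
  ultimately show "lift (shift x) i = shift (lift x) i"
    unfolding lift_def S1.labels_shift by (simp only:)
qed

text \<open>Each vertex is realized at its position and level by an approximating point
  \<open>x'\<close>. Then \<open>h x'\<close> realizes the lifted vertex, and \<open>g\<close> leads
  back to \<open>x'\<close>.\<close>

lemma lift_inverse:
  assumes "x \<in> X_set L1" shows "conjugacy.lift L2 L1 g m (lift x) = x"
proof -
  interpret C: conjugacy N2 L2 N1 L1 g h m by (rule flip)
  obtain v a where va: "S1.path v a" "x = (\<lambda>i. (a i, v (Suc i)))" using assms unfolding S1.X_set_iff by blast
  have a: "a \<in> S1.X" using S1.path_X[OF va(1)] .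
  let ?w = "\<lambda>i l. vmap (pre m ((shift ^^ i) a)) l (v i l)"
  have "C.vmap (pre m ((shift ^^ i) (h a))) l (?w i l) = v i l" for i l
  proof -
    \<comment> \<open>Large enough for position \<open>i\<close>, level \<open>l\<close> and the
      \<open>m\<close> letters read from position \<open>i\<close> on.\<close>
    define n where "n = i + l + m"
    obtain x' where x': "S1.apx (n + m) n v a x'" using S1.path_approx[OF va(1)] by blast
    note y = approx_h[OF x' a]
    have il: "i \<le> n" "l \<le> n" "i \<le> n + m" unfolding n_def by auto
    let ?y = "(shift ^^ i) (h x')"
    have p: "S2.psync l ?y" "S2.cls l ?y = ?w i l" using S2.apxD(3,4)[OF y il(1,2)] by auto
    have q: "pre m ?y = pre m ((shift ^^ i) (h a))"
      unfolding pre_eq_iff shift_funpow using S2.apxD(2)[OF y] unfolding n_def by auto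
    have x'X: "x' \<in> S1.X" using S1.apxD(1)[OF x'] .
    have "g ?y = (shift ^^ i) x'" unfolding h_shift_pow[OF x'X, symmetric] by (rule gh[OF S1.shift_pow_X[OF x'X]])
    then show ?thesis using C.vmap[OF p(1)] unfolding q p(2) using S1.apxD(4)[OF x' il(3,2)] by simp
  qed
  then show ?thesis unfolding va(2) lift_path C.lift_path[of "h a" ?w] gh[OF a] by (simp only:)
qed

lemma lift_continuous: "continuous_map (X_top L1) (X_top L2) lift"
proof (rule S2.continuous_into_Y)
  show "lift z \<in> X_set L2" if "z \<in> topspace (X_top L1)" for z using that lift_X by simp
  have lab: "locally_constant (X_top L1) (\<lambda>z. pre n ((shift ^^ i) (labels z)))" for n i
    by (rule locally_constant_list) (simp add: shift_funpow labels_def S1.label_locally_constant)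
  show "locally_constant (X_top L1) (\<lambda>z. snd (lift z i) l)" for i l
  proof -
    have "locally_constant (X_top L1) (\<lambda>z. (pre m ((shift ^^ Suc i) (labels z)), snd (z i) l))"
      by (intro locally_constant_pair lab S1.vertex_locally_constant)
    from locally_constant_comp[OF this, of "\<lambda>(w, c). vmap w l c"] show ?thesis unfolding lift_def by simp
  qed
  show "locally_constant (X_top L1) (\<lambda>z. fst (lift z i))" for i
  proof -
    \<comment> \<open>The code as a function of words: some point with the given prefix is chosen,
      and by \<open>h_prefix\<close> the choice does not matter.\<close>
    let ?s = "\<lambda>w. h (SOME y. y \<in> S1.X \<and> pre (Suc i + m) y = w) i"
    have "h y i = ?s (pre (Suc i + m) y)" if y: "y \<in> S1.X" for y
    proof -
      have "\<exists>y'. y' \<in> S1.X \<and> pre (Suc i + m) y' = pre (Suc i + m) y" using y by blast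
      from someI_ex[OF this] have "pre (Suc i) (h (SOME y'. y' \<in> S1.X \<and> pre (Suc i + m) y' = pre (Suc i + m) y)) = pre (Suc i) (h y)"
        by (intro h_prefix y) auto
      then have "h (SOME y'. y' \<in> S1.X \<and> pre (Suc i + m) y' = pre (Suc i + m) y) i = h y i"
        unfolding pre_eq_iff[of "Suc i" "h _"] by blast
      then show ?thesis by (rule sym)
    qed
    then have eq: "fst (lift z i) = ?s (pre (Suc i + m) ((shift ^^ 0) (labels z)))" if "z \<in> topspace (X_top L1)" for z
      unfolding lift_def using S1.labels_X that by simp
    have "locally_constant (X_top L1) (\<lambda>z. ?s (pre (Suc i + m) ((shift ^^ 0) (labels z))))"
      by (rule locally_constant_comp[OF lab])
    then show ?thesis using eq by (rule locally_constant_cong)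
  qed
qed

end

section \<open>Transport along a conjugacy of local homeomorphisms\<close>

locale dr_conjugacy = D1: dr_system X s + D2: dr_system Y r
  for X :: "'x topology" and s :: "'x \<Rightarrow> 'x" and Y :: "'y topology" and r :: "'y \<Rightarrow> 'y" +
  fixes k :: "'x \<Rightarrow> 'y" and k' :: "'y \<Rightarrow> 'x"
  assumes k_cont: "continuous_map X Y k" and k'_cont: "continuous_map Y X k'"
    and k'k: "\<And>x. x \<in> topspace X \<Longrightarrow> k' (k x) = x" and kk': "\<And>y. y \<in> topspace Y \<Longrightarrow> k (k' y) = y"
    and ks: "\<And>x. x \<in> topspace X \<Longrightarrow> k (s x) = r (k x)"
begin

lemma k_T: "x \<in> topspace X \<Longrightarrow> k x \<in> topspace Y"
  using k_cont continuous_map_image_subset_topspace by blast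

lemma k'_T: "y \<in> topspace Y \<Longrightarrow> k' y \<in> topspace X"
  using k'_cont continuous_map_image_subset_topspace by blast

lemma k's: "y \<in> topspace Y \<Longrightarrow> k' (r y) = s (k' y)"
  using ks[OF k'_T] kk' k'k[OF D1.pow_topspace[OF k'_T, of y 1]] by simp

lemma flip: "dr_conjugacy Y r X s k' k"
  by unfold_locales (use k_cont k'_cont k'k kk' k's in auto)

lemma k_pow: "x \<in> topspace X \<Longrightarrow> k ((s ^^ n) x) = (r ^^ n) (k x)"
  by (induction n) (simp_all add: ks D1.pow_topspace)

section \<open>Transport of arrows and vectors\<close>

definition K :: "'x arrow \<Rightarrow> 'y arrow" where "K = (\<lambda>(x, n, z). (k x, n, k z))"

abbreviation "K' \<equiv> dr_conjugacy.K k'"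

lemma K_A: assumes "\<gamma> \<in> arrows X s" shows "K \<gamma> \<in> arrows Y r" "K' (K \<gamma>) = \<gamma>"
proof -
  interpret F: dr_conjugacy Y r X s k' k by (rule flip)
  obtain x n z where g: "\<gamma> = (x, n, z)" by (metis prod.collapse)
  then have "(x, n, z) \<in> arrows X s" using assms by simp
  then obtain p q where pq: "x \<in> topspace X" "z \<in> topspace X" "n = int p - int q" "(s ^^ p) x = (s ^^ q) z" by (rule D1.arrowsE)
  show "K \<gamma> \<in> arrows Y r" unfolding g K_def using pq k_T k_pow by (simp, metis D2.arrowsI)
  show "K' (K \<gamma>) = \<gamma>" unfolding g K_def F.K_def using pq k'k by simp
qed

lemma K_cont: "continuous_map (arrow_top X s) (arrow_top Y r) K"
proof (rule D2.continuous_into_G)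
  show "K z \<in> arrows Y r" if "z \<in> topspace (arrow_top X s)" for z using that K_A by simp
  fix U p q V assume o: "openin Y U" "openin Y V"
  let ?U = "{x \<in> topspace X. k x \<in> U}" and ?V = "{x \<in> topspace X. k x \<in> V}"
  have "{z \<in> topspace (arrow_top X s). K z \<in> basic_set Y r U p q V} = basic_set X s ?U p q ?V"
  proof (intro equalityI subsetI)
    fix \<gamma> assume "\<gamma> \<in> {z \<in> topspace (arrow_top X s). K z \<in> basic_set Y r U p q V}"
    then have g: "\<gamma> \<in> arrows X s" "K \<gamma> \<in> basic_set Y r U p q V" by auto
    obtain x n z where xz: "\<gamma> = (x, n, z)" by (metis prod.collapse)
    have T: "x \<in> topspace X" "z \<in> topspace X" using D1.arrow_topspace[OF g(1)] xz by auto
    have b: "n = int p - int q" "k x \<in> U" "k z \<in> V" "(r ^^ p) (k x) = (r ^^ q) (k z)"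
      using g(2) unfolding xz K_def by (auto simp: D2.in_basic_set)
    then have "k ((s ^^ p) x) = k ((s ^^ q) z)" using k_pow T by simp
    then have "(s ^^ p) x = (s ^^ q) z" using k'k D1.pow_topspace T by metis
    then show "\<gamma> \<in> basic_set X s ?U p q ?V" unfolding xz D1.in_basic_set using b T by simp
  next
    fix \<gamma> assume g: "\<gamma> \<in> basic_set X s ?U p q ?V"
    obtain x n z where xz: "\<gamma> = (x, n, z)" by (metis prod.collapse)
    have b: "n = int p - int q" "x \<in> topspace X" "k x \<in> U" "z \<in> topspace X" "k z \<in> V" "(s ^^ p) x = (s ^^ q) z"
      using g unfolding xz D1.in_basic_set by auto
    have "(r ^^ p) (k x) = (r ^^ q) (k z)" using k_pow b by metis
    then show "\<gamma> \<in> {z \<in> topspace (arrow_top X s). K z \<in> basic_set Y r U p q V}"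
      using b D1.arrowsI[OF b(2,4,6,1)] unfolding xz K_def by (simp add: D2.in_basic_set)
  qed
  also have "openin (arrow_top X s) ..."
    by (rule D1.basic_open; rule openin_continuous_map_preimage[OF k_cont]; rule o)
  finally show "openin (arrow_top X s) {z \<in> topspace (arrow_top X s). K z \<in> basic_set Y r U p q V}" .
qed

text \<open>A unitary between the two modules, over the homeomorphism of the unit spaces; see
  \<open>inner_W\<close>.\<close>

definition W :: "'x vec \<Rightarrow> 'y vec" where
  "W \<xi> = (\<lambda>\<gamma>. if \<gamma> \<in> arrows Y r then \<xi> (K' \<gamma>) else 0)"

lemma W_diff: "W (\<lambda>\<gamma>. \<xi> \<gamma> - \<eta> \<gamma>) = (\<lambda>\<gamma>. W \<xi> \<gamma> - W \<eta> \<gamma>)"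
  unfolding W_def by auto

lemma W_zero: "W (\<lambda>_. 0) = (\<lambda>_. 0)"
  unfolding W_def by auto

lemma K_surj: "\<gamma> \<in> arrows Y r \<Longrightarrow> K' \<gamma> \<in> arrows X s \<and> K (K' \<gamma>) = \<gamma>"
proof -
  interpret F: dr_conjugacy Y r X s k' k by (rule flip)
  show "\<gamma> \<in> arrows Y r \<Longrightarrow> K' \<gamma> \<in> arrows X s \<and> K (K' \<gamma>) = \<gamma>" using F.K_A by blast
qed

lemma K'_eq: "K' \<gamma> = (k' (fst \<gamma>), fst (snd \<gamma>), k' (snd (snd \<gamma>)))"
proof -
  interpret F: dr_conjugacy Y r X s k' k by (rule flip)
  show ?thesis unfolding F.K_def by (simp add: case_prod_beta)
qed

lemma W_K: "\<gamma> \<in> arrows X s \<Longrightarrow> W \<xi> (K \<gamma>) = \<xi> \<gamma>"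
  unfolding W_def using K_A by simp

lemma W_Cc: assumes f: "f \<in> Cc X s" shows "W f \<in> Cc Y r"
proof (rule D2.CcI)
  interpret F: dr_conjugacy Y r X s k' k by (rule flip)
  have "continuous_map (arrow_top Y r) euclidean (f \<circ> K')"
    by (rule continuous_map_compose[OF F.K_cont D1.CcD(2)[OF f]])
  then show "continuous_map (arrow_top Y r) euclidean (W f)"
    by (rule continuous_map_eq) (simp add: W_def)
  show "compactin (arrow_top Y r) (K ` (arrow_top X s closure_of {\<gamma>. f \<gamma> \<noteq> 0}))"
    by (rule image_compactin[OF D1.CcD(3)[OF f] K_cont])
  show "{\<gamma>. W f \<gamma> \<noteq> 0} \<subseteq> K ` (arrow_top X s closure_of {\<gamma>. f \<gamma> \<noteq> 0})"
  proof
    fix \<gamma> assume "\<gamma> \<in> {\<gamma>. W f \<gamma> \<noteq> 0}"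
    then have g: "\<gamma> \<in> arrows Y r" "f (K' \<gamma>) \<noteq> 0" unfolding W_def by (auto split: if_splits)
    then have "K' \<gamma> \<in> arrow_top X s closure_of {\<gamma>. f \<gamma> \<noteq> 0}" using D1.CcD(4)[OF f] by blast
    then have "K (K' \<gamma>) \<in> K ` (arrow_top X s closure_of {\<gamma>. f \<gamma> \<noteq> 0})" by (rule imageI)
    then show "\<gamma> \<in> K ` (arrow_top X s closure_of {\<gamma>. f \<gamma> \<noteq> 0})" using K_surj[OF g(1)] by simp
  qed
qed (simp add: W_def)

lemma fibre_bij:
  assumes "w \<in> topspace Y" shows "bij_betw K' (source_fibre Y r w) (source_fibre X s (k' w))"
proof (rule bij_betw_byWitness[where f' = K])
  show "\<forall>a\<in>source_fibre Y r w. K (K' a) = a" using K_surj by (simp add: source_fibre_def)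
  show "\<forall>a\<in>source_fibre X s (k' w). K' (K a) = a" using K_A by (simp add: source_fibre_def)
  show "K' ` source_fibre Y r w \<subseteq> source_fibre X s (k' w)" using K_surj by (auto simp: source_fibre_def K'_eq)
  show "K ` source_fibre X s (k' w) \<subseteq> source_fibre Y r w"
    using K_A(1) kk'[OF assms] by (auto simp: source_fibre_def K_def)
qed

lemma norm_W: assumes "module_norm_le X s \<xi> c" shows "module_norm_le Y r (W \<xi>) c"
proof -
  have "(\<lambda>\<gamma>. (cmod (W \<xi> \<gamma>))\<^sup>2) summable_on source_fibre Y r w \<and>
    (\<Sum>\<^sub>\<infinity>\<gamma>\<in>source_fibre Y r w. (cmod (W \<xi> \<gamma>))\<^sup>2) \<le> c\<^sup>2" if w: "w \<in> topspace Y" for w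
  proof -
    have e: "(cmod (W \<xi> \<gamma>))\<^sup>2 = (cmod (\<xi> (K' \<gamma>)))\<^sup>2" if "\<gamma> \<in> source_fibre Y r w" for \<gamma>
      using that unfolding W_def source_fibre_def by simp
    note b = fibre_bij[OF w]
    have 1: "(\<lambda>\<gamma>. (cmod (W \<xi> \<gamma>))\<^sup>2) summable_on source_fibre Y r w \<longleftrightarrow>
        (\<lambda>\<gamma>. (cmod (\<xi> \<gamma>))\<^sup>2) summable_on source_fibre X s (k' w)"
      using summable_on_reindex_bij_betw[OF b, of "\<lambda>\<gamma>. (cmod (\<xi> \<gamma>))\<^sup>2"] e by (simp cong: summable_on_cong)
    have 2: "(\<Sum>\<^sub>\<infinity>\<gamma>\<in>source_fibre Y r w. (cmod (W \<xi> \<gamma>))\<^sup>2) = (\<Sum>\<^sub>\<infinity>\<gamma>\<in>source_fibre X s (k' w). (cmod (\<xi> \<gamma>))\<^sup>2)"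
      using infsum_reindex_bij_betw[OF b, of "\<lambda>\<gamma>. (cmod (\<xi> \<gamma>))\<^sup>2"] e by (simp cong: infsum_cong)
    show ?thesis unfolding 1 2 using D1.norm_leD(2,3)[OF assms k'_T[OF w]] by blast
  qed
  then show ?thesis unfolding module_norm_le_def using D1.norm_leD(1)[OF assms] by blast
qed

lemma inner_W:
  assumes w: "w \<in> topspace Y" shows "module_inner Y r (W \<xi>) (W \<eta>) w = module_inner X s \<xi> \<eta> (k' w)"
proof -
  have "(\<Sum>\<^sub>\<infinity>\<gamma>\<in>source_fibre Y r w. cnj (W \<xi> \<gamma>) * W \<eta> \<gamma>) = (\<Sum>\<^sub>\<infinity>\<gamma>\<in>source_fibre Y r w. cnj (\<xi> (K' \<gamma>)) * \<eta> (K' \<gamma>))"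
    by (rule infsum_cong) (simp add: W_def source_fibre_def)
  then show ?thesis unfolding module_inner_def
    using infsum_reindex_bij_betw[OF fibre_bij[OF w], of "\<lambda>\<gamma>. cnj (\<xi> \<gamma>) * \<eta> \<gamma>"] by simp
qed

lemma W_l2: assumes "\<xi> \<in> l2 X s" shows "W \<xi> \<in> l2 Y r"
proof -
  have "\<exists>f\<in>Cc Y r. module_norm_le Y r (\<lambda>\<gamma>. W \<xi> \<gamma> - f \<gamma>) \<epsilon>" if \<epsilon>: "\<epsilon> > 0" for \<epsilon>
  proof -
    obtain f where f: "f \<in> Cc X s" "module_norm_le X s (\<lambda>\<gamma>. \<xi> \<gamma> - f \<gamma>) \<epsilon>" using D1.l2D(2)[OF assms \<epsilon>] by blast
    show ?thesis using norm_W[OF f(2)] W_Cc[OF f(1)] unfolding W_diff by blast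
  qed
  then show ?thesis unfolding l2_def by (simp add: W_def)
qed

section \<open>Transport of operators by conjugation with the unitary\<close>

definition \<Psi> :: "'x oper \<Rightarrow> 'y oper" where
  "\<Psi> T = (\<lambda>\<eta>. if \<eta> \<in> l2 Y r then W (T (dr_conjugacy.W X s k \<eta>)) else (\<lambda>_. 0))"

context
begin

interpretation F: dr_conjugacy Y r X s k' k by (rule flip)

lemma WW: "\<eta> \<in> l2 Y r \<Longrightarrow> W (F.W \<eta>) = \<eta>"
  unfolding W_def F.W_def using K_surj D2.l2D(1) by (auto simp: fun_eq_iff)

end

context
begin

interpretation F: dr_conjugacy Y r X s k' k by (rule flip)

lemma \<Psi>_apply: "\<eta> \<in> l2 Y r \<Longrightarrow> \<Psi> T \<eta> = W (T (F.W \<eta>))"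
  unfolding \<Psi>_def by simp

lemma \<Psi>_operator: "T \<in> operators X s \<Longrightarrow> \<Psi> T \<in> operators Y r"
  unfolding operators_def \<Psi>_def using W_l2 F.W_l2 by auto

lemma \<Psi>_adjoint:
  assumes "T \<in> operators X s" "S \<in> operators X s" "is_adjoint X s T S" shows "is_adjoint Y r (\<Psi> T) (\<Psi> S)"
  unfolding is_adjoint_def
proof (intro ballI)
  fix \<xi> \<eta> w assume l: "\<xi> \<in> l2 Y r" "\<eta> \<in> l2 Y r" and w: "w \<in> topspace Y"
  have "module_inner Y r (\<Psi> T \<xi>) \<eta> w = module_inner Y r (W (T (F.W \<xi>))) (W (F.W \<eta>)) w"
    unfolding \<Psi>_apply[OF l(1)] WW[OF l(2)] ..
  also have "... = module_inner X s (T (F.W \<xi>)) (F.W \<eta>) (k' w)" by (rule inner_W[OF w])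
  also have "... = module_inner X s (F.W \<xi>) (S (F.W \<eta>)) (k' w)"
    using assms(3) F.W_l2[OF l(1)] F.W_l2[OF l(2)] k'_T[OF w] unfolding is_adjoint_def by blast
  also have "... = module_inner Y r (W (F.W \<xi>)) (W (S (F.W \<eta>))) w" by (rule inner_W[OF w, symmetric])
  also have "... = module_inner Y r \<xi> (\<Psi> S \<eta>) w" unfolding \<Psi>_apply[OF l(2)] WW[OF l(1)] ..
  finally show "module_inner Y r (\<Psi> T \<xi>) \<eta> w = module_inner Y r \<xi> (\<Psi> S \<eta>) w" .
qed

lemma \<Psi>_norm: assumes "op_norm_le X s T c" shows "op_norm_le Y r (\<Psi> T) c"
  unfolding op_norm_le_def
proof (intro ballI allI impI)
  fix \<xi> d assume l: "\<xi> \<in> l2 Y r" and n: "module_norm_le Y r \<xi> d"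
  have "module_norm_le X s (T (F.W \<xi>)) (c * d)"
    using assms F.W_l2[OF l] F.norm_W[OF n] unfolding op_norm_le_def by blast
  then show "module_norm_le Y r (\<Psi> T \<xi>) (c * d)" unfolding \<Psi>_apply[OF l] by (rule norm_W)
qed

lemma \<Psi>_diff: "op_diff (\<Psi> S) (\<Psi> T) = \<Psi> (op_diff S T)"
  unfolding op_diff_def \<Psi>_def by (auto simp: fun_eq_iff W_def)

lemma \<Psi>_add: "\<Psi> (op_add S T) = op_add (\<Psi> S) (\<Psi> T)"
  unfolding op_add_def \<Psi>_def by (auto simp: fun_eq_iff W_def)

lemma \<Psi>_scale: "\<Psi> (op_scale c T) = op_scale c (\<Psi> T)"
  unfolding op_scale_def \<Psi>_def by (auto simp: fun_eq_iff W_def)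

lemma \<Psi>_comp:
  assumes "T \<in> operators X s" "S (\<lambda>_. 0) = (\<lambda>_. 0)" shows "\<Psi> (S \<circ> T) = \<Psi> S \<circ> \<Psi> T"
proof
  fix \<eta> show "\<Psi> (S \<circ> T) \<eta> = (\<Psi> S \<circ> \<Psi> T) \<eta>"
  proof (cases "\<eta> \<in> l2 Y r")
    case True
    have l: "T (F.W \<eta>) \<in> l2 X s" using D1.operator_l2[OF assms(1) F.W_l2[OF True]] .
    have "\<Psi> T \<eta> \<in> l2 Y r" using D2.operator_l2[OF \<Psi>_operator[OF assms(1)] True] .
    then show ?thesis unfolding o_apply \<Psi>_apply[OF True] using \<Psi>_apply F.WW[OF l] by simp
  next
    case False
    then have "\<Psi> T \<eta> = (\<lambda>_. 0)" "\<Psi> (S \<circ> T) \<eta> = (\<lambda>_. 0)" unfolding \<Psi>_def by auto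
    moreover have "\<Psi> S (\<lambda>_. 0) = (\<lambda>_. 0)" unfolding \<Psi>_def using assms(2) W_zero F.W_zero by simp
    ultimately show ?thesis by simp
  qed
qed

text \<open>\<open>K\<close> is an isomorphism of groupoids, so it matches the factorizations of an
  arrow with those of its image.\<close>

lemma \<Psi>_conv: "\<Psi> (conv_op X s f) = conv_op Y r (W f)"
proof
  fix \<eta> show "\<Psi> (conv_op X s f) \<eta> = conv_op Y r (W f) \<eta>"
  proof (cases "\<eta> \<in> l2 Y r")
    case True
    have "W (conv_op X s f (F.W \<eta>)) \<gamma> = conv_op Y r (W f) \<eta> \<gamma>" for \<gamma>
    proof (cases "\<gamma> \<in> arrows Y r")
      case False
      then show ?thesis unfolding D2.conv_apply[OF True] D2.factorizations_empty[OF False] by (simp add: W_def)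
    next
      case g: True
      let ?j = "\<lambda>(\<beta>, \<delta>). (K' \<beta>, K' \<delta>)"
      have "bij_betw ?j (factorizations Y r \<gamma>) (factorizations X s (K' \<gamma>))"
      proof (rule bij_betw_byWitness[where f' = "\<lambda>(\<beta>, \<delta>). (K \<beta>, K \<delta>)"])
        show "\<forall>a\<in>factorizations Y r \<gamma>. (\<lambda>(\<beta>, \<delta>). (K \<beta>, K \<delta>)) (?j a) = a"
          using K_surj by (auto elim!: D2.factorization_cases)
        show "\<forall>a\<in>factorizations X s (K' \<gamma>). ?j ((\<lambda>(\<beta>, \<delta>). (K \<beta>, K \<delta>)) a) = a"
          using K_A by (auto elim!: D1.factorization_cases)
        show "?j ` factorizations Y r \<gamma> \<subseteq> factorizations X s (K' \<gamma>)"
        proof (rule image_subsetI)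
          fix a assume "a \<in> factorizations Y r \<gamma>"
          then obtain x n z m w where a: "a = ((x, n, z), (z, m, w))" "(x, n, z) \<in> arrows Y r" "(z, m, w) \<in> arrows Y r"
            "\<gamma> = (x, n + m, w)" by (rule D2.factorization_cases)
          show "?j a \<in> factorizations X s (K' \<gamma>)"
            using K_surj[OF a(2)] K_surj[OF a(3)] unfolding a(1,4) factorizations_def K'_eq by auto
        qed
        show "(\<lambda>(\<beta>, \<delta>). (K \<beta>, K \<delta>)) ` factorizations X s (K' \<gamma>) \<subseteq> factorizations Y r \<gamma>"
        proof (rule image_subsetI)
          fix a assume "a \<in> factorizations X s (K' \<gamma>)"
          then obtain x n z m w where a: "a = ((x, n, z), (z, m, w))" "(x, n, z) \<in> arrows X s" "(z, m, w) \<in> arrows X s"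
            "K' \<gamma> = (x, n + m, w)" by (rule D1.factorization_cases)
          have "\<gamma> = (k x, n + m, k w)" using K_surj[OF g] unfolding a(4) K_def by simp
          then show "(\<lambda>(\<beta>, \<delta>). (K \<beta>, K \<delta>)) a \<in> factorizations Y r \<gamma>"
            using K_A(1)[OF a(2)] K_A(1)[OF a(3)] unfolding a(1) factorizations_def K_def by auto
        qed
      qed
      from infsum_reindex_bij_betw[OF this, of "\<lambda>(\<beta>, \<delta>). f \<beta> * F.W \<eta> \<delta>"]
      have "conv_op X s f (F.W \<eta>) (K' \<gamma>) = (\<Sum>\<^sub>\<infinity>a\<in>factorizations Y r \<gamma>. (\<lambda>(\<beta>, \<delta>). f \<beta> * F.W \<eta> \<delta>) (?j a))"
        unfolding D1.conv_apply[OF F.W_l2[OF True]] by simp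
      also have "... = (\<Sum>\<^sub>\<infinity>(\<beta>, \<delta>)\<in>factorizations Y r \<gamma>. W f \<beta> * \<eta> \<delta>)"
      proof (rule infsum_cong)
        fix a assume "a \<in> factorizations Y r \<gamma>"
        then obtain x n z m w where a: "a = ((x, n, z), (z, m, w))" "(x, n, z) \<in> arrows Y r" "(z, m, w) \<in> arrows Y r"
            by (rule D2.factorization_cases)
        have "F.W \<eta> (K' (z, m, w)) = \<eta> (z, m, w)" using F.W_K[OF a(3)] .
        moreover have "W f (x, n, z) = f (K' (x, n, z))" using a(2) by (simp add: W_def)
        ultimately show "(\<lambda>(\<beta>, \<delta>). f \<beta> * F.W \<eta> \<delta>) (?j a) = (case a of (\<beta>, \<delta>) \<Rightarrow> W f \<beta> * \<eta> \<delta>)"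
          unfolding a(1) by simp
      qed
      finally show ?thesis unfolding D2.conv_apply[OF True] using g by (simp add: W_def)
    qed
    then show ?thesis unfolding \<Psi>_apply[OF True] by auto
  next
    case False then show ?thesis unfolding \<Psi>_def conv_op_def restrict_op_def by simp
  qed
qed

lemma \<Psi>_reduced: assumes T: "T \<in> reduced_cstar X s" shows "\<Psi> T \<in> reduced_cstar Y r"
proof -
  obtain S where S: "S \<in> operators X s" "is_adjoint X s T S" using D1.reducedD(1)[OF T] unfolding adjointables_def by blast
  note To = D1.reducedD(2)[OF T]
  have "\<Psi> T \<in> adjointables Y r" unfolding adjointables_def
    using \<Psi>_operator[OF To] \<Psi>_operator[OF S(1)] \<Psi>_adjoint[OF To S] by blast
  moreover have "\<exists>f\<in>Cc Y r. op_norm_le Y r (op_diff (\<Psi> T) (conv_op Y r f)) \<epsilon>" if \<epsilon>: "\<epsilon> > 0" for \<epsilon>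
  proof -
    obtain f where f: "f \<in> Cc X s" "op_norm_le X s (op_diff T (conv_op X s f)) \<epsilon>" using D1.reducedD(3)[OF T \<epsilon>] by blast
    show ?thesis using \<Psi>_norm[OF f(2)] W_Cc[OF f(1)] unfolding \<Psi>_diff[symmetric] \<Psi>_conv by blast
  qed
  ultimately show ?thesis unfolding reduced_cstar_def by blast
qed

end

context
begin

interpretation F: dr_conjugacy Y r X s k' k by (rule flip)

lemma \<Psi>_inverse: assumes "T \<in> operators X s" shows "F.\<Psi> (\<Psi> T) = T"
proof (rule D1.operator_ext[OF F.\<Psi>_operator[OF \<Psi>_operator[OF assms]] assms])
  fix \<xi> assume l: "\<xi> \<in> l2 X s"
  have "F.\<Psi> (\<Psi> T) \<xi> = F.W (\<Psi> T (W \<xi>))" unfolding F.\<Psi>_def using l by simp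
  also have "... = T \<xi>" unfolding \<Psi>_apply[OF W_l2[OF l]] F.WW[OF l] by (rule F.WW[OF D1.operator_l2[OF assms l]])
  finally show "F.\<Psi> (\<Psi> T) \<xi> = T \<xi>" .
qed

end

text \<open>The zero vector is \<open>e0\<close> multiplied by the zero function, and adjointable
  maps are module maps. This provides the side condition of \<open>\<Psi>_comp\<close>.\<close>

lemma adjointable_zero: assumes "T \<in> adjointables X s" shows "T (\<lambda>_. 0) = (\<lambda>_. 0)"
proof -
  have "D1.rmul (\<lambda>_. 0) \<xi> = (\<lambda>_. 0)" for \<xi> unfolding D1.rmul_def D1.wfun_def by auto
  then show ?thesis using D1.module_linear[OF assms, of "\<lambda>_. 0" D1.e0] D1.e0_l2 by simp
qed

theorem \<Psi>_isomorphism: "cstar_isomorphism X s Y r \<Psi>"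
proof -
  interpret F: dr_conjugacy Y r X s k' k by (rule flip)
  have "bij_betw \<Psi> (reduced_cstar X s) (reduced_cstar Y r)"
    by (rule bij_betw_byWitness[where f' = F.\<Psi>])
       (use \<Psi>_inverse F.\<Psi>_inverse \<Psi>_reduced F.\<Psi>_reduced D1.reducedD(2) D2.reducedD(2) in auto)
  moreover have "\<Psi> (S \<circ> T) = \<Psi> S \<circ> \<Psi> T" if "S \<in> reduced_cstar X s" "T \<in> reduced_cstar X s" for S T
    using \<Psi>_comp[where S = S and T = T, OF D1.reducedD(2)[OF that(2)] adjointable_zero[OF D1.reducedD(1)[OF that(1)]]] .
  moreover have "\<Psi> (op_star X s T) = op_star Y r (\<Psi> T)" if T: "T \<in> reduced_cstar X s" for T
  proof -
    obtain S where S: "S \<in> operators X s" "is_adjoint X s T S" using D1.reducedD(1)[OF T] unfolding adjointables_def by blast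
    show ?thesis using D1.op_star_eqI[OF S] D2.op_star_eqI[OF \<Psi>_operator[OF S(1)] \<Psi>_adjoint[OF D1.reducedD(2)[OF T] S]] by simp
  qed
  ultimately show ?thesis unfolding cstar_isomorphism_def using \<Psi>_add \<Psi>_scale by blast
qed

text \<open>The common form of diagonal operators and gauge unitaries, multiplication by a function
  on arrows.\<close>

lemma \<Psi>_multiplication:
  assumes "\<And>\<gamma>. \<gamma> \<in> arrows X s \<Longrightarrow> d (K \<gamma>) = c \<gamma>"
  shows "\<Psi> (restrict_op X s (\<lambda>\<xi> \<gamma>. c \<gamma> * \<xi> \<gamma>)) = restrict_op Y r (\<lambda>\<xi> \<gamma>. d \<gamma> * \<xi> \<gamma>)"
proof
  interpret F: dr_conjugacy Y r X s k' k by (rule flip)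
  fix \<eta> show "\<Psi> (restrict_op X s (\<lambda>\<xi> \<gamma>. c \<gamma> * \<xi> \<gamma>)) \<eta> = restrict_op Y r (\<lambda>\<xi> \<gamma>. d \<gamma> * \<xi> \<gamma>) \<eta>"
  proof (cases "\<eta> \<in> l2 Y r")
    case True
    have "W (\<lambda>\<gamma>. c \<gamma> * F.W \<eta> \<gamma>) \<gamma> = d \<gamma> * \<eta> \<gamma>" for \<gamma>
    proof (cases "\<gamma> \<in> arrows Y r")
      case g: True
      have "c (K' \<gamma>) = d \<gamma>" using assms[of "K' \<gamma>"] K_surj[OF g] by simp
      then show ?thesis using g F.W_K[OF g] by (simp add: W_def)
    qed (use D2.l2D(1)[OF True] in \<open>simp add: W_def\<close>)
    then show ?thesis using True F.W_l2[OF True] unfolding \<Psi>_apply[OF True] restrict_op_def by auto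
  qed (simp add: \<Psi>_def restrict_op_def)
qed

lemma \<Psi>_diag: assumes "\<And>x. x \<in> topspace X \<Longrightarrow> \<psi> (k x) = \<phi> x" shows "\<Psi> (D1.diag \<phi>) = D2.diag \<psi>"
proof -
  have 1: "D1.diag \<phi> = restrict_op X s (\<lambda>\<xi> \<gamma>. \<phi> (fst \<gamma>) * \<xi> \<gamma>)"
    unfolding D1.diag_wop D1.wop_def D1.wfun_def restrict_op_def using D1.l2D(1) by (auto simp: fun_eq_iff)
  have 2: "D2.diag \<psi> = restrict_op Y r (\<lambda>\<xi> \<gamma>. \<psi> (fst \<gamma>) * \<xi> \<gamma>)"
    unfolding D2.diag_wop D2.wop_def D2.wfun_def restrict_op_def using D2.l2D(1) by (auto simp: fun_eq_iff)
  have "\<psi> (fst (K \<gamma>)) = \<phi> (fst \<gamma>)" if "\<gamma> \<in> arrows X s" for \<gamma>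
    using assms[OF D1.arrow_topspace(1)[OF that]] unfolding K_def by (simp add: case_prod_beta)
  then show ?thesis unfolding 1 2 by (rule \<Psi>_multiplication)
qed

lemma \<Psi>_gauge:
  assumes F: "\<And>x. x \<in> topspace X \<Longrightarrow> F' (k x) = F x"
  shows "\<Psi> (gauge_unitary X s F t) = gauge_unitary Y r F' t"
  unfolding gauge_unitary_def
proof (rule \<Psi>_multiplication)
  fix \<gamma> assume g: "\<gamma> \<in> arrows X s"
  obtain x n z where xz: "\<gamma> = (x, n, z)" by (metis prod.collapse)
  then obtain p q where pq: "x \<in> topspace X" "z \<in> topspace X" "n = int p - int q" "(s ^^ p) x = (s ^^ q) z"
    using g D1.arrowsE by metis
  have b: "D2.bsum F' p (k x) = D1.bsum F p x" if "x \<in> topspace X" for p x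
    unfolding D1.bsum_def D2.bsum_def using F[OF D1.pow_topspace[OF that]] k_pow[OF that] by simp
  have "(r ^^ p) (k x) = (r ^^ q) (k z)" using pq k_pow by metis
  then have "cocycle r F' (K \<gamma>) = cocycle s F \<gamma>"
    unfolding xz K_def using D1.cocycle_eq[OF pq(4,3)] D2.cocycle_eq[OF _ pq(3)] b pq by simp
  then show "exp (2 * of_real pi * \<i> * of_int (cocycle r F' (K \<gamma>)) * of_real t) =
      (exp (2 * of_real pi * \<i> * of_int (cocycle s F \<gamma>) * of_real t) :: complex)" by simp
qed

end

section \<open>The isomorphism induced by a conjugacy\<close>

context conjugacy
begin

lemma lift_conjugacy: "dr_conjugacy (X_top L1) shift (X_top L2) shift lift (conjugacy.lift L2 L1 g m)"
proof -
  interpret C: conjugacy N2 L2 N1 L1 g h m by (rule flip)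
  show ?thesis
    by unfold_locales (use lift_continuous C.lift_continuous lift_inverse C.lift_inverse lift_shift in auto)
qed

end

locale normal_conjugacy = normal_pair + conjugacy +
  assumes h_cont: "continuous_on S1.X h" and g_cont: "continuous_on S2.X g"
begin

sublocale T: dr_conjugacy "X_top L1" shift "X_top L2" shift lift "conjugacy.lift L2 L1 g m"
  by (rule lift_conjugacy)

lemma \<Psi>_diag_elem:
  assumes "\<And>x. x \<in> S1.X \<Longrightarrow> f' (h x) = f x" shows "T.\<Psi> (diag_elem L1 f) = diag_elem L2 f'"
  unfolding S1.diag_elem_eq S2.diag_elem_eq
  by (rule T.\<Psi>_diag) (use assms S1.labels_X labels_lift in simp)

lemma \<Psi>_D_alg: "T.\<Psi> ` D_alg L1 = D_alg L2"
proof (intro equalityI subsetI)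
  fix S assume "S \<in> T.\<Psi> ` D_alg L1"
  then obtain f where f: "continuous_on S1.X f" "S = T.\<Psi> (diag_elem L1 f)" unfolding S1.D_alg_eq by blast
  have "continuous_on S2.X (\<lambda>y. f (g y))" by (rule continuous_on_compose2[OF f(1) g_cont]) (use g_X in blast)
  moreover have "S = diag_elem L2 (\<lambda>y. f (g y))" unfolding f(2) by (rule \<Psi>_diag_elem) (simp add: gh)
  ultimately show "S \<in> D_alg L2" unfolding S2.D_alg_eq by blast
next
  fix S assume "S \<in> D_alg L2"
  then obtain f where f: "continuous_on S2.X f" "S = diag_elem L2 f" unfolding S2.D_alg_eq by blast
  have "continuous_on S1.X (\<lambda>y. f (h y))" by (rule continuous_on_compose2[OF f(1) h_cont]) (use h_X in blast)
  moreover have "S = T.\<Psi> (diag_elem L1 (\<lambda>y. f (h y)))" unfolding f(2) by (rule \<Psi>_diag_elem[symmetric]) simp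
  ultimately show "S \<in> T.\<Psi> ` D_alg L1" unfolding S1.D_alg_eq by blast
qed

text \<open>The definite description has one solution: the diagonal operator determines an integer
  function on \<open>X\<close>, and extensionality fixes it elsewhere.\<close>

lemma image_potential_eq:
  assumes "f \<in> CZ L1"
  shows "image_potential L1 L2 T.\<Psi> f = restrict (\<lambda>y. f (g y)) S2.X" "continuous_on S2.X (restrict (\<lambda>y. f (g y)) S2.X)"
proof -
  have "continuous_on S2.X (\<lambda>y. f (g y))"
    by (rule continuous_on_compose2[OF _ g_cont]) (use assms g_X in \<open>auto simp: CZ_def\<close>)
  then show c: "continuous_on S2.X (restrict (\<lambda>y. f (g y)) S2.X)" by (simp cong: continuous_on_cong)
  have \<Psi>f: "T.\<Psi> (diag_elem L1 (\<lambda>x. of_int (f x))) = diag_elem L2 (\<lambda>y. of_int (restrict (\<lambda>y. f (g y)) S2.X y))"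
    by (rule \<Psi>_diag_elem) (simp add: gh h_X)
  show "image_potential L1 L2 T.\<Psi> f = restrict (\<lambda>y. f (g y)) S2.X"
    unfolding image_potential_def \<Psi>f
  proof (rule the_equality)
    show "restrict (\<lambda>y. f (g y)) S2.X \<in> CZ L2 \<and>
        diag_elem L2 (\<lambda>y. of_int (restrict (\<lambda>y. f (g y)) S2.X y)) = diag_elem L2 (\<lambda>y. of_int (restrict (\<lambda>y. f (g y)) S2.X y))"
      using c by (simp add: CZ_def)
    fix q assume q: "q \<in> CZ L2 \<and> diag_elem L2 (\<lambda>y. of_int (q y)) = diag_elem L2 (\<lambda>y. of_int (restrict (\<lambda>y. f (g y)) S2.X y))"
    then have "\<forall>y\<in>S2.X. complex_of_int (q y) = of_int (restrict (\<lambda>y. f (g y)) S2.X y)" unfolding S2.diag_elem_eq_iff by blast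
    then have "\<forall>y\<in>S2.X. q y = restrict (\<lambda>y. f (g y)) S2.X y" by simp
    then show "q = restrict (\<lambda>y. f (g y)) S2.X" using q unfolding CZ_def by (auto intro: extensionalityI)
  qed
qed

text \<open>Gauge unitaries need not lie in the reduced algebra, so multiplicativity is taken from
  \<open>\<Psi>_comp\<close>, which holds for operators at large.\<close>

lemma \<Psi>_gauge_action:
  assumes f: "f \<in> CZ L1" and T: "T \<in> O_min L1"
  shows "T.\<Psi> (gauge_action L1 f t T) = gauge_action L2 (image_potential L1 L2 T.\<Psi> f) t (T.\<Psi> T)"
proof -
  let ?f' = "restrict (\<lambda>y. f (g y)) S2.X"
  let ?U = "\<lambda>t. gauge_unitary (X_top L1) shift (f \<circ> labels) t" and ?U' = "\<lambda>t. gauge_unitary (X_top L2) shift (?f' \<circ> labels) t"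
  have cf: "continuous_on S1.X f" using f unfolding CZ_def by blast
  note p1 = S1.potential_open[OF cf] and p2 = S2.potential_open[OF image_potential_eq(2)[OF f]]
  have U: "T.\<Psi> (?U t) = ?U' t" for t
    by (rule T.\<Psi>_gauge) (use S1.labels_X labels_lift h_X gh in simp)
  have TR: "T \<in> reduced_cstar (X_top L1) shift" using T unfolding O_min_def .
  have U0: "?U t (\<lambda>_. 0) = (\<lambda>_. 0)" for t unfolding gauge_unitary_def restrict_op_def by auto
  have T0: "T (\<lambda>_. 0) = (\<lambda>_. 0)" by (rule T.adjointable_zero[OF S1.reducedD(1)[OF TR]])
  have Uo: "?U t \<in> operators (X_top L1) shift" for t by (rule S1.gauge_wop(2)[OF p1])
  have "T.\<Psi> (?U t \<circ> (T \<circ> ?U (- t))) = T.\<Psi> (?U t) \<circ> (T.\<Psi> T \<circ> T.\<Psi> (?U (- t)))"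
    using T.\<Psi>_comp[where S = "?U t" and T = "T \<circ> ?U (- t)", OF S1.operator_comp[OF S1.reducedD(2)[OF TR] Uo T0] U0]
      T.\<Psi>_comp[where S = T and T = "?U (- t)", OF Uo T0] by (simp only:)
  then show ?thesis unfolding gauge_action_def Let_def image_potential_eq(1)[OF f] S1.gauge_wop(3)[OF p1] S2.gauge_wop(3)[OF p2]
    by (simp only: U comp_assoc)
qed

end

theorem theorem1p5:
  fixes N1 N2 :: nat and L1 L2 :: "(int \<Rightarrow> nat) set"
  assumes "normal_subshift N1 L1" and "normal_subshift N2 L2"
  shows "one_sided_conjugate L1 L2 \<longleftrightarrow>
    (\<exists>\<Phi>. cstar_isomorphism (X_top L1) shift (X_top L2) shift \<Phi> \<and>
         \<Phi> ` D_alg L1 = D_alg L2 \<and>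
         (\<forall>f\<in>CZ L1. \<forall>t::real. \<forall>T\<in>O_min L1.
            \<Phi> (gauge_action L1 f t T) = gauge_action L2 (image_potential L1 L2 \<Phi> f) t (\<Phi> T)))"
proof
  interpret normal_pair N1 L1 N2 L2 using assms by unfold_locales
  assume "one_sided_conjugate L1 L2"
  then obtain h where h: "homeomorphic_map (top_of_set S1.X) (top_of_set S2.X) h"
    "\<And>x. x \<in> S1.X \<Longrightarrow> h (shift x) = shift (h x)" unfolding one_sided_conjugate_def by blast
  then obtain g where hg: "homeomorphic_maps (top_of_set S1.X) (top_of_set S2.X) h g"
    using homeomorphic_map_maps by blast
  have c: "continuous_on S1.X h" "continuous_on S2.X g" "\<And>x. x \<in> S1.X \<Longrightarrow> h x \<in> S2.X" "\<And>y. y \<in> S2.X \<Longrightarrow> g y \<in> S1.X"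
    "\<And>x. x \<in> S1.X \<Longrightarrow> g (h x) = x" "\<And>y. y \<in> S2.X \<Longrightarrow> h (g y) = y"
    using hg unfolding homeomorphic_maps_def by (auto simp: continuous_map_in_subtopology)
  \<comment> \<open>Natural numbers at distance less than 1 are equal, so uniform continuity of the
    first letter with error 1 yields the window of a block code, as in the Curtis--Hedlund--Lyndon
    theorem.\<close>
  have d: "dist (real a) (real b) < 1 \<longleftrightarrow> a = b" for a b by (auto simp: dist_real_def)
  note c0 = continuous_on_product_then_coordinatewise[OF c(1)] continuous_on_product_then_coordinatewise[OF c(2)]
  obtain m1 where m1: "\<And>x y. x \<in> S1.X \<Longrightarrow> y \<in> S1.X \<Longrightarrow> pre m1 x = pre m1 y \<Longrightarrow> h x 0 = h y 0"
    using S1.uniform_prefix[OF S1.continuous_on_discrete_comp[OF c0(1)[of 0], of real] zero_less_one] unfolding d by blast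
  obtain m2 where m2: "\<And>x y. x \<in> S2.X \<Longrightarrow> y \<in> S2.X \<Longrightarrow> pre m2 x = pre m2 y \<Longrightarrow> g x 0 = g y 0"
    using S2.uniform_prefix[OF S2.continuous_on_discrete_comp[OF c0(2)[of 0], of real] zero_less_one] unfolding d by blast
  interpret normal_conjugacy N1 L1 N2 L2 h g "max m1 m2"
  proof unfold_locales
    show "h x 0 = h y 0" if "x \<in> S1.X" "y \<in> S1.X" "pre (max m1 m2) x = pre (max m1 m2) y" for x y
      using m1[OF that(1,2) pre_mono[OF that(3)]] by simp
    show "g x 0 = g y 0" if "x \<in> S2.X" "y \<in> S2.X" "pre (max m1 m2) x = pre (max m1 m2) y" for x y
      using m2[OF that(1,2) pre_mono[OF that(3)]] by simp
  qed (fact c h(2))+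
  show "\<exists>\<Phi>. cstar_isomorphism (X_top L1) shift (X_top L2) shift \<Phi> \<and>
         \<Phi> ` D_alg L1 = D_alg L2 \<and>
         (\<forall>f\<in>CZ L1. \<forall>t::real. \<forall>T\<in>O_min L1.
            \<Phi> (gauge_action L1 f t T) = gauge_action L2 (image_potential L1 L2 \<Phi> f) t (\<Phi> T))"
    by (intro exI[of _ T.\<Psi>] conjI ballI allI T.\<Psi>_isomorphism \<Psi>_D_alg \<Psi>_gauge_action)
next
  assume "\<exists>\<Phi>. cstar_isomorphism (X_top L1) shift (X_top L2) shift \<Phi> \<and>
         \<Phi> ` D_alg L1 = D_alg L2 \<and>
         (\<forall>f\<in>CZ L1. \<forall>t::real. \<forall>T\<in>O_min L1.
            \<Phi> (gauge_action L1 f t T) = gauge_action L2 (image_potential L1 L2 \<Phi> f) t (\<Phi> T))"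
  then obtain \<Phi> where \<Phi>: "cstar_isomorphism (X_top L1) shift (X_top L2) shift \<Phi>" "\<Phi> ` D_alg L1 = D_alg L2"
    "\<And>f t T. f \<in> CZ L1 \<Longrightarrow> T \<in> O_min L1 \<Longrightarrow>
      \<Phi> (gauge_action L1 f t T) = gauge_action L2 (image_potential L1 L2 \<Phi> f) t (\<Phi> T)" by metis
  interpret diagonal_isomorphism N1 L1 N2 L2 \<Phi>
    by unfold_locales (fact assms \<Phi>)+
  show "one_sided_conjugate L1 L2" by (rule one_sided_conjugate)
qed

end
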